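(* There is a $2\pi$-periodic traveling wave $\varphi$ of the Burgers–Hilbert equation, i.e. a $2\pi$-periodic solution $\varphi$ of $$-c\,\varphi'+\varphi\,\varphi'=\mathbf{H}[\varphi],$$ which behaves asymptotically at $x=0$ as $$\varphi(x)=c+\frac1\pi|x|\log|x|+\mathcal{O}\!\left(|x|\sqrt{|\log|x||}\right).$$
   Context: $\mathbf{H}$ is the periodic Hilbert transform: for $f:\mathbb{T}\to\mathbb{R}$, $\mathbb{T}=\mathbb{R}/2\pi\mathbb{Z}$, $$\mathbf{H}[f](x)=\frac1{2\pi}\,\mathrm{p.v.}\!\int_{-\pi}^{\pi}\cot\!\left(\frac{x-y}{2}\right)f(y)\,dy,\qquad \widehat{\mathbf{H}[f]}(k)=-i\,\mathrm{sgn}(k)\hat f(k).$$ The Burgers–Hilbert equation is $f_t+ff_x=\mathbf{H}[f]$ for $(x,t)\in\mathbb{T}\times\mathbb{R}$. The traveling wave assumption $f(x,t)=\varphi(x-ct)$, where $c>0$ denotes the wave speed, gives the equation for $\varphi$ in the claim. *)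

theory Defs
  imports "HOL-Analysis.Analysis" "HOL-Library.Landau_Symbols"
begin

text \<open>
  Functions on the circle \<open>\<real> / 2\<pi>\<int>\<close> are rendered as \<open>2\<pi>\<close>-periodic functions on the reals.
\<close>

definition two_pi_periodic :: "(real \<Rightarrow> real) \<Rightarrow> bool" where
  "two_pi_periodic f \<longleftrightarrow> (\<forall>x. f (x + 2 * pi) = f x)"

text \<open>
  For the principal value, the singularity of \<open>cot ((x - y) / 2)\<close> in \<open>y\<close> is at every point
  congruent to \<open>x\<close> modulo \<open>2\<pi>\<close>. The points of \<open>[-\<pi>, \<pi>]\<close> removed are therefore those whose
  distance to \<open>x\<close> on the circle is at most \<open>\<epsilon>\<close>; this also covers \<open>x\<close> outside \<open>(-\<pi>, \<pi>)\<close>.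
\<close>

definition pv_domain :: "real \<Rightarrow> real \<Rightarrow> real set" where
  "pv_domain x \<epsilon> = {y \<in> {-pi..pi}. \<forall>k::int. \<epsilon> < \<bar>x - y - 2 * pi * of_int k\<bar>}"

text \<open>
  \<open>has_hilbert_transform f x L\<close>: the principal value defining \<open>\<^bold>H[f](x)\<close> exists and equals \<open>L\<close>.
  The integrability condition excludes the default value 0 of the integral of a
  non-integrable function.
\<close>

definition has_hilbert_transform :: "(real \<Rightarrow> real) \<Rightarrow> real \<Rightarrow> real \<Rightarrow> bool" where
  "has_hilbert_transform f x L \<longleftrightarrow>
     (\<forall>\<epsilon>>0. set_integrable lborel (pv_domain x \<epsilon>) (\<lambda>y. cot ((x - y) / 2) * f y)) \<and>
     ((\<lambda>\<epsilon>. 1 / (2 * pi) * (LBINT y:pv_domain x \<epsilon>. cot ((x - y) / 2) * f y)) \<longlongrightarrow> L) (at_right 0)"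

text \<open>
  The profile equation \<open>- c \<phi>' + \<phi> \<phi>' = \<^bold>H[\<phi>]\<close> on a set \<open>S\<close>, in the classical pointwise sense.
  If \<open>\<phi>\<close> is continuous and periodic and the complement of \<open>S\<close> is countable, then
  \<open>(\<phi> - c)\<^sup>2 / 2\<close> is locally absolutely continuous, because its derivative \<open>\<^bold>H[\<phi>]\<close> is
  locally integrable, and so \<open>\<phi>\<close> is also a distributional solution on the whole circle.
\<close>

definition burgers_hilbert_profile_on :: "real set \<Rightarrow> real \<Rightarrow> (real \<Rightarrow> real) \<Rightarrow> bool" where
  "burgers_hilbert_profile_on S c \<phi> \<longleftrightarrow>
     (\<forall>x\<in>S. \<exists>d. (\<phi> has_real_derivative d) (at x) \<and>
                has_hilbert_transform \<phi> x (- c * d + \<phi> x * d))"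

end

theory Submission
  imports Defs "HOL-Complex_Analysis.Great_Picard"
begin

text \<open>
  Constants are annihilated by the Hilbert transform, so with \<open>\<phi> = c - (2/\<pi>) u\<close> the equation
  integrates to \<open>u\<^sup>2 = B u\<close>, where \<open>B u\<close> (\<open>pot_rise u\<close> below) is the increase from \<open>0\<close> of the potential
  of \<open>u\<close> with kernel \<open>- ln \<bar>sin (z/2)\<bar>\<close>; the speed \<open>c\<close> is arbitrary. Folding the potential about the
  midpoint of two points shows that \<open>B\<close> preserves the even functions that increase on \<open>[0, \<pi>]\<close>, and bounds
  \<open>B u\<close> from below by the first Fourier mode \<open>N u\<close>. As \<open>B\<close> is linear, \<open>u\<^sup>2 = B u\<close> is equivalent, up to a
  factor, to a fixed point of \<open>u \<mapsto> sqrt (B u) / N (sqrt (B u))\<close>. This map leaves a compact convex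
  set of increasing functions with \<open>N u = 1\<close> invariant: the logarithmic singularity of the kernel makes the
  bound on the maximum sublinear. Schauder's theorem gives \<open>u\<close>.

  Where \<open>u > 0\<close>, \<open>u\<close> is Hoelder continuous of order \<open>3/4\<close>, hence the potential is differentiable there with
  the conjugate function as derivative. Near \<open>0\<close> the equation reads
  \<open>(u x / x)\<^sup>2 = \<Psi> x + O(ln x)\<close> with \<open>\<Psi> x = \<integral>\<^sub>x\<^sup>\<pi> u y / y\<^sup>2 dy\<close>; in the variable \<open>t = - ln x\<close> this is a
  differential equation for \<open>sqrt \<Psi>\<close>, whose slope tends to \<open>1/2\<close>.
\<close>

subsection \<open>Schauder fixed point theorem\<close>

text \<open>The zero function also solves \<open>u ^ 2 = pot_rise u\<close>, so the fixed point must
  be kept away from it. The normalisation uses \<open>first_mode\<close> because it is linear, so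
  that \<open>first_mode u = 1\<close> is a closed convex condition, and because the positive kernel
  transmits it: the first mode of \<open>pot_rise u\<close> is at least pi/8 times that of
  \<open>u\<close>, which bounds the normalising factor by the maximum. The factor 2/\<pi> comes
  from H[u] = - (1/\<pi>) (log_pot u)'. Since \<open>u\<close> is recovered from its square, the
  Hoelder constants obtained contain 1 / u x, and the equation is derived off the zeros of
  \<open>u\<close>. With w = u x / x, the derivative of \<Psi> in t is w itself and w^2 is close to
  \<Psi>. So sqrt \<Psi> has slope w / (2 sqrt \<Psi>), about 1/2, u x is about x t / 2, and 2/\<pi>
  times this is the stated term. The obstacle is that the upper estimate for u x involves u (2 x)
  and values farther out; an a priori bound u x = O(x \<bar>ln x\<bar>) has to come first.\<close>

text \<open>
  The dimension \<open>n\<close> varies with the accuracy in Schauder's theorem, so Brouwer's theorem for a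
  \<open>euclidean_space\<close> type does not apply; Kuhn's lemma works for every \<open>n\<close>.
\<close>

lemma approximate_brouwer_cube:
  fixes g :: "(nat \<Rightarrow> real) \<Rightarrow> nat \<Rightarrow> real"
  assumes g: "\<And>x i. \<lbrakk>\<forall>i<n. x i \<in> {0..1}; i < n\<rbrakk> \<Longrightarrow> g x i \<in> {0..1}"
    and "0 < d" "0 < e"
    and unif: "\<And>x y i. \<lbrakk>\<forall>i<n. x i \<in> {0..1}; \<forall>i<n. y i \<in> {0..1}; \<forall>i<n. \<bar>x i - y i\<bar> \<le> d; i < n\<rbrakk>
                 \<Longrightarrow> \<bar>g x i - g y i\<bar> \<le> e"
  obtains x where "\<forall>i<n. x i \<in> {0..1}" "\<forall>i<n. \<bar>g x i - x i\<bar> \<le> 2 * e"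
proof -
  obtain p :: nat where p: "inverse (real p) < min d e" "p > 0"
    using ex_inverse_of_nat_less[of "min d e"] assms(2,3) by auto
  define pt where "pt x = (\<lambda>i. real (x i) / real p)" for x :: "nat \<Rightarrow> nat"
  \<comment> \<open>The label of a grid point tells in which direction \<open>g\<close> moves its
    i-th coordinate. On the two faces it is forced to the value that Kuhn's lemma demands, which
    agrees with the direction because \<open>g\<close> stays in the cube.\<close>
  define label :: "(nat \<Rightarrow> nat) \<Rightarrow> nat \<Rightarrow> nat" where
    "label x i = (if x i = p then 1 else if x i = 0 then 0
                  else if pt x i \<le> g (pt x) i then 0 else 1)" for x i
  have pt_cube: "\<forall>i<n. pt x i \<in> {0..1}" if "\<forall>i<n. x i \<le> p" for x
    using that p(2) by (auto simp: pt_def divide_simps)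
  have label0: "pt x i \<le> g (pt x) i" if "\<forall>i<n. x i \<le> p" "i < n" "label x i = 0" for x i
    using g[OF pt_cube[OF that(1)] that(2)] that(3) p(2)
    by (auto simp: label_def pt_def split: if_splits)
  have label1: "g (pt x) i \<le> pt x i" if "\<forall>i<n. x i \<le> p" "i < n" "label x i = 1" for x i
    using g[OF pt_cube[OF that(1)] that(2)] that(3) p(2)
    by (auto simp: label_def pt_def split: if_splits)
  obtain q where q: "\<forall>i<n. q i < p"
    and rs: "\<forall>i<n. \<exists>r s. (\<forall>j<n. q j \<le> r j \<and> r j \<le> q j + 1) \<and>
                          (\<forall>j<n. q j \<le> s j \<and> s j \<le> q j + 1) \<and> label r i \<noteq> label s i"
    by (rule kuhn_lemma[of p n label]) (use p(2) in \<open>auto simp: label_def\<close>)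
  have near: "pt q i - e \<le> g (pt q) i"
    if r: "\<forall>j<n. q j \<le> r j \<and> r j \<le> q j + 1" and "i < n" "label r i = 0" for r i
  proof -
    have rp: "\<forall>i<n. r i \<le> p" using r q by (metis Suc_eq_plus1 Suc_leI le_trans)
    have qp: "\<forall>i<n. q i \<le> p" using q by auto
    have "\<forall>j<n. \<bar>pt q j - pt r j\<bar> \<le> d"
    proof (intro allI impI)
      fix j assume j: "j < n"
      have "\<bar>real (q j) - real (r j)\<bar> \<le> 1" using r j by force
      then have "\<bar>pt q j - pt r j\<bar> \<le> inverse (real p)"
        using p(2) by (simp add: pt_def divide_simps flip: diff_divide_distrib)
      then show "\<bar>pt q j - pt r j\<bar> \<le> d" using p(1) by linarith
    qed
    from unif[OF pt_cube[OF qp] pt_cube[OF rp] this that(2)] label0[OF rp that(2,3)]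
    have "pt r i - e \<le> g (pt q) i" by linarith
    moreover have "pt q i \<le> pt r i" using r that(2) by (auto simp: pt_def divide_right_mono)
    ultimately show ?thesis by linarith
  qed
  \<comment> \<open>The bound is \<open>2 * e\<close> here and \<open>e\<close> in
    \<open>near\<close>: the corner \<open>q\<close> lies below \<open>r\<close>, so the grid width,
    less than \<open>e\<close>, is lost only in this direction.\<close>
  have near': "g (pt q) i \<le> pt q i + 2 * e"
    if r: "\<forall>j<n. q j \<le> r j \<and> r j \<le> q j + 1" and "i < n" "label r i = 1" for r i
  proof -
    have rp: "\<forall>i<n. r i \<le> p" using r q by (metis Suc_eq_plus1 Suc_leI le_trans)
    have qp: "\<forall>i<n. q i \<le> p" using q by auto
    have *: "\<forall>j<n. \<bar>pt q j - pt r j\<bar> \<le> inverse (real p)"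
    proof (intro allI impI)
      fix j assume j: "j < n"
      have "\<bar>real (q j) - real (r j)\<bar> \<le> 1" using r j by force
      then show "\<bar>pt q j - pt r j\<bar> \<le> inverse (real p)"
        using p(2) by (simp add: pt_def divide_simps flip: diff_divide_distrib)
    qed
    then have "\<forall>j<n. \<bar>pt q j - pt r j\<bar> \<le> d" using p(1) by fastforce
    from unif[OF pt_cube[OF qp] pt_cube[OF rp] this that(2)] label1[OF rp that(2,3)]
    show ?thesis using *[rule_format, OF that(2)] p(1) by linarith
  qed
  have label_cases: "label r i = 0 \<or> label r i = 1" for r i by (simp add: label_def)
  have "\<forall>i<n. \<bar>g (pt q) i - pt q i\<bar> \<le> 2 * e"
  proof (intro allI impI)
    fix i assume i: "i < n"
    with rs obtain r s where "\<forall>j<n. q j \<le> r j \<and> r j \<le> q j + 1" "\<forall>j<n. q j \<le> s j \<and> s j \<le> q j + 1"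
      "label r i \<noteq> label s i" by blast
    then show "\<bar>g (pt q) i - pt q i\<bar> \<le> 2 * e"
      using near[of r i] near[of s i] near'[of r i] near'[of s i] label_cases[of r i] label_cases[of s i] i \<open>0 < e\<close>
      by (smt (verit))
  qed
  moreover have "\<forall>i<n. pt q i \<in> {0..1}" using pt_cube q less_imp_le by blast
  ultimately show thesis using that by blast
qed

lemma finite_min_radius:
  assumes "\<And>i. i < (n::nat) \<Longrightarrow> \<exists>d>0::real. \<forall>d'\<in>{0<..d}. P i d'"
  shows "\<exists>d>0. \<forall>i<n. P i d"
proof -
  obtain d where d: "\<And>i. i < n \<Longrightarrow> d i > 0 \<and> (\<forall>d'\<in>{0<..d i}. P i d')"
    using assms by metis
  define d0 where "d0 = Min (insert 1 (d ` {..<n}))"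
  have "d0 > 0" unfolding d0_def using d by (subst Min_gr_iff) auto
  moreover have "d0 \<le> d i" if "i < n" for i unfolding d0_def using that by (intro Min_le) auto
  ultimately show ?thesis using d by (intro exI[of _ d0]) auto
qed

text \<open>A partition of unity subordinate to an e/2-net moves every point of \<open>S\<close> by
  at most e/2 and describes it by finitely many weights. Composed with \<open>f\<close> it gives a
  self-map of the cube of weights, whose approximate fixed points yield those of \<open>f\<close>.
  The whole cube is needed, so \<open>x\<close> below also assigns points of \<open>S\<close> to
  weights that do not sum to 1.\<close>

lemma schauder_approximate:
  fixes S :: "'a::real_normed_vector set"
  assumes S: "compact S" "convex S" "S \<noteq> {}"
    and f: "continuous_on S f" "f ` S \<subseteq> S" and e: "0 < e"
  obtains x where "x \<in> S" "norm (f x - x) \<le> e"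
proof -
  have "0 < e/2" using e by simp
  with seq_compact_imp_totally_bounded[OF compact_imp_seq_compact[OF S(1)]]
  obtain k where k: "finite k" "k \<subseteq> S" "S \<subseteq> (\<Union>x\<in>k. ball x (e/2))"
    by metis
  define n where "n = card k"
  obtain b where b: "bij_betw b {..<n} k"
    using ex_bij_betw_nat_finite[OF k(1)] unfolding n_def atLeast0LessThan by blast
  have bS: "b i \<in> S" if "i < n" for i using b k(2) that by (auto simp: bij_betw_def)
  have n0: "0 < n"
    using S(3) k by (auto simp: n_def card_gt_0_iff)
  obtain B where B: "B > 0" "\<And>x. x \<in> S \<Longrightarrow> norm x \<le> B"
    using compact_imp_bounded[OF S(1)] by (auto simp: bounded_pos)

  define \<phi> where "\<phi> i y = max 0 (e/2 - dist (b i) y)" for i y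
  define \<Phi> where "\<Phi> y = (\<Sum>i<n. \<phi> i y)" for y
  have \<phi>_nonneg: "0 \<le> \<phi> i y" for i y by (simp add: \<phi>_def)
  have \<Phi>_pos: "0 < \<Phi> y" if "y \<in> S" for y
  proof -
    obtain c where "c \<in> k" "dist c y < e/2" using subsetD[OF k(3) \<open>y \<in> S\<close>] by auto
    then obtain i where "i < n" "dist (b i) y < e/2" using b by (auto simp: bij_betw_def)
    then have "0 < \<phi> i y" by (simp add: \<phi>_def)
    then show ?thesis unfolding \<Phi>_def using \<open>i < n\<close> \<phi>_nonneg by (intro sum_pos2[of _ i]) auto
  qed
  define P where "P i y = \<phi> i y / \<Phi> y" for i y
  have P_sum: "(\<Sum>i<n. P i y) = 1" if "y \<in> S" for y
    using \<Phi>_pos[OF that] by (simp add: P_def \<Phi>_def flip: sum_divide_distrib)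
  have P_nonneg: "0 \<le> P i y" if "y \<in> S" for i y
    using \<Phi>_pos[OF that] \<phi>_nonneg by (simp add: P_def)
  have P_le1: "P i y \<le> 1" if "y \<in> S" "i < n" for i y
    using member_le_sum[of i "{..<n}" "\<lambda>i. P i y"] P_sum[OF that(1)] P_nonneg[OF that(1)] that(2) by simp
  have P_cont: "continuous_on S (P i)" for i
    unfolding P_def \<phi>_def \<Phi>_def
    by (intro continuous_intros) (use \<Phi>_pos in \<open>auto simp: \<Phi>_def \<phi>_def less_imp_neq[symmetric]\<close>)
  have P_near: "norm (y - (\<Sum>i<n. P i y *\<^sub>R b i)) \<le> e/2" if "y \<in> S" for y
  proof -
    have "y - (\<Sum>i<n. P i y *\<^sub>R b i) = (\<Sum>i<n. P i y *\<^sub>R (y - b i))"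
      using P_sum[OF that] by (simp add: scaleR_diff_right sum_subtractf flip: scaleR_left.sum)
    also have "norm \<dots> \<le> (\<Sum>i<n. P i y * (e/2))"
    proof (rule sum_norm_le)
      fix i
      have "\<phi> i y * norm (y - b i) \<le> \<phi> i y * (e/2)"
      proof (cases "norm (y - b i) \<le> e/2")
        case True
        then show ?thesis using \<phi>_nonneg by (intro mult_left_mono)
      qed (simp add: \<phi>_def dist_norm norm_minus_commute)
      then show "norm (P i y *\<^sub>R (y - b i)) \<le> P i y * (e/2)"
        using \<Phi>_pos[OF that] \<phi>_nonneg[of i y] by (simp add: P_def divide_simps)
    qed
    also have "\<dots> = e/2" using P_sum[OF that] sum_distrib_right[of "\<lambda>i. P i y" "{..<n}" "e/2"] by simp
    finally show ?thesis .
  qed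

  \<comment> \<open>Weights of sum above 1 are divided by their sum \<open>m\<close>; weights of sum
    below 1 get the deficit \<open>t\<close> added at \<open>b 0\<close>. For sum 1 both corrections
    vanish.\<close>
  define m where "m z = max 1 (\<Sum>i<n. z i)" for z :: "nat \<Rightarrow> real"
  define t where "t z = max 0 (1 - (\<Sum>i<n. z i))" for z :: "nat \<Rightarrow> real"
  define a where "a z = (\<Sum>i<n. z i *\<^sub>R b i) + t z *\<^sub>R b 0" for z
  define x where "x z = (1 / m z) *\<^sub>R a z" for z
  have m1: "1 \<le> m z" for z by (simp add: m_def)
  have xS: "x z \<in> S" if "\<forall>i<n. z i \<in> {0..1}" for z
  proof -
    define c where "c i = (z i + (if i = 0 then t z else 0)) / m z" for i
    have "(\<Sum>i<n. c i) = ((\<Sum>i<n. z i) + (\<Sum>i<n. if i = 0 then t z else 0)) / m z"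
      by (simp add: c_def sum.distrib flip: sum_divide_distrib)
    also have "\<dots> = 1" using n0 by (auto simp: t_def m_def max_def)
    finally have c1: "(\<Sum>i<n. c i) = 1" .
    have "(\<Sum>i<n. c i *\<^sub>R b i) \<in> S"
      by (rule convex_sum[OF _ S(2) c1]) (use bS that m1 in \<open>auto simp: c_def t_def divide_nonneg_pos m_def\<close>)
    also have "(\<Sum>i<n. c i *\<^sub>R b i) = (1 / m z) *\<^sub>R ((\<Sum>i<n. z i *\<^sub>R b i) + (\<Sum>i<n. (if i = 0 then t z else 0) *\<^sub>R b i))"
      by (simp add: c_def scaleR_add_left scaleR_sum_right add_divide_distrib sum.distrib[symmetric]
          scaleR_add_right)
    also have "(\<Sum>i<n. (if i = 0 then t z else 0) *\<^sub>R b i) = t z *\<^sub>R b 0"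
      using n0 by (simp add: if_distrib[of "\<lambda>c. c *\<^sub>R _"] cong: if_cong)
    finally show ?thesis by (simp add: x_def a_def)
  qed
  \<comment> \<open>Three perturbations of size \<open>n * d * B\<close> each: the weights
    themselves, the deficit, and the normalising denominator.\<close>
  have x_lip: "norm (x z - x w) \<le> 3 * real n * d * B"
    if z: "\<forall>i<n. z i \<in> {0..1}" and w: "\<forall>i<n. w i \<in> {0..1}" and d: "\<forall>i<n. \<bar>z i - w i\<bar> \<le> d" for z w d
  proof -
    have d0: "0 \<le> d" using d[rule_format, OF n0] by simp
    have "\<bar>(\<Sum>i<n. z i) - (\<Sum>i<n. w i)\<bar> \<le> (\<Sum>i<n. \<bar>z i - w i\<bar>)"
      by (simp add: sum_abs flip: sum_subtractf)
    also have "\<dots> \<le> real n * d" using d sum_bounded_above[of "{..<n}" "\<lambda>i. \<bar>z i - w i\<bar>" d] by auto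
    finally have s: "\<bar>(\<Sum>i<n. z i) - (\<Sum>i<n. w i)\<bar> \<le> real n * d" .
    have mm: "\<bar>m w - m z\<bar> \<le> real n * d" and tt: "\<bar>t z - t w\<bar> \<le> real n * d"
      using s by (auto simp: m_def t_def)
    have "norm (\<Sum>i<n. (z i - w i) *\<^sub>R b i) \<le> (\<Sum>i<n. d * B)"
      by (rule sum_norm_le) (use d d0 B bS in \<open>auto intro!: mult_mono\<close>)
    moreover have "norm ((t z - t w) *\<^sub>R b 0) \<le> real n * d * B"
      using tt B(2)[OF bS[OF n0]] d0 by (auto intro!: mult_mono)
    moreover have "a z - a w = (\<Sum>i<n. (z i - w i) *\<^sub>R b i) + (t z - t w) *\<^sub>R b 0"
      by (simp add: a_def scaleR_diff_left sum_subtractf)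
    ultimately have aa: "norm (a z - a w) \<le> 2 * (real n * d * B)"
      using norm_triangle_ineq[of "\<Sum>i<n. (z i - w i) *\<^sub>R b i" "(t z - t w) *\<^sub>R b 0"] by simp
    have aw: "a w = m w *\<^sub>R x w" using m1[of w] by (simp add: x_def)
    have "x z = (1 / m z) *\<^sub>R (a z - a w) + (1 / m z) *\<^sub>R a w"
      by (simp add: x_def flip: scaleR_add_right)
    then have "x z = (1 / m z) *\<^sub>R (a z - a w) + (m w / m z) *\<^sub>R x w" by (simp add: aw)
    then have "x z - x w = (1 / m z) *\<^sub>R (a z - a w) + ((m w - m z) / m z) *\<^sub>R x w"
      using m1[of z] by (simp add: diff_divide_distrib scaleR_diff_left)
    then have "norm (x z - x w) \<le> norm (a z - a w) / m z + \<bar>m w - m z\<bar> / m z * norm (x w)"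
      using norm_triangle_ineq[of "(1 / m z) *\<^sub>R (a z - a w)" "((m w - m z) / m z) *\<^sub>R x w"] m1[of z]
      by (simp add: abs_of_pos)
    also have "\<dots> \<le> norm (a z - a w) + \<bar>m w - m z\<bar> * norm (x w)"
      using m1[of z] by (intro add_mono mult_right_mono) (simp_all add: divide_le_eq mult_left_le mult_le_cancel_left1)
    also have "\<dots> \<le> 2 * (real n * d * B) + real n * d * B"
      using aa mm B(2)[OF xS[OF w]] d0 by (intro add_mono mult_mono) auto
    finally show ?thesis by (simp add: algebra_simps)
  qed

  \<comment> \<open>Chosen so that the Lipschitz estimate turns the error \<open>2 * e'\<close> of
    the weights into e/2; the net accounts for the other e/2.\<close>
  define e' where "e' = e / (12 * real n * B)"
  have e': "e' > 0" using e n0 B(1) by (simp add: e'_def)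
  have "\<exists>d>0. \<forall>i<n. \<forall>y\<in>S. \<forall>y'\<in>S. norm (y - y') \<le> d \<longrightarrow> \<bar>P i (f y) - P i (f y')\<bar> \<le> e'"
  proof (rule finite_min_radius)
    fix i
    have "continuous_on S (\<lambda>y. P i (f y))"
      using continuous_on_compose2[OF P_cont f(1)] f(2) by auto
    then have "uniformly_continuous_on S (\<lambda>y. P i (f y))"
      using S(1) compact_uniformly_continuous by blast
    then obtain d where "d > 0" "\<And>y y'. \<lbrakk>y \<in> S; y' \<in> S; dist y' y < d\<rbrakk> \<Longrightarrow> dist (P i (f y')) (P i (f y)) < e'"
      using e' unfolding uniformly_continuous_on_def by metis
    then show "\<exists>d>0. \<forall>d'\<in>{0<..d}. \<forall>y\<in>S. \<forall>y'\<in>S. norm (y - y') \<le> d' \<longrightarrow> \<bar>P i (f y) - P i (f y')\<bar> \<le> e'"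
      by (intro exI[of _ "d/2"]) (force simp: dist_norm)
  qed
  then obtain d where d: "d > 0" "\<And>i y y'. \<lbrakk>i < n; y \<in> S; y' \<in> S; norm (y - y') \<le> d\<rbrakk> \<Longrightarrow> \<bar>P i (f y) - P i (f y')\<bar> \<le> e'"
    by blast
  have fS: "f y \<in> S" if "y \<in> S" for y using f(2) that by auto
  obtain z where z: "\<forall>i<n. z i \<in> {0..1}" "\<forall>i<n. \<bar>P i (f (x z)) - z i\<bar> \<le> 2 * e'"
  proof (rule approximate_brouwer_cube[of n "\<lambda>z i. P i (f (x z))" "d / (3 * real n * B)" e'])
    show "P i (f (x z)) \<in> {0..1}" if "\<forall>i<n. z i \<in> {0..1}" "i < n" for z i
      using P_nonneg P_le1 fS xS that by auto
    show "d / (3 * real n * B) > 0" using d n0 B by simp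
    show "\<bar>P i (f (x z)) - P i (f (x w))\<bar> \<le> e'"
      if "\<forall>i<n. z i \<in> {0..1}" "\<forall>i<n. w i \<in> {0..1}" "\<forall>i<n. \<bar>z i - w i\<bar> \<le> d / (3 * real n * B)" "i < n" for z w i
      proof (rule d(2)[OF that(4) xS[OF that(1)] xS[OF that(2)]])
      have "3 * real n * (d / (3 * real n * B)) * B = d" using n0 B(1) by simp
      then show "norm (x z - x w) \<le> d" using x_lip[OF that(1-3)] by simp
    qed
  qed (use e' in auto)
  define p where "p i = P i (f (x z))" for i
  have fx: "f (x z) \<in> S" using fS xS z(1) by auto
  have p: "\<forall>i<n. p i \<in> {0..1}" using P_nonneg P_le1 fx by (auto simp: p_def)
  have "x p = (\<Sum>i<n. p i *\<^sub>R b i)" using P_sum[OF fx] by (simp add: x_def a_def m_def t_def p_def)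
  then have "norm (f (x z) - x p) \<le> e/2" using P_near[OF fx] by (simp add: p_def)
  moreover have "norm (x p - x z) \<le> 3 * real n * (2 * e') * B"
    by (rule x_lip[OF p z(1)]) (use z(2) in \<open>simp add: p_def\<close>)
  moreover have "3 * real n * (2 * e') * B = e/2" using n0 B(1) by (simp add: e'_def)
  ultimately have "norm (f (x z) - x z) \<le> e"
    using norm_triangle_ineq[of "f (x z) - x p" "x p - x z"] by simp
  then show thesis using that xS[OF z(1)] by blast
qed

text \<open>By compactness the displacement attains its minimum, which approximate fixed points
  force below every positive number; no limit of approximate fixed points has to be taken.\<close>

theorem schauder_fixpoint:
  fixes S :: "'a::real_normed_vector set"
  assumes S: "compact S" "convex S" "S \<noteq> {}"
    and f: "continuous_on S f" "f ` S \<subseteq> S"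
  obtains x where "x \<in> S" "f x = x"
proof -
  have "continuous_on S (\<lambda>x. norm (f x - x))" by (intro continuous_intros f)
  from continuous_attains_inf[OF S(1,3) this] obtain x
    where x: "x \<in> S" "\<And>y. y \<in> S \<Longrightarrow> norm (f x - x) \<le> norm (f y - y)" by blast
  have "norm (f x - x) \<le> e" if e: "0 < e" for e
  proof -
    obtain y where "y \<in> S" "norm (f y - y) \<le> e" using schauder_approximate[OF S f e] by metis
    with x(2) show ?thesis by fastforce
  qed
  then have "f x = x" using field_le_epsilon[of "norm (f x - x)" 0] by simp
  then show thesis using that x(1) by blast
qed

subsection \<open>Integrals of periodic functions\<close>

lemma set_integral_affine:
  fixes f :: "real \<Rightarrow> real"
  assumes "\<bar>c\<bar> = 1"
  shows "set_integrable lborel S f \<longleftrightarrow> set_integrable lborel ((\<lambda>s. t + c * s) -` S) (\<lambda>s. f (t + c * s))"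
    and "(LBINT y:S. f y) = (LBINT s:((\<lambda>s. t + c * s) -` S). f (t + c * s))"
proof -
  have c: "c \<noteq> 0" using assms by auto
  have ind: "indicat_real ((\<lambda>s. t + c * s) -` S) s = indicat_real S (t + c * s)" for s
    by (simp add: indicator_def)
  show "set_integrable lborel S f \<longleftrightarrow> set_integrable lborel ((\<lambda>s. t + c * s) -` S) (\<lambda>s. f (t + c * s))"
    unfolding set_integrable_def ind
    using lborel_integrable_real_affine_iff[OF c, where f = "\<lambda>y. indicat_real S y *\<^sub>R f y" and t = t] by simp
  show "(LBINT y:S. f y) = (LBINT s:((\<lambda>s. t + c * s) -` S). f (t + c * s))"
    unfolding set_lebesgue_integral_def ind
    using lborel_integral_real_affine[OF c, where f = "\<lambda>y. indicat_real S y *\<^sub>R f y" and t = t] assms by simp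
qed

lemma vimage_shift_Icc: "(\<lambda>s::real. t + 1 * s) -` {a..b} = {a - t..b - t}"
  and vimage_reflect_Icc: "(\<lambda>s::real. t + (-1) * s) -` {a..b} = {t - b..t - a}"
  by auto

lemmas set_integrable_shift = set_integral_affine(1)[where c = 1 and S = "{a..b}" for a b, simplified vimage_shift_Icc]
  and set_integral_shift = set_integral_affine(2)[where c = 1 and S = "{a..b}" for a b, simplified vimage_shift_Icc]
  and set_integrable_reflect = set_integral_affine(1)[where c = "-1" and S = "{a..b}" for a b, simplified vimage_reflect_Icc]
  and set_integral_reflect = set_integral_affine(2)[where c = "-1" and S = "{a..b}" for a b, simplified vimage_reflect_Icc]

lemma set_integral_combine_Icc:
  fixes f :: "real \<Rightarrow> real"
  assumes "a \<le> b" "b \<le> c" "set_integrable lborel {a..b} f" "set_integrable lborel {b..c} f"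
  shows "set_integrable lborel {a..c} f"
    and "(LBINT x:{a..c}. f x) = (LBINT x:{a..b}. f x) + (LBINT x:{b..c}. f x)"
proof -
  have eq: "{a..c} = {a..b} \<union> {b..c}" using assms(1,2) by auto
  show "set_integrable lborel {a..c} f" unfolding eq by (rule set_integrable_Un) (use assms in auto)
  show "(LBINT x:{a..c}. f x) = (LBINT x:{a..b}. f x) + (LBINT x:{b..c}. f x)"
    unfolding eq
    by (rule set_integral_Un_AE) (use assms AE_lborel_singleton[of b] in \<open>auto elim!: eventually_mono\<close>)
qed

lemma set_integrable_subinterval:
  fixes f :: "real \<Rightarrow> real"
  assumes "set_integrable lborel {a..b} f" "a \<le> c" "d \<le> b"
  shows "set_integrable lborel {c..d} f"
  by (rule set_integrable_subset[OF assms(1)]) (use assms(2,3) in auto)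

lemma set_integrable_mult_bounded:
  fixes f g :: "'a \<Rightarrow> real"
  assumes f: "set_integrable M A f" and [measurable]: "g \<in> borel_measurable M"
    and g: "\<And>x. x \<in> A \<Longrightarrow> \<bar>g x\<bar> \<le> B" and A[measurable]: "A \<in> sets M"
  shows "set_integrable M A (\<lambda>x. f x * g x)"
proof (rule set_integrable_bound)
  show "set_integrable M A (\<lambda>x. B * f x)" using f by simp
  have "(\<lambda>x. indicat_real A x *\<^sub>R f x) \<in> borel_measurable M"
    using f unfolding set_integrable_def by simp
  then have "(\<lambda>x. (indicat_real A x *\<^sub>R f x) * g x) \<in> borel_measurable M" by measurable
  then show "set_borel_measurable M A (\<lambda>x. f x * g x)"
    unfolding set_borel_measurable_def by (simp add: mult.assoc)
  show "AE x in M. x \<in> A \<longrightarrow> norm (f x * g x) \<le> norm (B * f x)"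
    using g by (intro AE_I2) (auto simp: abs_mult mult.commute[of "\<bar>f _\<bar>"] intro!: mult_right_mono dest: order_trans[OF _ abs_ge_self])
qed

lemma set_integrable_continuous:
  fixes f :: "real \<Rightarrow> real"
  assumes "continuous_on {a..b} f"
  shows "set_integrable lborel {a..b} f"
  unfolding set_integrable_def
  using borel_integrable_compact[OF compact_Icc assms] by (simp add: indicator_def if_distrib cong: if_cong)

lemma set_integral_powr:
  assumes "-1 < a" "0 \<le> c"
  shows "set_integrable lborel {0..c} (\<lambda>x::real. x powr a)"
    and "(LBINT x:{0..c}. x powr a) = c powr (a + 1) / (a + 1)"
proof -
  have "(\<lambda>x. x powr a) absolutely_integrable_on {0..c}"
    by (rule nonnegative_absolutely_integrable_1[OF integrable_on_powr_from_0[OF assms]]) simp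
  then show int: "set_integrable lborel {0..c} (\<lambda>x. x powr a)"
    unfolding set_integrable_def by (subst (asm) integrable_completion) auto
  show "(LBINT x:{0..c}. x powr a) = c powr (a + 1) / (a + 1)"
    using set_borel_integral_eq_integral(2)[OF int] has_integral_powr_from_0[OF assms] by (simp add: integral_unique)
qed

lemma two_pi_periodic_int:
  assumes "two_pi_periodic f"
  shows "f (x + 2 * pi * of_int k) = f x"
proof -
  have nat: "f (x + 2 * pi * real n) = f x" for n x
  proof (induction n)
    case (Suc n)
    have "f (x + 2 * pi * real (Suc n)) = f ((x + 2 * pi * real n) + 2 * pi)" by (simp add: algebra_simps)
    then show ?case using assms Suc by (simp add: two_pi_periodic_def)
  qed simp
  show ?thesis
  proof (cases "0 \<le> k")
    case True
    then show ?thesis using nat[of x "nat k"] by simp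
  next
    case False
    then show ?thesis using nat[of "x + 2 * pi * of_int k" "nat (-k)"] by simp
  qed
qed

lemma two_pi_representative:
  obtains k :: int where "a \<le> x + 2 * pi * of_int k" "x + 2 * pi * of_int k < a + 2 * pi"
proof
  define q where "q = (a - x) / (2 * pi)"
  have q: "a = x + 2 * pi * q" by (simp add: q_def)
  show "a \<le> x + 2 * pi * of_int \<lceil>q\<rceil>" using le_of_int_ceiling[of q] by (simp add: q)
  have "2 * pi * of_int \<lceil>q\<rceil> < 2 * pi * (q + 1)" by (rule mult_strict_left_mono) (simp_all, linarith)
  then show "x + 2 * pi * of_int \<lceil>q\<rceil> < a + 2 * pi" by (simp add: q algebra_simps)
qed

lemma set_integral_periodic:
  assumes per: "two_pi_periodic f" and int: "set_integrable lborel {-pi..pi} f"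
  shows "set_integrable lborel {a..a + 2 * pi} f"
    and "(LBINT y:{a..a + 2 * pi}. f y) = (LBINT y:{-pi..pi}. f y)"
proof -
  obtain k where k: "-pi \<le> a + 2 * pi * of_int k" "a + 2 * pi * of_int k < pi"
    using two_pi_representative[of "-pi" a] by auto
  define b where "b = a + 2 * pi * of_int k"
  have b: "-pi \<le> b" "b \<le> pi" using k by (auto simp: b_def)
  have fk: "f (2 * pi * of_int j + 1 * x) = f x" for j x
    using two_pi_periodic_int[OF per, of x j] by (simp add: add.commute)
  have i1: "set_integrable lborel {-pi..b} f" "set_integrable lborel {b..pi} f"
    using set_integrable_subinterval[OF int] b by auto
  have i2: "set_integrable lborel {pi..b + 2 * pi} f"
    and e2: "(LBINT y:{pi..b + 2 * pi}. f y) = (LBINT y:{-pi..b}. f y)"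
    using set_integrable_shift[of pi "b + 2 * pi" f "2 * pi"] set_integral_shift[of pi "b + 2 * pi" f "2 * pi"] fk[of 1] i1
    by auto
  have i3: "set_integrable lborel {b..b + 2 * pi} f"
    and e3: "(LBINT y:{b..b + 2 * pi}. f y) = (LBINT y:{-pi..pi}. f y)"
    using set_integral_combine_Icc[OF _ _ i1(2) i2] set_integral_combine_Icc(2)[OF _ _ i1] e2 b by auto
  show "set_integrable lborel {a..a + 2 * pi} f"
    using i3 set_integrable_shift[of b "b + 2 * pi" f "2 * pi * of_int k"] fk[of k] by (simp add: b_def)
  show "(LBINT y:{a..a + 2 * pi}. f y) = (LBINT y:{-pi..pi}. f y)"
    using e3 set_integral_shift[of b "b + 2 * pi" f "2 * pi * of_int k"] fk[of k] by (simp add: b_def)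
qed

text \<open>Cutting the period opposite to \<open>x\<close> and folding it at \<open>x\<close> pairs
  the points at equal distance from \<open>x\<close>. The later symmetric integrals arise in this
  way: about the midpoint of two points, about the singularity of the principal value, and about the
  cusp.\<close>

lemma set_integral_periodic_fold:
  assumes per: "two_pi_periodic f" and int: "set_integrable lborel {-pi..pi} f"
  shows "set_integrable lborel {0..pi} (\<lambda>s. f (x + s))" "set_integrable lborel {0..pi} (\<lambda>s. f (x - s))"
    and "(LBINT y:{-pi..pi}. f y) = (LBINT s:{0..pi}. f (x + s) + f (x - s))"
proof -
  have i: "set_integrable lborel {x - pi..x + pi} f"
    and e: "(LBINT y:{x - pi..x + pi}. f y) = (LBINT y:{-pi..pi}. f y)"
    using set_integral_periodic[OF per int, of "x - pi"] by (auto simp: algebra_simps)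
  have l: "set_integrable lborel {x - pi..x} f" and r: "set_integrable lborel {x..x + pi} f"
    using set_integrable_subinterval[OF i] by auto
  show 1: "set_integrable lborel {0..pi} (\<lambda>s. f (x + s))"
    using r set_integrable_shift[of x "x + pi" f x] by simp
  show 2: "set_integrable lborel {0..pi} (\<lambda>s. f (x - s))"
    using l set_integrable_reflect[of "x - pi" x f x] by simp
  show "(LBINT y:{-pi..pi}. f y) = (LBINT s:{0..pi}. f (x + s) + f (x - s))"
    using e set_integral_combine_Icc(2)[OF _ _ l r] set_integral_shift[of x "x + pi" f x]
      set_integral_reflect[of "x - pi" x f x] set_integral_add(2)[OF 1 2] by simp
qed

subsection \<open>The logarithmic kernel\<close>

text \<open>A primitive of cot (z/2) / 2, the kernel of the Hilbert transform up to a factor. At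
  multiples of 2\<pi> its value is \<open>ln 0 = 0\<close> instead of minus infinity, which
  integrals do not see.\<close>

definition lsin :: "real \<Rightarrow> real" where
  "lsin z = ln \<bar>sin (z / 2)\<bar>"

text \<open>Since \<open>ln 0 = 0\<close>, the value of \<open>kern h s\<close> at the singularity \<open>s = h\<close> has the wrong sign.\<close>

definition kern :: "real \<Rightarrow> real \<Rightarrow> real" where
  "kern h s = lsin (h + s) - lsin (h - s)"

lemma borel_measurable_lsin [measurable]: "lsin \<in> borel_measurable borel"
  unfolding lsin_def by measurable

lemma lsin_minus [simp]: "lsin (- z) = lsin z"
  by (simp add: lsin_def)

lemma lsin_minus_commute: "lsin (x - y) = lsin (y - x)"
  using lsin_minus[of "x - y"] by simp

lemma lsin_nonpos: "lsin z \<le> 0"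
  by (cases "sin (z / 2) = 0") (auto simp: lsin_def)

lemma lsin_add_2pi [simp]: "lsin (z + 2 * pi) = lsin z"
proof -
  have "sin ((z + 2 * pi) / 2) = - sin (z / 2)" by (simp add: add_divide_distrib)
  then show ?thesis by (simp add: lsin_def)
qed

lemma two_pi_periodic_lsin: "two_pi_periodic lsin"
  by (simp add: two_pi_periodic_def)

lemma sin_half_lower:
  assumes "0 \<le> z" "z \<le> pi"
  shows "z / pi \<le> sin (z / 2)"
proof -
  have "concave_on {0..pi} sin"
    by (rule f''_le0_imp_concave[where f' = cos and f'' = "\<lambda>x. - sin x"])
       (auto intro!: derivative_eq_intros simp: sin_ge_zero)
  from concave_onD[OF this, of "z / pi" 0 "pi / 2"] show ?thesis using assms by simp
qed

text \<open>The logarithm is traded for the power -1/4. This choice makes potentials Hoelder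
  continuous of order 3/4; differentiating the potential needs an order above 1/2, and the square
  root in the fixed point map halves it to 3/8.\<close>

lemma abs_lsin_le:
  assumes "0 < z" "z \<le> pi"
  shows "\<bar>lsin z\<bar> \<le> 4 * pi powr (1/4) * z powr (-1/4)"
proof -
  define q where "q = (pi / z) powr (1/4)"
  have q: "q > 0" using assms by (simp add: q_def)
  have zs: "z / pi \<le> sin (z / 2)" "0 < z / pi" using sin_half_lower assms by auto
  then have "ln (z / pi) \<le> lsin z" unfolding lsin_def by simp
  moreover have "ln (z / pi) = - ln (pi / z)" using assms by (simp add: ln_div)
  moreover have "ln (pi / z) = 4 * ln q" using assms by (simp add: q_def ln_powr)
  moreover have "ln q \<le> q" using q ln_le_minus_one[OF q] by linarith
  moreover have "q = pi powr (1/4) * z powr (-1/4)"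
    using assms by (simp add: q_def powr_divide powr_minus_divide)
  ultimately show ?thesis using lsin_nonpos[of z] by linarith
qed

lemma set_integrable_lsin: "set_integrable lborel {-pi..pi} lsin"
  and set_integral_lsin_le: "0 \<le> h \<Longrightarrow> h \<le> pi \<Longrightarrow> (LBINT z:{0..h}. \<bar>lsin z\<bar>) \<le> 8 * h powr (3/4)"
proof -
  have bd: "AE z in lborel. z \<in> {0..h} \<longrightarrow> norm (lsin z) \<le> norm (4 * pi powr (1/4) * z powr (-1/4))" if "h \<le> pi" for h
    using AE_lborel_singleton[of 0] by eventually_elim (use that abs_lsin_le in force)
  have int0: "set_integrable lborel {0..h} lsin" if "0 \<le> h" "h \<le> pi" for h
  proof (rule set_integrable_bound)
    show "set_integrable lborel {0..h} (\<lambda>z. 4 * pi powr (1/4) * z powr (-1/4))"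
      using set_integral_powr(1)[of "-1/4" h] that by (intro set_integrable_mult_right) auto
    show "set_borel_measurable lborel {0..h} lsin" unfolding set_borel_measurable_def by measurable
  qed (rule bd[OF that(2)])
  then have pos: "set_integrable lborel {0..pi} lsin" by simp
  have "set_integrable lborel {-pi..0} lsin"
    using set_integrable_reflect[of "-pi" 0 lsin 0] pos by simp
  then show "set_integrable lborel {-pi..pi} lsin"
    using set_integral_combine_Icc(1)[OF _ _ _ pos] by simp
  show "(LBINT z:{0..h}. \<bar>lsin z\<bar>) \<le> 8 * h powr (3/4)" if h: "0 \<le> h" "h \<le> pi" for h
  proof -
    have "(LBINT z:{0..h}. \<bar>lsin z\<bar>) \<le> (LBINT z:{0..h}. 4 * pi powr (1/4) * z powr (-1/4))"
    proof (rule set_integral_mono_AE)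
      show "set_integrable lborel {0..h} (\<lambda>z. \<bar>lsin z\<bar>)" using int0[OF h] by (rule set_integrable_abs)
      show "set_integrable lborel {0..h} (\<lambda>z. 4 * pi powr (1/4) * z powr (-1/4))"
        using set_integral_powr(1)[of "-1/4" h] that by (intro set_integrable_mult_right) auto
      show "AE z\<in>{0..h} in lborel. \<bar>lsin z\<bar> \<le> 4 * pi powr (1/4) * z powr (-1/4)"
        using bd[OF h(2)] by eventually_elim auto
    qed
    also have "\<dots> = 4 * pi powr (1/4) * (h powr (3/4) / (3/4))"
      using set_integral_powr(2)[of "-1/4" h] h by simp
    also have "\<dots> \<le> 4 * (3/2) * (h powr (3/4) / (3/4))"
    proof (intro mult_right_mono mult_left_mono)
      \<comment> \<open>pi < 4, while (3/2)^4 = 81/16 exceeds 4.\<close>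
      have "pi powr (1/4) \<le> ((3/2) powr 4) powr (1/4)"
        by (rule powr_mono2) (use pi_less_4 in \<open>auto simp: power_divide\<close>)
      then show "pi powr (1/4) \<le> 3/2" by (subst (asm) powr_powr) simp
    qed auto
    finally show ?thesis by simp
  qed
qed

lemma set_integrable_lsin_shift:
  assumes "b \<le> a + 2 * pi"
  shows "set_integrable lborel {a..b} (\<lambda>s. lsin (x + s))" "set_integrable lborel {a..b} (\<lambda>s. lsin (x - s))"
proof -
  show *: "set_integrable lborel {a..b} (\<lambda>s. lsin (x + s))" for x
    using set_integrable_subinterval[OF set_integral_periodic(1)[OF two_pi_periodic_lsin set_integrable_lsin, of "a + x"], of "a + x" "b + x"]
      set_integrable_shift[of "a + x" "b + x" lsin x] assms by simp
  show "set_integrable lborel {a..b} (\<lambda>s. lsin (x - s))"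
    using *[of "-x"] lsin_minus_commute[of x] by (simp add: add.commute)
qed

lemma set_integrable_kern: "set_integrable lborel {0..pi} (kern h)"
  unfolding kern_def using set_integrable_lsin_shift[of pi 0 h] by (intro set_integral_diff) auto

lemma borel_measurable_kern [measurable]: "kern h \<in> borel_measurable borel"
  unfolding kern_def by measurable

section \<open>Positivity and mass of the difference kernel\<close>

lemma sin_squared_eq_half: "sin (z / 2) ^ 2 = (1 - cos z) / (2::real)"
proof -
  have "cos z = cos (2 * (z / 2))" by simp
  then show ?thesis unfolding cos_double_sin by simp
qed

lemma sin_half_sq_diff: "sin ((h + s) / 2) ^ 2 - sin ((h - s) / 2) ^ 2 = sin h * sin (s::real)"
proof -
  have "sin ((h + s) / 2) ^ 2 = (1 - cos (h + s)) / 2" "sin ((h - s) / 2) ^ 2 = (1 - cos (h - s)) / 2"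
    by (simp_all add: sin_squared_eq_half)
  then show ?thesis by (simp add: cos_add cos_diff field_simps)
qed

text \<open>With \<open>A\<close> and \<open>B\<close> the squared sines,
  \<open>2 * kern h s = ln (A / B)\<close> and \<open>A - B = sin h * sin s = p\<close>. As
  \<open>B \<le> 1\<close>, the quotient is at least \<open>1 + p\<close>, and
  \<open>ln (1 + p)\<close> is at least \<open>p / 2\<close> for p in [0, 1].\<close>

lemma kern_lower:
  assumes "h \<in> {0..pi}" "s \<in> {0..pi}" "s \<noteq> h"
  shows "sin h * sin s / 4 \<le> kern h s"
proof -
  have "sin ((h - s) / 2) \<noteq> 0"
    using sin_eq_0_pi[of "(h - s) / 2"] assms by auto
  define B where "B = sin ((h - s) / 2) ^ 2"
  define A where "A = sin ((h + s) / 2) ^ 2"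
  define p where "p = sin h * sin s"
  have B: "0 < B" "B \<le> 1" using \<open>sin ((h - s) / 2) \<noteq> 0\<close> by (auto simp: B_def abs_square_le_1)
  have p: "0 \<le> p" "p \<le> 1" using assms by (auto simp: p_def sin_ge_zero mult_le_one)
  have A: "A = B + p" using sin_half_sq_diff[of h s] by (simp add: A_def B_def p_def)
  have ln_sq: "ln \<bar>x\<bar> = ln (x^2) / 2" for x :: real
    using ln_realpow[of "\<bar>x\<bar>" 2] by (cases "x = 0") auto
  have "p / 2 \<le> p / (1 + p)" using p by (intro divide_left_mono) auto
  also have "\<dots> \<le> ln (1 + p)" using ln_diff_le[of 1 "1 + p"] p by simp
  also have "\<dots> \<le> ln (A / B)"
  proof -
    have "p \<le> p / B" using B p by (simp add: le_divide_eq mult_left_le)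
    then have "1 + p \<le> A / B" using B by (simp add: A add_divide_distrib)
    then show ?thesis using p by simp
  qed
  also have "\<dots> = ln A - ln B" using B p A by (subst ln_div) auto
  also have "\<dots> = 2 * kern h s" by (simp add: kern_def lsin_def ln_sq A_def B_def)
  finally show ?thesis by (simp add: p_def)
qed

lemma kern_nonneg: "h \<in> {0..pi} \<Longrightarrow> s \<in> {0..pi} \<Longrightarrow> s \<noteq> h \<Longrightarrow> 0 \<le> kern h s"
  using kern_lower[of h s] mult_nonneg_nonneg[OF sin_ge_zero sin_ge_zero, of h s] by simp

lemma AE_kern_lower:
  assumes "h \<in> {0..pi}"
  shows "AE s\<in>{0..pi} in lborel. sin h * sin s / 4 \<le> kern h s" "AE s\<in>{0..pi} in lborel. 0 \<le> kern h s"
proof -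
  show "AE s\<in>{0..pi} in lborel. sin h * sin s / 4 \<le> kern h s"
    using AE_lborel_singleton[of h] by eventually_elim (use kern_lower assms in auto)
  show "AE s\<in>{0..pi} in lborel. 0 \<le> kern h s"
    using AE_lborel_singleton[of h] by eventually_elim (use kern_nonneg assms in auto)
qed

text \<open>The kernel is nonnegative up to a null set, so the absolute value drops out, and the
  integrals of \<open>lsin\<close> over shifted intervals cancel by periodicity and evenness. Two
  intervals of length \<open>h\<close> survive: one at 0, estimated by
  \<open>set_integral_lsin_le\<close>, and one at pi, where \<open>lsin \<le> 0\<close> has the
  favourable sign.\<close>

lemma set_integral_abs_kern_le:
  assumes h: "h \<in> {0..pi}"
  shows "(LBINT s:{0..pi}. \<bar>kern h s\<bar>) \<le> 16 * h powr (3/4)"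
proof -
  define I where "I = (LBINT z:{0..pi}. lsin z)"
  have int: "set_integrable lborel {a..b} lsin" if "b \<le> a + 2 * pi" for a b
    using set_integrable_lsin_shift(1)[OF that, of 0] by simp
  have refl: "(LBINT z:{-b..-a}. lsin z) = (LBINT z:{a..b}. lsin z)" for a b
    using set_integral_reflect[of "-b" "-a" lsin 0] by simp
  have "(LBINT s:{0..pi}. \<bar>kern h s\<bar>) = (LBINT s:{0..pi}. kern h s)"
    by (rule set_lebesgue_integral_cong_AE) (use AE_kern_lower(2)[OF h] in \<open>auto elim: eventually_mono\<close>)
  also have "\<dots> = (LBINT s:{0..pi}. lsin (h + s)) - (LBINT s:{0..pi}. lsin (h - s))"
    unfolding kern_def using set_integrable_lsin_shift[of pi 0 h] by (intro set_integral_diff) auto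
  also have "(LBINT s:{0..pi}. lsin (h + s)) = (LBINT z:{h..h + pi}. lsin z)"
    using set_integral_shift[of h "h + pi" lsin h] by simp
  also have "(LBINT s:{0..pi}. lsin (h - s)) = (LBINT z:{h - pi..h}. lsin z)"
    using set_integral_reflect[of "h - pi" h lsin h] by simp
  also have "(LBINT z:{h..h + pi}. lsin z) = 2 * I - (LBINT z:{h - pi..h}. lsin z)"
    using set_integral_combine_Icc(2)[of "h - pi" h "h + pi" lsin] int
      set_integral_periodic(2)[OF two_pi_periodic_lsin set_integrable_lsin, of "h - pi"]
      set_integral_combine_Icc(2)[of "-pi" 0 pi lsin] refl[of pi 0]
    by (simp add: I_def algebra_simps)
  also have "(LBINT z:{h - pi..h}. lsin z) = (LBINT z:{0..pi - h}. lsin z) + (LBINT z:{0..h}. lsin z)"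
    using set_integral_combine_Icc(2)[of "h - pi" 0 h lsin] int refl[of "pi - h" 0] h by simp
  also have "(LBINT z:{0..pi - h}. lsin z) = I - (LBINT z:{pi - h..pi}. lsin z)"
    using set_integral_combine_Icc(2)[of 0 "pi - h" pi lsin] int h by (simp add: I_def)
  finally have "(LBINT s:{0..pi}. \<bar>kern h s\<bar>) = 2 * (LBINT z:{pi - h..pi}. lsin z) - 2 * (LBINT z:{0..h}. lsin z)"
    by simp
  moreover have "(LBINT z:{pi - h..pi}. lsin z) \<le> 0"
    using set_integral_mono[of lborel "{pi - h..pi}" lsin "\<lambda>_. 0"] int h lsin_nonpos
    by (simp add: set_integrable_def)
  moreover have "- (LBINT z:{0..h}. lsin z) = (LBINT z:{0..h}. \<bar>lsin z\<bar>)"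
    using set_integral_uminus[OF int[of h 0]] h lsin_nonpos by simp
  ultimately show ?thesis using set_integral_lsin_le[of h] h by simp
qed

subsection \<open>Logarithmic potentials of even waves\<close>

definition log_pot :: "(real \<Rightarrow> real) \<Rightarrow> real \<Rightarrow> real" where
  "log_pot u x = - (LBINT y:{-pi..pi}. lsin (x - y) * u y)"

definition pot_rise :: "(real \<Rightarrow> real) \<Rightarrow> real \<Rightarrow> real" where
  "pot_rise u x = log_pot u x - log_pot u 0"

text \<open>Minus the cosine coefficient, without normalising factor; the sign makes it nonnegative
  on even periodic functions that increase from 0 to pi.\<close>

definition first_mode :: "(real \<Rightarrow> real) \<Rightarrow> real" where
  "first_mode u = - (LBINT y:{-pi..pi}. cos y * u y)"

definition even_wave :: "(real \<Rightarrow> real) \<Rightarrow> bool" where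
  "even_wave u \<longleftrightarrow> continuous_on UNIV u \<and> two_pi_periodic u \<and> (\<forall>x. u (- x) = u x)"

definition hump :: "(real \<Rightarrow> real) \<Rightarrow> bool" where
  "hump u \<longleftrightarrow> even_wave u \<and> mono_on {0..pi} u"

lemma even_waveD:
  assumes "even_wave u"
  shows "continuous_on S u" "two_pi_periodic u" "u (- x) = u x" "u (x + 2 * pi) = u x"
    "u \<in> borel_measurable borel"
  using assms by (auto simp: even_wave_def two_pi_periodic_def intro: continuous_on_subset borel_measurable_continuous_onI)

lemma hump_even_wave: "hump u \<Longrightarrow> even_wave u"
  by (simp add: hump_def)

lemma humpD: "hump u \<Longrightarrow> 0 \<le> x \<Longrightarrow> x \<le> y \<Longrightarrow> y \<le> pi \<Longrightarrow> u x \<le> u y"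
  by (auto simp: hump_def mono_on_def)

lemma hump_bounds:
  assumes "hump u"
  shows "u 0 \<le> u x" "u x \<le> u pi"
proof -
  obtain k where k: "-pi \<le> x + 2 * pi * of_int k" "x + 2 * pi * of_int k < pi"
    using two_pi_representative[of "-pi" x] by auto
  define z where "z = \<bar>x + 2 * pi * of_int k\<bar>"
  have "u x = u (x + 2 * pi * of_int k)"
    using two_pi_periodic_int even_waveD(2)[OF hump_even_wave[OF assms]] by metis
  also have "\<dots> = u z" using even_waveD(3)[OF hump_even_wave[OF assms], of "x + 2 * pi * of_int k"] by (auto simp: z_def abs_if)
  finally have "u x = u z" .
  moreover have "0 \<le> z" "z \<le> pi" using k by (auto simp: z_def)
  ultimately show "u 0 \<le> u x" "u x \<le> u pi" using humpD[OF assms] by auto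
qed

text \<open>\<open>u\<close> is an increasing function of the distance to the lattice of multiples
  of 2\<pi>, and \<open>x + s\<close> is at least as far from the lattice as \<open>x - s\<close>.
  If \<open>x + s\<close> exceeds pi, its distance is \<open>2 * pi - (x + s)\<close>.\<close>

lemma hump_reflect_le:
  assumes u: "hump u" and x: "x \<in> {0..pi}" and s: "s \<in> {0..pi}"
  shows "u (x - s) \<le> u (x + s)"
proof -
  have "u (x - s) = u \<bar>x - s\<bar>"
    using even_waveD(3)[OF hump_even_wave[OF u], of "x - s"] by (auto simp: abs_if)
  moreover have "u (x + s) = u (2 * pi - (x + s))"
    using even_waveD(3)[OF hump_even_wave[OF u], of "x + s"] even_waveD(4)[OF hump_even_wave[OF u], of "-(x + s)"]
    by (simp add: algebra_simps)
  ultimately show ?thesis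
    using humpD[OF u, of "\<bar>x - s\<bar>" "x + s"] humpD[OF u, of "\<bar>x - s\<bar>" "2 * pi - (x + s)"] x s
    by (cases "x + s \<le> pi") (auto simp: abs_if split: if_splits)
qed

lemma even_wave_bounded:
  assumes "even_wave u"
  obtains M where "0 < M" "\<And>x. \<bar>u x\<bar> \<le> M"
proof -
  have "bounded (u ` {-pi..pi})"
    by (intro compact_imp_bounded compact_continuous_image even_waveD[OF assms] compact_Icc)
  then obtain M where M: "0 < M" "\<And>x. x \<in> {-pi..pi} \<Longrightarrow> \<bar>u x\<bar> \<le> M"
    by (auto simp: bounded_pos)
  have "\<bar>u x\<bar> \<le> M" for x
  proof -
    obtain k where "-pi \<le> x + 2 * pi * of_int k" "x + 2 * pi * of_int k < pi"
      using two_pi_representative[of "-pi" x] by auto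
    then show ?thesis
      using M(2)[of "x + 2 * pi * of_int k"] two_pi_periodic_int[OF even_waveD(2)[OF assms], of x k] by auto
  qed
  with M(1) that show thesis by blast
qed

lemma set_integrable_lsin_mult:
  assumes "even_wave u" "b \<le> a + 2 * pi"
  shows "set_integrable lborel {a..b} (\<lambda>y. lsin (x - y) * u y)"
proof -
  obtain M where "\<And>x. \<bar>u x\<bar> \<le> M" using even_wave_bounded[OF assms(1)] by blast
  then show ?thesis
    by (intro set_integrable_mult_bounded[where B = M] set_integrable_lsin_shift assms)
       (use even_waveD(5)[OF assms(1)] in auto)
qed

lemma set_integrable_kern_mult:
  assumes "even_wave u"
  shows "set_integrable lborel {0..pi} (\<lambda>s. kern h s * (u (x + s) - u (x - s)))"
proof -
  obtain M where M: "\<And>x. \<bar>u x\<bar> \<le> M" using even_wave_bounded[OF assms] by blast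
  have [measurable]: "u \<in> borel_measurable borel" by (rule even_waveD[OF assms])
  have "\<bar>u (x + s) - u (x - s)\<bar> \<le> 2 * M" for s
    using M[of "x + s"] M[of "x - s"] by linarith
  then show ?thesis
    by (intro set_integrable_mult_bounded[where B = "2 * M"] set_integrable_kern) auto
qed

text \<open>The difference of the kernels at \<open>x - h\<close> and \<open>x + h\<close> is odd
  about the midpoint \<open>x\<close>; folding there leaves \<open>kern h\<close> against
  differences of \<open>u\<close>.\<close>

lemma log_pot_diff:
  assumes u: "even_wave u"
  shows "log_pot u (x + h) - log_pot u (x - h) = (LBINT s:{0..pi}. kern h s * (u (x + s) - u (x - s)))"
proof -
  define f where "f y = (lsin (x - h - y) - lsin (x + h - y)) * u y" for y
  have int: "set_integrable lborel {-pi..pi} (\<lambda>y. lsin (z - y) * u y)" for z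
    by (rule set_integrable_lsin_mult[OF u]) simp
  have "lsin (z - (y + 2 * pi)) = lsin (z - y)" for z y
    using lsin_add_2pi[of "z - (y + 2 * pi)"] by (simp add: algebra_simps)
  then have per: "two_pi_periodic f"
    using even_waveD(4)[OF u] by (simp add: two_pi_periodic_def f_def)
  have fint: "set_integrable lborel {-pi..pi} f"
    unfolding f_def left_diff_distrib by (rule set_integral_diff(1)[OF int int])
  have "log_pot u (x + h) - log_pot u (x - h) = (LBINT y:{-pi..pi}. f y)"
    unfolding f_def log_pot_def left_diff_distrib using set_integral_diff(2)[OF int int] by simp
  also have "\<dots> = (LBINT s:{0..pi}. f (x + s) + f (x - s))"
    by (rule set_integral_periodic_fold[OF per fint])
  also have "(\<lambda>s. f (x + s) + f (x - s)) = (\<lambda>s. kern h s * (u (x + s) - u (x - s)))"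
  proof
    fix s
    show "f (x + s) + f (x - s) = kern h s * (u (x + s) - u (x - s))"
      using lsin_minus[of "h + s"] lsin_minus[of "h - s"] by (simp add: f_def kern_def algebra_simps)
  qed
  finally show ?thesis .
qed

text \<open>The weight \<open>sin s\<close> is the one in the minorant of \<open>kern_lower\<close>.
  Expanding \<open>sin (y - x)\<close> leaves only the cosine coefficient, as the sine coefficient
  of an even function vanishes. At \<open>x = pi/2\<close> the first mode becomes an integral of
  differences with nonnegative weight, the form used for its estimates on humps.\<close>

lemma first_mode_fold:
  assumes u: "even_wave u"
  shows "(LBINT s:{0..pi}. sin s * (u (x + s) - u (x - s))) = sin x * first_mode u"
    and "set_integrable lborel {0..pi} (\<lambda>s. sin s * (u (x + s) - u (x - s)))"
proof -
  define f where "f y = sin (y - x) * u y" for y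
  have cont: "continuous_on S (\<lambda>y. sin (y - x) * u y)" "continuous_on S (\<lambda>y. cos y * u y)"
     "continuous_on S (\<lambda>y. sin y * u y)" for S
    by (intro continuous_intros even_waveD[OF u])+
  have c: "continuous_on S (\<lambda>s. u (x + s))" "continuous_on S (\<lambda>s. u (x - s))" for S
    by (rule continuous_on_compose2[OF even_waveD(1)[OF u, of UNIV]]; auto intro!: continuous_intros)+
  show "set_integrable lborel {0..pi} (\<lambda>s. sin s * (u (x + s) - u (x - s)))"
    by (intro set_integrable_continuous continuous_intros c)
  have per: "two_pi_periodic f"
  proof -
    have "sin (y + 2 * pi - x) = sin (y - x)" for y
      using sin_periodic[of "y - x"] by (simp add: algebra_simps)
    then show ?thesis by (simp add: two_pi_periodic_def f_def even_waveD(4)[OF u])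
  qed
  have fint: "set_integrable lborel {-pi..pi} f"
    unfolding f_def by (intro set_integrable_continuous cont)
  have "(LBINT y:{-pi..pi}. sin y * u y) = (LBINT y:{-pi..pi}. - (sin y * u y))"
    using set_integral_reflect[of "-pi" pi "\<lambda>y. sin y * u y" 0] even_waveD(3)[OF u] by simp
  also have "\<dots> = - (LBINT y:{-pi..pi}. sin y * u y)"
    by (intro set_integral_uminus set_integrable_continuous cont)
  finally have sin0: "(LBINT y:{-pi..pi}. sin y * u y) = 0" by simp
  have "(LBINT s:{0..pi}. sin s * (u (x + s) - u (x - s))) = (LBINT s:{0..pi}. f (x + s) + f (x - s))"
    by (simp add: f_def algebra_simps)
  also have "\<dots> = (LBINT y:{-pi..pi}. f y)"
    using set_integral_periodic_fold(3)[OF per fint] by simp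
  also have "\<dots> = (LBINT y:{-pi..pi}. cos x * (sin y * u y) - sin x * (cos y * u y))"
    by (simp add: f_def sin_diff algebra_simps)
  also have "\<dots> = cos x * (LBINT y:{-pi..pi}. sin y * u y) - sin x * (LBINT y:{-pi..pi}. cos y * u y)"
    using set_integral_diff(2)[OF set_integrable_mult_right[OF set_integrable_continuous[OF cont(3)]]
        set_integrable_mult_right[OF set_integrable_continuous[OF cont(2)]]] by simp
  finally show "(LBINT s:{0..pi}. sin s * (u (x + s) - u (x - s))) = sin x * first_mode u"
    by (simp add: sin0 first_mode_def)
qed

lemmas first_mode_eq = first_mode_fold(1)[where x = "pi/2", simplified, symmetric]

lemma first_mode_nonneg: "hump u \<Longrightarrow> 0 \<le> first_mode u"
proof -
  assume u: "hump u"
  have "0 \<le> (LBINT s:{0..pi}. sin s * (u (pi/2 + s) - u (pi/2 - s)))"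
    using set_integral_mono[of lborel "{0..pi}" "\<lambda>_. 0" "\<lambda>s. sin s * (u (pi/2 + s) - u (pi/2 - s))"]
      first_mode_fold(2)[OF hump_even_wave[OF u], of "pi/2"] hump_reflect_le[OF u, of "pi/2"]
    by (simp add: set_integrable_def sin_ge_zero)
  then show ?thesis using first_mode_eq[OF hump_even_wave[OF u]] by simp
qed

text \<open>The common source of the monotonicity of \<open>pot_rise u\<close> (any midpoint), of
  its quadratic growth at 0 (midpoint and half-length \<open>x / 2\<close>) and of the bound on its
  first mode (midpoint pi/2).\<close>

lemma log_pot_diff_lower:
  assumes u: "hump u" and x: "x \<in> {0..pi}" and h: "h \<in> {0..pi}"
  shows "sin h * sin x * first_mode u / 4 \<le> log_pot u (x + h) - log_pot u (x - h)"
proof -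
  have eu: "even_wave u" by (rule hump_even_wave[OF u])
  have "sin h * sin x * first_mode u / 4 = (LBINT s:{0..pi}. (sin h / 4) * (sin s * (u (x + s) - u (x - s))))"
    using first_mode_fold(1)[OF eu, of x] by simp
  also have "\<dots> \<le> (LBINT s:{0..pi}. kern h s * (u (x + s) - u (x - s)))"
  proof (rule set_integral_mono_AE)
    show "AE s\<in>{0..pi} in lborel. (sin h / 4) * (sin s * (u (x + s) - u (x - s))) \<le> kern h s * (u (x + s) - u (x - s))"
      using AE_kern_lower(1)[OF h]
    proof eventually_elim
      case (elim s)
      show ?case
      proof
        assume s: "s \<in> {0..pi}"
        then have "(sin h * sin s / 4) * (u (x + s) - u (x - s)) \<le> kern h s * (u (x + s) - u (x - s))"
          using elim hump_reflect_le[OF u x] by (intro mult_right_mono) auto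
        then show "(sin h / 4) * (sin s * (u (x + s) - u (x - s))) \<le> kern h s * (u (x + s) - u (x - s))" by simp
      qed
    qed
  qed (intro set_integrable_mult_right first_mode_fold(2)[OF eu] set_integrable_kern_mult[OF eu])+
  also have "\<dots> = log_pot u (x + h) - log_pot u (x - h)"
    by (rule log_pot_diff[OF eu, symmetric])
  finally show ?thesis .
qed

section \<open>Linearity, size and modulus of continuity of the potential\<close>

lemma log_pot_linear:
  assumes "even_wave u" "even_wave v"
  shows "log_pot (\<lambda>x. u x - v x) x = log_pot u x - log_pot v x"
  using set_integral_diff(2)[OF set_integrable_lsin_mult[OF assms(1), of pi "-pi" x] set_integrable_lsin_mult[OF assms(2), of pi "-pi" x]]
  by (simp add: log_pot_def right_diff_distrib)

lemma log_pot_scale: "log_pot (\<lambda>x. c * u x) x = c * log_pot u x"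
  by (simp add: log_pot_def mult.left_commute[of _ c])

lemma abs_log_pot_le:
  assumes u: "even_wave u" and M: "\<And>x. \<bar>u x\<bar> \<le> M"
  shows "\<bar>log_pot u x\<bar> \<le> M * (LBINT y:{-pi..pi}. \<bar>lsin y\<bar>)"
proof -
  have i: "set_integrable lborel {-pi..pi} (\<lambda>y. \<bar>lsin (x - y)\<bar>)"
    by (intro set_integrable_abs set_integrable_lsin_shift) simp
  have "\<bar>log_pot u x\<bar> \<le> (LBINT y:{-pi..pi}. \<bar>lsin (x - y) * u y\<bar>)"
    unfolding log_pot_def abs_minus_cancel
    using integral_norm_bound[of lborel "\<lambda>y. indicator {-pi..pi} y *\<^sub>R (lsin (x - y) * u y)"]
    by (simp add: set_lebesgue_integral_def abs_mult)
  also have "\<dots> \<le> (LBINT y:{-pi..pi}. \<bar>lsin (x - y)\<bar> * M)"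
    by (intro set_integral_mono set_integrable_abs set_integrable_lsin_mult[OF u])
       (use M i in \<open>auto simp: abs_mult intro!: mult_left_mono\<close>)
  also have "\<dots> = (LBINT y:{-pi..pi}. \<bar>lsin (x - y)\<bar>) * M" by simp
  also have "(LBINT y:{-pi..pi}. \<bar>lsin (x - y)\<bar>) = (LBINT z:{x - pi..x + pi}. \<bar>lsin z\<bar>)"
    using set_integral_reflect[of "x - pi" "x + pi" "\<lambda>z. \<bar>lsin z\<bar>" x] by simp
  also have "\<dots> = (LBINT y:{-pi..pi}. \<bar>lsin y\<bar>)"
    using set_integral_periodic(2)[of "\<lambda>z. \<bar>lsin z\<bar>" "x - pi"] set_integrable_abs[OF set_integrable_lsin]
    by (simp add: two_pi_periodic_def add.commute)
  finally show ?thesis by (simp add: mult.commute)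
qed

lemma log_pot_periodic: "log_pot u (x + 2 * pi) = log_pot u x"
proof -
  have "lsin (x + 2 * pi - y) = lsin (x - y)" for y
    using lsin_add_2pi[of "x - y"] by (simp add: algebra_simps)
  then show ?thesis by (simp add: log_pot_def)
qed

lemma log_pot_even:
  assumes "even_wave u"
  shows "log_pot u (- x) = log_pot u x"
  using set_integral_reflect[of "-pi" pi "\<lambda>y. lsin (- x - y) * u y" 0] even_waveD(3)[OF assms] lsin_minus_commute[of x]
  by (simp add: log_pot_def add.commute)

text \<open>Folding about the midpoint bounds the difference by the mass of \<open>kern h\<close>
  times the oscillation \<open>2 * M\<close>, with \<open>h\<close> half the distance. This requires
  \<open>h \<le> pi\<close>; larger distances are first shortened by periods.\<close>

lemma log_pot_holder:
  assumes u: "even_wave u" and M: "\<And>x. \<bar>u x\<bar> \<le> M"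
  shows "\<bar>log_pot u a - log_pot u b\<bar> \<le> 32 * M * \<bar>a - b\<bar> powr (3/4)"
proof -
  have M0: "0 \<le> M" using M[of 0] by linarith
  have near: "\<bar>log_pot u a - log_pot u b\<bar> \<le> 32 * M * (a - b) powr (3/4)" if ab: "b \<le> a" "a \<le> b + 2 * pi" for a b
  proof -
    define h where "h = (a - b) / 2"
    define x where "x = (a + b) / 2"
    have h: "h \<in> {0..pi}" using ab by (auto simp: h_def)
    have abx: "a = x + h" "b = x - h" by (auto simp: h_def x_def field_simps)
    have "\<bar>log_pot u a - log_pot u b\<bar> \<le> (LBINT s:{0..pi}. \<bar>kern h s * (u (x + s) - u (x - s))\<bar>)"
      unfolding abx log_pot_diff[OF u]
      using integral_norm_bound[of lborel "\<lambda>s. indicator {0..pi} s *\<^sub>R (kern h s * (u (x + s) - u (x - s)))"]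
      by (simp add: set_lebesgue_integral_def abs_mult)
    also have "\<dots> \<le> (LBINT s:{0..pi}. \<bar>kern h s\<bar> * (2 * M))"
    proof (rule set_integral_mono)
      show "\<bar>kern h s * (u (x + s) - u (x - s))\<bar> \<le> \<bar>kern h s\<bar> * (2 * M)" for s
      proof -
        have "\<bar>u (x + s) - u (x - s)\<bar> \<le> 2 * M" using M[of "x + s"] M[of "x - s"] by linarith
        then show ?thesis by (simp add: abs_mult mult_left_mono)
      qed
    qed (use set_integrable_abs[OF set_integrable_kern_mult[OF u]] set_integrable_abs[OF set_integrable_kern] in auto)
    also have "\<dots> = (LBINT s:{0..pi}. \<bar>kern h s\<bar>) * (2 * M)" by simp
    also have "\<dots> \<le> (16 * h powr (3/4)) * (2 * M)"
      using set_integral_abs_kern_le[OF h] M0 by (intro mult_right_mono) auto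
    also have "\<dots> \<le> (16 * (a - b) powr (3/4)) * (2 * M)"
      using M0 ab by (intro mult_right_mono mult_left_mono powr_mono2) (auto simp: h_def)
    finally show ?thesis by (simp add: mult_ac)
  qed
  have gen: "\<bar>log_pot u a - log_pot u b\<bar> \<le> 32 * M * (a - b) powr (3/4)" if ab: "b \<le> a" for a b
  proof (cases "a \<le> b + 2 * pi")
    case False
    obtain k where k: "b \<le> a + 2 * pi * of_int k" "a + 2 * pi * of_int k < b + 2 * pi"
      using two_pi_representative[of b a] by auto
    have "a + 2 * pi * of_int k \<le> a" using False k(2) by simp
    then have "(a + 2 * pi * of_int k - b) powr (3/4) \<le> (a - b) powr (3/4)"
      using k by (intro powr_mono2) auto
    moreover have "log_pot u (a + 2 * pi * of_int k) = log_pot u a"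
      by (rule two_pi_periodic_int) (simp add: two_pi_periodic_def log_pot_periodic)
    moreover have "\<bar>log_pot u (a + 2 * pi * of_int k) - log_pot u b\<bar> \<le> 32 * M * (a + 2 * pi * of_int k - b) powr (3/4)"
      using k by (intro near) auto
    ultimately show ?thesis
      using mult_left_mono[of "(a + 2 * pi * of_int k - b) powr (3/4)" "(a - b) powr (3/4)" "32 * M"] M0 by linarith
  qed (use near ab in auto)
  show ?thesis
    using gen[of a b] gen[of b a] by (cases "b \<le> a") (auto simp: abs_minus_commute)
qed

lemma even_wave_pot_rise:
  assumes u: "even_wave u"
  shows "even_wave (pot_rise u)"
proof -
  obtain M where M: "0 < M" "\<And>x. \<bar>u x\<bar> \<le> M" using even_wave_bounded[OF u] by blast
  have "isCont (pot_rise u) a" for a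
  proof -
    have "((\<lambda>x. 32 * M * \<bar>x - a\<bar> powr (3/4)) \<longlongrightarrow> 32 * M * \<bar>a - a\<bar> powr (3/4)) (at a)"
      by (intro tendsto_intros) auto
    then have "((\<lambda>x. pot_rise u x - pot_rise u a) \<longlongrightarrow> 0) (at a)"
      by (intro tendsto_0_le[where K = 1 and g = "\<lambda>x. pot_rise u x - pot_rise u a"])
         (use log_pot_holder[OF u M(2)] M(1) in \<open>auto simp: pot_rise_def abs_mult intro!: always_eventually\<close>)
    then show ?thesis by (simp add: isCont_def LIM_zero_iff)
  qed
  then show ?thesis
    using log_pot_periodic log_pot_even[OF u]
    by (auto simp: even_wave_def continuous_on_eq_continuous_at two_pi_periodic_def) (auto simp: pot_rise_def)
qed

lemma pot_rise_0 [simp]: "pot_rise u 0 = 0"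
  by (simp add: pot_rise_def)

lemma hump_pot_rise:
  assumes u: "hump u"
  shows "hump (pot_rise u)"
  unfolding hump_def
proof
  show "even_wave (pot_rise u)" using even_wave_pot_rise hump_even_wave u by blast
  show "mono_on {0..pi} (pot_rise u)"
  proof (rule mono_onI)
    fix a b assume ab: "a \<in> {0..pi}" "b \<in> {0..pi}" "a \<le> b"
    define h x where "h = (b - a) / 2" and "x = (a + b) / 2"
    have hx: "h \<in> {0..pi}" "x \<in> {0..pi}" "b = x + h" "a = x - h"
      using ab by (auto simp: h_def x_def field_simps)
    have "0 \<le> sin h * sin x * first_mode u / 4"
      using first_mode_nonneg[OF u] hx by (auto simp: sin_ge_zero)
    then show "pot_rise u a \<le> pot_rise u b"
      using log_pot_diff_lower[OF u hx(2,1)] hx(3,4) by (simp add: pot_rise_def)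
  qed
qed

lemma pot_rise_nonneg: "hump u \<Longrightarrow> 0 \<le> pot_rise u x"
  using hump_bounds(1)[OF hump_pot_rise, of u x] by simp

text \<open>After a square root this is a linear lower bound on the wave, which therefore vanishes
  only on the lattice. The 40 is 4 times 10, a bound for \<open>pi ^ 2\<close>.\<close>

lemma pot_rise_lower:
  assumes u: "hump u" and x: "x \<in> {0..pi}"
  shows "x ^ 2 * first_mode u / 40 \<le> pot_rise u x"
proof -
  have "(x / pi) ^ 2 * first_mode u / 4 \<le> sin (x / 2) ^ 2 * first_mode u / 4"
    using sin_half_lower[of x] first_mode_nonneg[OF u] x
    by (intro divide_right_mono mult_right_mono power_mono) auto
  also have "\<dots> \<le> pot_rise u x"
    using log_pot_diff_lower[OF u, of "x / 2" "x / 2"] x by (simp add: pot_rise_def power2_eq_square)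
  finally have *: "(x / pi) ^ 2 / 4 * first_mode u \<le> pot_rise u x" by simp
  have "x ^ 2 * first_mode u / 40 = x ^ 2 / 40 * first_mode u" by simp
  also have "\<dots> \<le> (x / pi) ^ 2 / 4 * first_mode u"
  proof (rule mult_right_mono[OF _ first_mode_nonneg[OF u]])
    have "pi * pi \<le> 3.15 * 3.15" using pi_approx by (intro mult_mono) auto
    then have "pi ^ 2 \<le> 10" by (simp add: power2_eq_square)
    then show "x ^ 2 / 40 \<le> (x / pi) ^ 2 / 4" by (simp add: power_divide field_simps mult_right_mono)
  qed
  also note *
  finally show ?thesis .
qed

text \<open>This keeps the denominator of the fixed point map away from 0. The constant is a
  quarter, from \<open>kern_lower\<close>, of the integral of \<open>sin s ^ 2\<close> over
  [0, pi].\<close>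

lemma first_mode_pot_rise:
  assumes u: "hump u"
  shows "pi / 8 * first_mode u \<le> first_mode (pot_rise u)"
proof -
  have ev: "even_wave (pot_rise u)" using hump_pot_rise[OF u] hump_even_wave by blast
  have "(LBINT s:{0..pi}. sin s * (first_mode u / 4 * sin s)) \<le> first_mode (pot_rise u)"
    unfolding first_mode_eq[OF ev]
  proof (rule set_integral_mono)
    show "set_integrable lborel {0..pi} (\<lambda>s. sin s * (first_mode u / 4 * sin s))"
      by (intro set_integrable_continuous continuous_intros)
    show "set_integrable lborel {0..pi} (\<lambda>s. sin s * (pot_rise u (pi/2 + s) - pot_rise u (pi/2 - s)))"
      by (rule first_mode_fold(2)[OF ev])
    show "sin s * (first_mode u / 4 * sin s) \<le> sin s * (pot_rise u (pi/2 + s) - pot_rise u (pi/2 - s))"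
      if "s \<in> {0..pi}" for s
      using log_pot_diff_lower[OF u, of "pi/2" s] that
      by (intro mult_left_mono) (auto simp: pot_rise_def sin_ge_zero mult_ac)
  qed
  moreover have "(LBINT s:{0..pi}. sin s * (first_mode u / 4 * sin s)) = first_mode u / 4 * (LBINT s:{0..pi}. sin s ^ 2)"
    by (simp add: power2_eq_square mult_ac flip: set_integral_mult_right)
  moreover have "(LBINT s:{0..pi}. sin s ^ 2) = pi / 2"
  proof -
    have "((\<lambda>s. sin s ^ 2) has_integral ((pi - sin pi * cos pi) / 2 - (0 - sin 0 * cos 0) / 2)) {0..pi}"
    proof (rule fundamental_theorem_of_calculus)
      fix s :: real
      have "((\<lambda>s. (s - sin s * cos s) / 2) has_real_derivative sin s ^ 2) (at s within {0..pi})"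
        using sin_cos_squared_add[of s]
        by (auto intro!: derivative_eq_intros simp: power2_eq_square)
      then show "((\<lambda>s. (s - sin s * cos s) / 2) has_vector_derivative sin s ^ 2) (at s within {0..pi})"
        by (simp add: has_real_derivative_iff_has_vector_derivative)
    qed simp
    moreover have "set_integrable lborel {0..pi} (\<lambda>s::real. sin s ^ 2)"
      by (intro set_integrable_continuous continuous_intros)
    ultimately show ?thesis by (simp add: set_borel_integral_eq_integral(2) integral_unique)
  qed
  ultimately show ?thesis by (simp only:) (simp add: mult_ac)
qed

text \<open>A difference of squares is the difference times the sum, and the sum is at most twice
  the maximum. This carries the lower bound on the first mode of \<open>pot_rise u\<close> over to
  its square root.\<close>

lemma first_mode_square_le:
  assumes v: "hump v" "v 0 = 0"
  shows "first_mode (\<lambda>x. v x ^ 2) \<le> 2 * v pi * first_mode v"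
proof -
  have ev: "even_wave v" by (rule hump_even_wave[OF v(1)])
  have ev2: "even_wave (\<lambda>x. v x ^ 2)"
    using ev by (auto simp: even_wave_def two_pi_periodic_def intro!: continuous_intros)
  have "first_mode (\<lambda>x. v x ^ 2) \<le> (LBINT s:{0..pi}. 2 * v pi * (sin s * (v (pi/2 + s) - v (pi/2 - s))))"
    unfolding first_mode_eq[OF ev2]
  proof (rule set_integral_mono)
    fix s assume s: "s \<in> {0..pi}"
    have "sin s * (v (pi/2 + s) ^ 2 - v (pi/2 - s) ^ 2)
        = (v (pi/2 + s) + v (pi/2 - s)) * (sin s * (v (pi/2 + s) - v (pi/2 - s)))"
      by (simp add: power2_eq_square algebra_simps)
    also have "\<dots> \<le> 2 * v pi * (sin s * (v (pi/2 + s) - v (pi/2 - s)))"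
      using hump_bounds(2)[OF v(1), of "pi/2 + s"] hump_bounds(2)[OF v(1), of "pi/2 - s"]
        hump_reflect_le[OF v(1), of "pi/2" s] s
      by (intro mult_right_mono) (auto simp: sin_ge_zero)
    finally show "sin s * (v (pi/2 + s) ^ 2 - v (pi/2 - s) ^ 2) \<le> 2 * v pi * (sin s * (v (pi/2 + s) - v (pi/2 - s)))" .
  qed (intro set_integrable_mult_right first_mode_fold(2) ev ev2)+
  then show ?thesis using first_mode_eq[OF ev] by simp
qed

text \<open>The mass of the kernel above \<open>n * sin s\<close>. The part below is controlled by
  the first mode, which is fixed to 1; the part above multiplies the oscillation of
  \<open>u\<close>, and its mass is as small as desired because the kernel is integrable.\<close>

definition kern_excess :: "nat \<Rightarrow> real" where
  "kern_excess n = (LBINT s:{0..pi}. max 0 (kern (pi/2) s - real n * sin s))"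

lemma kern_excess_integrand_le:
  assumes "s \<in> {0..pi}"
  shows "max 0 (kern (pi/2) s - real n * sin s) \<le> \<bar>kern (pi/2) s\<bar>"
  using mult_nonneg_nonneg[OF of_nat_0_le_iff sin_ge_zero, of s n] assms by (auto simp: max_def)

lemma set_integrable_kern_excess:
  "set_integrable lborel {0..pi} (\<lambda>s. max 0 (kern (pi/2) s - real n * sin s))"
proof (rule set_integrable_bound[OF set_integrable_kern[of "pi/2"]])
  show "set_borel_measurable lborel {0..pi} (\<lambda>s. max 0 (kern (pi/2) s - real n * sin s))"
    unfolding set_borel_measurable_def by measurable
  show "AE s in lborel. s \<in> {0..pi} \<longrightarrow> norm (max 0 (kern (pi/2) s - real n * sin s)) \<le> norm (kern (pi/2) s)"
    using kern_excess_integrand_le by (intro AE_I2) auto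
qed

lemma kern_excess_tendsto_0: "kern_excess \<longlonglongrightarrow> 0"
proof -
  have "(\<lambda>n. \<integral>s. indicator {0..pi} s *\<^sub>R max 0 (kern (pi/2) s - real n * sin s) \<partial>lborel)
      \<longlonglongrightarrow> (\<integral>s. 0 \<partial>(lborel :: real measure))"
  proof (rule integral_dominated_convergence)
    show "integrable lborel (\<lambda>s. indicator {0..pi} s *\<^sub>R \<bar>kern (pi/2) s\<bar>)"
      using set_integrable_abs[OF set_integrable_kern[of "pi/2"]] by (simp add: set_integrable_def)
    show "AE s in lborel. norm (indicator {0..pi} s *\<^sub>R max 0 (kern (pi/2) s - real n * sin s))
            \<le> indicator {0..pi} s *\<^sub>R \<bar>kern (pi/2) s\<bar>" for n
      using kern_excess_integrand_le by (intro AE_I2) (auto simp: indicator_def)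
    show "AE s in lborel. (\<lambda>n. indicator {0..pi} s *\<^sub>R max 0 (kern (pi/2) s - real n * sin s)) \<longlonglongrightarrow> 0"
      using AE_lborel_singleton[of 0] AE_lborel_singleton[of pi]
    proof eventually_elim
      case (elim s)
      show ?case
      proof (cases "s \<in> {0..pi}")
        case True
        then have "0 < sin s" using elim by (intro sin_gt_zero) auto
        then obtain N :: nat where N: "kern (pi/2) s < real N * sin s" using reals_Archimedean3 by blast
        have "eventually (\<lambda>n. max 0 (kern (pi/2) s - real n * sin s) = 0) sequentially"
          using eventually_ge_at_top[of N]
        proof eventually_elim
          case (elim n)
          have "real N * sin s \<le> real n * sin s" using elim \<open>0 < sin s\<close> by (intro mult_right_mono) auto
          then show ?case using N by simp
        qed
        then show ?thesis using True by (intro tendsto_eventually) (auto elim: eventually_mono)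
      qed simp
    qed
  qed measurable
  then show ?thesis by (simp add: kern_excess_def[abs_def] set_lebesgue_integral_def)
qed

lemma pot_rise_pi_le:
  assumes u: "hump u"
  shows "pot_rise u pi \<le> real n * first_mode u + (u pi - u 0) * kern_excess n"
proof -
  define d where "d s = u (pi/2 + s) - u (pi/2 - s)" for s
  have eu: "even_wave u" by (rule hump_even_wave[OF u])
  have int1: "set_integrable lborel {0..pi} (\<lambda>s. real n * (sin s * d s))"
    unfolding d_def by (intro set_integrable_mult_right first_mode_fold(2) eu)
  have int2: "set_integrable lborel {0..pi} (\<lambda>s. (u pi - u 0) * max 0 (kern (pi/2) s - real n * sin s))"
    by (intro set_integrable_mult_right set_integrable_kern_excess)
  have "pot_rise u pi = (LBINT s:{0..pi}. kern (pi/2) s * d s)"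
    using log_pot_diff[OF eu, of "pi/2" "pi/2"] by (simp add: pot_rise_def d_def)
  also have "\<dots> \<le> (LBINT s:{0..pi}. real n * (sin s * d s) + (u pi - u 0) * max 0 (kern (pi/2) s - real n * sin s))"
  proof (rule set_integral_mono)
    fix s assume s: "s \<in> {0..pi}"
    have d: "0 \<le> d s" "d s \<le> u pi - u 0"
      using hump_reflect_le[OF u, of "pi/2" s] s hump_bounds[OF u] diff_mono[of "u (pi/2 + s)" "u pi" "u 0" "u (pi/2 - s)"]
      by (auto simp: d_def)
    have "kern (pi/2) s * d s \<le> (real n * sin s + max 0 (kern (pi/2) s - real n * sin s)) * d s"
      using d(1) by (intro mult_right_mono) auto
    also have "\<dots> \<le> real n * (sin s * d s) + (u pi - u 0) * max 0 (kern (pi/2) s - real n * sin s)"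
      using mult_left_mono[OF d(2), of "max 0 (kern (pi/2) s - real n * sin s)"] by (simp add: algebra_simps)
    finally show "kern (pi/2) s * d s \<le> real n * (sin s * d s) + (u pi - u 0) * max 0 (kern (pi/2) s - real n * sin s)" .
  qed (use set_integrable_kern_mult[OF eu] set_integral_add(1)[OF int1 int2] in \<open>auto simp: d_def\<close>)
  also have "\<dots> = real n * (LBINT s:{0..pi}. sin s * d s) + (u pi - u 0) * kern_excess n"
    using set_integral_add(2)[OF int1 int2] by (simp add: kern_excess_def)
  finally show ?thesis using first_mode_eq[OF eu] by (simp add: d_def)
qed

subsection \<open>Existence of the wave\<close>

lemma set_integrable_cos_mult:
  fixes u :: "real \<Rightarrow> real"
  assumes "continuous_on UNIV u"
  shows "set_integrable lborel {a..b} (\<lambda>y. cos y * u y)"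
  by (intro set_integrable_continuous continuous_intros continuous_on_subset[OF assms]) auto

lemma first_mode_linear:
  assumes "continuous_on UNIV u" "continuous_on UNIV w"
  shows "first_mode (\<lambda>x. a * u x + b * w x) = a * first_mode u + b * first_mode w"
proof -
  have "(LBINT y:{-pi..pi}. cos y * (a * u y + b * w y))
      = (LBINT y:{-pi..pi}. a * (cos y * u y) + b * (cos y * w y))"
    by (simp add: algebra_simps)
  also have "\<dots> = a * (LBINT y:{-pi..pi}. cos y * u y) + b * (LBINT y:{-pi..pi}. cos y * w y)"
    using set_integral_add(2)[OF set_integrable_mult_right[OF set_integrable_cos_mult[OF assms(1)]]
        set_integrable_mult_right[OF set_integrable_cos_mult[OF assms(2)]]] by simp
  finally show ?thesis by (simp add: first_mode_def)
qed

lemma first_mode_scale: "first_mode (\<lambda>x. a * u x) = a * first_mode u"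
  by (simp add: first_mode_def mult.left_commute[of _ a])

lemma first_mode_dist_le:
  assumes "continuous_on UNIV u" "continuous_on UNIV w" and e: "\<And>x. \<bar>u x - w x\<bar> \<le> e"
  shows "\<bar>first_mode u - first_mode w\<bar> \<le> 2 * pi * e"
proof -
  define f where "f y = cos y * (1 * u y + (-1) * w y)" for y
  have f: "continuous_on UNIV f" unfolding f_def by (intro continuous_intros assms)
  have "\<bar>first_mode u - first_mode w\<bar> = \<bar>LBINT y:{-pi..pi}. f y\<bar>"
    using first_mode_linear[OF assms(1,2), of 1 "-1"] by (simp add: first_mode_def f_def)
  also have "\<dots> \<le> (LBINT y:{-pi..pi}. \<bar>f y\<bar>)"
    using integral_norm_bound[of lborel "\<lambda>y. indicator {-pi..pi} y *\<^sub>R f y"]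
    by (simp add: set_lebesgue_integral_def abs_mult)
  also have "\<dots> \<le> (LBINT y:{-pi..pi}. e)"
  proof (rule set_integral_mono)
    show "set_integrable lborel {-pi..pi} (\<lambda>y. \<bar>f y\<bar>)"
      by (intro set_integrable_continuous continuous_intros continuous_on_subset[OF f]) auto
    show "set_integrable lborel {-pi..pi} (\<lambda>y. e)" by (intro set_integrable_continuous continuous_intros)
    show "\<bar>f y\<bar> \<le> e" for y
      using mult_mono[OF abs_cos_le_one e, of y y] by (simp add: f_def abs_mult)
  qed
  also have "\<dots> = 2 * pi * e" by (simp add: set_integral_const)
  finally show ?thesis .
qed

text \<open>The Hoelder condition supplies equicontinuity. Its exponent is half of 3/4 because the
  fixed point map ends with a square root.\<close>

definition wave_class :: "real \<Rightarrow> real \<Rightarrow> (real \<Rightarrow> real) \<Rightarrow> bool" where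
  "wave_class M H u \<longleftrightarrow> hump u \<and> u 0 = 0 \<and> first_mode u = 1 \<and> u pi \<le> M
     \<and> (\<forall>x y. \<bar>u x - u y\<bar> \<le> H * \<bar>x - y\<bar> powr (3/8))"

definition root_rise :: "(real \<Rightarrow> real) \<Rightarrow> real \<Rightarrow> real" where
  "root_rise u x = sqrt (pot_rise u x)"

lemma hump_root_rise:
  assumes "hump u"
  shows "hump (root_rise u)"
  using hump_pot_rise[OF assms]
  by (auto simp: hump_def even_wave_def two_pi_periodic_def root_rise_def mono_on_def
      intro!: continuous_intros)

lemma root_rise_0 [simp]: "root_rise u 0 = 0"
  by (simp add: root_rise_def)

text \<open>The mode of \<open>root_rise u\<close> can be small only if its maximum is large.
  Dividing the maximum by the mode therefore costs at most 16 / pi times the square of the maximum,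
  and this square is \<open>pot_rise u pi\<close>, which is linear in \<open>u\<close>.\<close>

lemma first_mode_root_rise:
  assumes u: "hump u" "first_mode u = 1"
  shows "pi / 16 \<le> root_rise u pi * first_mode (root_rise u)" "0 < first_mode (root_rise u)"
    "0 < root_rise u pi"
proof -
  have "pi / 8 \<le> first_mode (pot_rise u)" using first_mode_pot_rise[OF u(1)] u(2) by simp
  also have "pot_rise u = (\<lambda>x. root_rise u x ^ 2)"
    using pot_rise_nonneg[OF u(1)] by (simp add: root_rise_def)
  also have "first_mode \<dots> \<le> 2 * root_rise u pi * first_mode (root_rise u)"
    by (rule first_mode_square_le[OF hump_root_rise[OF u(1)]]) simp
  finally show *: "pi / 16 \<le> root_rise u pi * first_mode (root_rise u)" by simp
  then have "0 < root_rise u pi * first_mode (root_rise u)" using pi_gt_zero by linarith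
  then show "0 < first_mode (root_rise u)" "0 < root_rise u pi"
    using first_mode_nonneg[OF hump_root_rise[OF u(1)]] hump_bounds(1)[OF hump_root_rise[OF u(1)], of pi]
    by (auto simp: zero_less_mult_iff)
qed

lemma abs_sqrt_diff_le:
  assumes "0 \<le> a" "0 \<le> b"
  shows "\<bar>sqrt a - sqrt b\<bar> \<le> sqrt \<bar>a - b\<bar>"
proof -
  have *: "sqrt a - sqrt b \<le> sqrt (a - b)" if "0 \<le> b" "b \<le> a" for a b :: real
    using sqrt_add_le_add_sqrt[of b "a - b"] that by simp
  show ?thesis using *[of a b] *[of b a] assms by (cases "a \<le> b") auto
qed

lemma hump_scale:
  assumes "hump u" "0 \<le> c"
  shows "hump (\<lambda>x. c * u x)"
  using assms by (auto simp: hump_def even_wave_def two_pi_periodic_def mono_on_def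
      intro!: continuous_intros mult_left_mono)

text \<open>The new maximum is at most 16 / pi times \<open>pot_rise u pi\<close>, which is at most
  \<open>n + M * kern_excess n\<close>. A self-consistent \<open>M\<close> exists once its
  coefficient is below pi / 16, hence the requirement pi / 32 on the excess. The Hoelder bound of
  the image is produced by the potential from the bound \<open>M\<close> alone.\<close>

lemma wave_class_step:
  obtains M H where "1 \<le> M" "0 < H"
    "\<And>u. \<lbrakk>hump u; u 0 = 0; first_mode u = 1; u pi \<le> M\<rbrakk>
       \<Longrightarrow> wave_class M H (\<lambda>x. (1 / first_mode (root_rise u)) * root_rise u x)"
proof -
  have "eventually (\<lambda>n. kern_excess n < pi / 32) sequentially"
    using kern_excess_tendsto_0 by (rule order_tendstoD) simp
  then obtain n where n: "kern_excess n < pi / 32" by (auto simp: eventually_sequentially)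
  \<comment> \<open>Solves \<open>n + M * (pi / 32) \<le> pi / 16 * M\<close>; the summand 1 makes
    \<open>M\<close> at least 1.\<close>
  define M where "M = 32 * real n / pi + 1"
  have M: "1 \<le> M" by (simp add: M_def)
  define H where "H = sqrt (32 * M) * (16 * sqrt M / pi)"
  have H: "0 < H" using M by (simp add: H_def)
  show thesis
  proof (rule that[OF M H])
    fix u assume u: "hump u" "u 0 = 0" "first_mode u = 1" "u pi \<le> M"
    define v where "v = root_rise u"
    define m where "m = first_mode v"
    have v: "hump v" "v 0 = 0" unfolding v_def using hump_root_rise[OF u(1)] by auto
    have m: "0 < m" "pi / 16 \<le> v pi * m" "0 < v pi"
      using first_mode_root_rise[OF u(1,3)] by (auto simp: m_def v_def)
    have u0: "0 \<le> u x" "u x \<le> M" for x using hump_bounds[OF u(1), of x] u(2,4) by auto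
    have "pot_rise u pi \<le> real n + (u pi - u 0) * kern_excess n"
      using pot_rise_pi_le[OF u(1), of n] u(3) by simp
    also have "(u pi - u 0) * kern_excess n \<le> u pi * (pi / 32)"
      using mult_left_mono[of "kern_excess n" "pi / 32" "u pi"] u0[of pi] u(2) n by simp
    also have "u pi * (pi / 32) \<le> M * (pi / 32)"
      using u0[of pi] by (intro mult_right_mono) auto
    finally have "pot_rise u pi \<le> real n + M * (pi / 32)" by simp
    also have "\<dots> \<le> pi / 16 * M" by (simp add: M_def field_simps)
    finally have rise: "pot_rise u pi \<le> pi / 16 * M" .
    have vpi: "v pi ^ 2 = pot_rise u pi" using pot_rise_nonneg[OF u(1)] by (simp add: v_def root_rise_def)
    have inv: "1 / m \<le> 16 / pi * v pi" using m by (simp add: field_simps)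
    have top: "1 / m * v pi \<le> M"
    proof -
      have "1 / m * v pi \<le> 16 / pi * v pi * v pi" using inv m(3) by (intro mult_right_mono) auto
      also have "\<dots> = 16 / pi * pot_rise u pi" by (simp add: vpi[symmetric] power2_eq_square)
      also have "\<dots> \<le> 16 / pi * (pi / 16 * M)" using rise by (intro mult_left_mono) auto
      finally show ?thesis by simp
    qed
    have "pi / 16 * M \<le> 1 * M" using M pi_less_4 by (intro mult_right_mono) auto
    with rise have "pot_rise u pi \<le> M" by linarith
    then have "v pi ^ 2 \<le> sqrt M ^ 2" using vpi M by simp
    then have "v pi \<le> sqrt M" by (rule power2_le_imp_le) (use M in simp)
    then have "16 / pi * v pi \<le> 16 / pi * sqrt M" by (intro mult_left_mono) auto
    with inv have inv': "1 / m \<le> 16 * sqrt M / pi" by simp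
    have holder: "\<bar>1 / m * v x - 1 / m * v y\<bar> \<le> H * \<bar>x - y\<bar> powr (3/8)" for x y
    proof -
      have "\<bar>v x - v y\<bar> \<le> sqrt \<bar>pot_rise u x - pot_rise u y\<bar>"
        unfolding v_def root_rise_def by (intro abs_sqrt_diff_le pot_rise_nonneg u(1))
      also have "\<dots> \<le> sqrt (32 * M * \<bar>x - y\<bar> powr (3/4))"
        using log_pot_holder[OF hump_even_wave[OF u(1)], of M x y] u0 by (simp add: pot_rise_def)
      also have "\<dots> = sqrt (32 * M) * \<bar>x - y\<bar> powr (3/8)"
      proof -
        have "\<bar>x - y\<bar> powr (3/4) = (\<bar>x - y\<bar> powr (3/8)) ^ 2"
          by (simp add: power2_eq_square flip: powr_add)
        then show ?thesis by (simp add: real_sqrt_mult)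
      qed
      finally have *: "\<bar>v x - v y\<bar> \<le> sqrt (32 * M) * \<bar>x - y\<bar> powr (3/8)" .
      have "\<bar>1 / m * v x - 1 / m * v y\<bar> = \<bar>v x - v y\<bar> * (1 / m)"
        using m(1) by (simp add: abs_mult flip: diff_divide_distrib)
      also have "\<dots> \<le> (sqrt (32 * M) * \<bar>x - y\<bar> powr (3/8)) * (16 * sqrt M / pi)"
        using * inv' m(1) M by (intro mult_mono) auto
      finally show ?thesis by (simp add: H_def mult_ac)
    qed
    show "wave_class M H (\<lambda>x. (1 / first_mode (root_rise u)) * root_rise u x)"
      unfolding wave_class_def
    proof (intro conjI allI)
      show "first_mode (\<lambda>x. 1 / first_mode (root_rise u) * root_rise u x) = 1"
        using m(1) unfolding first_mode_scale by (simp add: m_def v_def)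
    qed (use hump_scale[OF v(1), of "1 / m"] m(1) top holder in \<open>auto simp: v_def m_def\<close>)
  qed
qed

text \<open>A starting function with the right normalisation. Its image under the fixed point map
  shows that the class is not empty.\<close>

lemma hump_cos: "hump (\<lambda>x. (1 - cos x) / pi)" "first_mode (\<lambda>x. (1 - cos x) / pi) = 1"
proof -
  show h: "hump (\<lambda>x. (1 - cos x) / pi)"
    by (auto simp: hump_def even_wave_def two_pi_periodic_def mono_on_def divide_right_mono cos_monotone_0_pi_le
        intro!: continuous_intros divide_right_mono)
  have cont: "continuous_on UNIV (\<lambda>x::real. 1)" "continuous_on UNIV (cos :: real \<Rightarrow> real)"
    by (intro continuous_intros)+
  have "((\<lambda>s. cos s * cos s) has_integral ((pi + sin pi * cos pi) / 2 - (-pi + sin (-pi) * cos (-pi)) / 2)) {-pi..pi}"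
  proof (rule fundamental_theorem_of_calculus)
    fix s :: real
    have "((\<lambda>s. (s + sin s * cos s) / 2) has_real_derivative cos s * cos s) (at s within {-pi..pi})"
      using sin_cos_squared_add[of s] by (auto intro!: derivative_eq_intros simp: power2_eq_square)
    then show "((\<lambda>s. (s + sin s * cos s) / 2) has_vector_derivative cos s * cos s) (at s within {-pi..pi})"
      by (simp add: has_real_derivative_iff_has_vector_derivative)
  qed simp
  then have 1: "first_mode cos = - pi"
    using set_borel_integral_eq_integral(2)[OF set_integrable_cos_mult[OF cont(2), of "-pi" pi]]
    by (simp add: first_mode_def integral_unique)
  have "(cos has_integral (sin pi - sin (-pi))) {-pi..pi}"
    by (rule fundamental_theorem_of_calculus)
       (auto intro!: derivative_eq_intros simp: has_real_derivative_iff_has_vector_derivative[symmetric])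
  then have "first_mode (\<lambda>x. 1) = 0"
    using set_borel_integral_eq_integral(2)[OF set_integrable_cos_mult[OF cont(1), of "-pi" pi]]
    by (simp add: first_mode_def integral_unique)
  with 1 show "first_mode (\<lambda>x. (1 - cos x) / pi) = 1"
    using first_mode_linear[OF cont, of "1 / pi" "- 1 / pi"] by (simp add: diff_divide_distrib)
qed

section \<open>The wave class as a compact convex set of bounded continuous functions\<close>

lemma bcontfun_tendsto_apply:
  fixes f :: "'c \<Rightarrow> 'a::topological_space \<Rightarrow>\<^sub>C 'b::metric_space"
  assumes "(f \<longlongrightarrow> l) F"
  shows "((\<lambda>n. apply_bcontfun (f n) x) \<longlongrightarrow> apply_bcontfun l x) F"
proof (subst tendsto_dist_iff)
  from assms have "((\<lambda>n. dist (f n) l) \<longlongrightarrow> 0) F" by (subst (asm) tendsto_dist_iff)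
  then show "((\<lambda>n. dist (apply_bcontfun (f n) x) (apply_bcontfun l x)) \<longlongrightarrow> 0) F"
    by (rule tendsto_0_le[where K = 1]) (auto intro!: always_eventually dist_bounded)
qed

lemma continuous_on_first_mode_bcontfun:
  "continuous_on S (\<lambda>u :: real \<Rightarrow>\<^sub>C real. first_mode (apply_bcontfun u))"
  unfolding continuous_on_def
proof
  fix u assume "u \<in> S"
  have "((\<lambda>w. dist w u) \<longlongrightarrow> dist u u) (at u within S)" by (intro tendsto_intros)
  then have "((\<lambda>w. dist w u) \<longlongrightarrow> 0) (at u within S)" by simp
  then have "((\<lambda>w. first_mode (apply_bcontfun w) - first_mode (apply_bcontfun u)) \<longlongrightarrow> 0) (at u within S)"
  proof (rule tendsto_0_le[where K = "2 * pi"], intro always_eventually allI)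
    fix w :: "real \<Rightarrow>\<^sub>C real"
    have "\<bar>first_mode (apply_bcontfun w) - first_mode (apply_bcontfun u)\<bar> \<le> 2 * pi * dist w u"
      by (rule first_mode_dist_le) (use dist_bounded[of w _ u] in \<open>auto simp: dist_real_def\<close>)
    then show "norm (first_mode (apply_bcontfun w) - first_mode (apply_bcontfun u)) \<le> norm (dist w u) * (2 * pi)"
      by (simp add: mult.commute)
  qed
  then show "((\<lambda>w. first_mode (apply_bcontfun w)) \<longlongrightarrow> first_mode (apply_bcontfun u)) (at u within S)"
    by (simp add: LIM_zero_iff)
qed

lemma convex_wave_class: "convex {u :: real \<Rightarrow>\<^sub>C real. wave_class M H (apply_bcontfun u)}"
proof (rule convexI)
  fix u w :: "real \<Rightarrow>\<^sub>C real" and a b :: real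
  assume "u \<in> {u. wave_class M H (apply_bcontfun u)}" "w \<in> {u. wave_class M H (apply_bcontfun u)}"
    and ab: "0 \<le> a" "0 \<le> b" "a + b = 1"
  then have u: "wave_class M H (apply_bcontfun u)" and w: "wave_class M H (apply_bcontfun w)" by simp_all
  have eq: "apply_bcontfun (a *\<^sub>R u + b *\<^sub>R w) = (\<lambda>x. a * u x + b * w x)" by auto
  show "a *\<^sub>R u + b *\<^sub>R w \<in> {u. wave_class M H (apply_bcontfun u)}"
    unfolding mem_Collect_eq wave_class_def eq
  proof (intro conjI allI)
    show "hump (\<lambda>x. a * u x + b * w x)"
      using u w ab by (auto simp: wave_class_def hump_def even_wave_def two_pi_periodic_def mono_on_def
          intro!: continuous_intros add_mono mult_left_mono)
    show "a * u 0 + b * w 0 = 0" using u w by (simp add: wave_class_def)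
    show "first_mode (\<lambda>x. a * u x + b * w x) = 1"
      using u w ab by (simp add: first_mode_linear wave_class_def)
    show "a * u pi + b * w pi \<le> M"
      using u w ab by (intro convex_bound_le) (auto simp: wave_class_def)
    show "\<bar>a * u x + b * w x - (a * u y + b * w y)\<bar> \<le> H * \<bar>x - y\<bar> powr (3/8)" for x y
    proof -
      have "\<bar>a * u x + b * w x - (a * u y + b * w y)\<bar> = \<bar>a * (u x - u y) + b * (w x - w y)\<bar>"
        by (simp add: algebra_simps)
      also have "\<dots> \<le> a * \<bar>u x - u y\<bar> + b * \<bar>w x - w y\<bar>"
        using abs_triangle_ineq[of "a * (u x - u y)" "b * (w x - w y)"] ab by (simp add: abs_mult)
      also have "\<dots> \<le> H * \<bar>x - y\<bar> powr (3/8)"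
        using u w ab by (intro convex_bound_le) (auto simp: wave_class_def)
      finally show ?thesis .
    qed
  qed
qed

text \<open>Continuity of the limit is part of its type, and the other conditions pass to pointwise
  limits, except the value of \<open>first_mode\<close>, where uniform convergence enters.\<close>

lemma wave_class_closed:
  fixes f :: "nat \<Rightarrow> real \<Rightarrow>\<^sub>C real"
  assumes f: "\<And>n. wave_class M H (apply_bcontfun (f n))" and lim: "f \<longlonglongrightarrow> l"
  shows "wave_class M H (apply_bcontfun l)"
proof -
  have pt: "(\<lambda>n. f n x) \<longlonglongrightarrow> l x" for x by (rule bcontfun_tendsto_apply[OF lim])
  have h: "hump (apply_bcontfun (f n))" and z: "f n 0 = 0" for n using f[of n] by (auto simp: wave_class_def)
  have "l (x + 2 * pi) = l x" for x
    using LIMSEQ_unique[OF pt[of "x + 2 * pi"], of "l x"] pt[of x] even_waveD(4)[OF hump_even_wave[OF h]] by simp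
  moreover have "l (- x) = l x" for x
    using LIMSEQ_unique[OF pt[of "- x"], of "l x"] pt[of x] even_waveD(3)[OF hump_even_wave[OF h]] by simp
  moreover have "l x \<le> l y" if "x \<in> {0..pi}" "y \<in> {0..pi}" "x \<le> y" for x y
    using LIMSEQ_le[OF pt[of x] pt[of y]] humpD[OF h, of x y] that by auto
  moreover have "l 0 = 0" using LIMSEQ_unique[OF pt[of 0], of 0] z by simp
  moreover have "l pi \<le> M"
    using LIMSEQ_le_const2[OF pt[of pi], of M] f by (auto simp: wave_class_def)
  moreover have "first_mode l = 1"
  proof -
    have "(\<lambda>n. first_mode (f n)) \<longlonglongrightarrow> first_mode l"
      using continuous_on_tendsto_compose[OF continuous_on_first_mode_bcontfun[of UNIV] lim] by simp
    moreover have "(\<lambda>n. first_mode (f n)) = (\<lambda>n. 1)" using f by (simp add: wave_class_def)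
    ultimately show ?thesis by (simp add: LIMSEQ_const_iff)
  qed
  moreover have "\<bar>l x - l y\<bar> \<le> H * \<bar>x - y\<bar> powr (3/8)" for x y
  proof (rule LIMSEQ_le_const2)
    show "(\<lambda>n. \<bar>f n x - f n y\<bar>) \<longlonglongrightarrow> \<bar>l x - l y\<bar>" by (intro tendsto_intros pt)
    show "\<exists>N. \<forall>n\<ge>N. \<bar>f n x - f n y\<bar> \<le> H * \<bar>x - y\<bar> powr (3/8)" using f by (auto simp: wave_class_def)
  qed
  ultimately show ?thesis
    by (auto simp: wave_class_def hump_def even_wave_def two_pi_periodic_def mono_on_def)
qed

text \<open>Arzela-Ascoli gives uniform convergence on one period, to a function \<open>g\<close>
  there. Instead of extending \<open>g\<close>, periodicity shows that the subsequence is Cauchy on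
  the whole line, and completeness of the bounded continuous functions supplies the limit.\<close>

lemma compact_wave_class:
  assumes "0 < H"
  shows "compact {u :: real \<Rightarrow>\<^sub>C real. wave_class M H (apply_bcontfun u)}"
  unfolding compact_eq_seq_compact_metric
proof (rule seq_compactI)
  fix f :: "nat \<Rightarrow> real \<Rightarrow>\<^sub>C real"
  assume "\<forall>n. f n \<in> {u. wave_class M H (apply_bcontfun u)}"
  then have f: "wave_class M H (apply_bcontfun (f n))" for n by simp
  have h: "hump (apply_bcontfun (f n))" and hol: "\<bar>f n x - f n y\<bar> \<le> H * \<bar>x - y\<bar> powr (3/8)" for n x y
    using f[of n] by (auto simp: wave_class_def)
  have bd: "norm (f n x) \<le> M" for n x
    using hump_bounds[OF h, of n x] f[of n] by (auto simp: wave_class_def)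
  have equi: "\<exists>d>0. \<forall>n y. y \<in> {-pi..pi} \<and> norm (x - y) < d \<longrightarrow> norm (f n x - f n y) < e" if "0 < e" for x e :: real
  proof (intro exI conjI allI impI)
    show "0 < (e / H) powr (8/3)" using that assms by simp
    fix n y assume y: "y \<in> {-pi..pi} \<and> norm (x - y) < (e / H) powr (8/3)"
    have "\<bar>x - y\<bar> powr (3/8) < ((e / H) powr (8/3)) powr (3/8)"
      using y by (intro powr_less_mono2) auto
    then have "\<bar>x - y\<bar> powr (3/8) < e / H" using that assms by (simp add: powr_powr)
    then have "H * \<bar>x - y\<bar> powr (3/8) < e" using assms by (simp add: field_simps)
    then show "norm (f n x - f n y) < e" using hol[of n x y] by simp
  qed
  obtain g and k :: "nat \<Rightarrow> nat" where k: "strict_mono k"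
    and g: "\<And>e. 0 < e \<Longrightarrow> \<exists>N. \<forall>n x. n \<ge> N \<and> x \<in> {-pi..pi} \<longrightarrow> norm (f (k n) x - g x) < e"
    by (rule Arzela_Ascoli[of "{-pi..pi}" "\<lambda>n. apply_bcontfun (f n)" M]) (use bd equi in auto)
  have "Cauchy (\<lambda>n. f (k n))"
  proof (rule metric_CauchyI)
    fix e :: real assume e: "0 < e"
    obtain N where N: "\<And>n x. \<lbrakk>n \<ge> N; x \<in> {-pi..pi}\<rbrakk> \<Longrightarrow> \<bar>f (k n) x - g x\<bar> < e / 4"
      using g[of "e / 4"] e by auto
    have "dist (f (k m)) (f (k n)) < e" if mn: "m \<ge> N" "n \<ge> N" for m n
    proof -
      have "dist (f (k m) x) (f (k n) x) \<le> e / 2" for x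
      proof -
        obtain j where j: "-pi \<le> x + 2 * pi * of_int j" "x + 2 * pi * of_int j < pi"
          using two_pi_representative[of "-pi" x] by auto
        define z where "z = x + 2 * pi * of_int j"
        have z: "f i x = f i z" for i
          unfolding z_def using two_pi_periodic_int[OF even_waveD(2)[OF hump_even_wave[OF h]], of i x j] by simp
        show ?thesis
          unfolding z dist_real_def using N[OF mn(1), of z] N[OF mn(2), of z] j[folded z_def]
          by (simp add: abs_if split: if_splits)
      qed
      then have "dist (f (k m)) (f (k n)) \<le> e / 2" by (rule dist_bound)
      then show ?thesis using e by simp
    qed
    then show "\<exists>N. \<forall>m\<ge>N. \<forall>n\<ge>N. dist (f (k m)) (f (k n)) < e" by blast
  qed
  then obtain l where l: "(\<lambda>n. f (k n)) \<longlonglongrightarrow> l"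
    using Cauchy_convergent convergent_def by blast
  then have "wave_class M H (apply_bcontfun l)" using wave_class_closed[of M H "\<lambda>n. f (k n)"] f by blast
  then show "\<exists>l\<in>{u. wave_class M H (apply_bcontfun u)}. \<exists>r. strict_mono r \<and> (f \<circ> r) \<longlonglongrightarrow> l"
    using k l by (auto simp: o_def)
qed

lemma abs_pot_rise_diff_le:
  assumes u: "even_wave u" and w: "even_wave w" and e: "\<And>x. \<bar>u x - w x\<bar> \<le> e"
  shows "\<bar>pot_rise u x - pot_rise w x\<bar> \<le> 2 * e * (LBINT y:{-pi..pi}. \<bar>lsin y\<bar>)"
proof -
  have "even_wave (\<lambda>x. u x - w x)"
    using u w by (auto simp: even_wave_def two_pi_periodic_def intro!: continuous_intros)
  from abs_log_pot_le[OF this e] have "\<bar>log_pot u x - log_pot w x\<bar> \<le> e * (LBINT y:{-pi..pi}. \<bar>lsin y\<bar>)" for x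
    using log_pot_linear[OF u w] by simp
  from this[of x] this[of 0] show ?thesis unfolding pot_rise_def by linarith
qed

lemma even_wave_bcontfun: "even_wave u \<Longrightarrow> u \<in> bcontfun"
  by (metis even_waveD(1) even_wave_bounded bcontfun_normI real_norm_def)

theorem exists_normalized_wave:
  obtains u \<kappa> where "hump u" "u 0 = 0" "first_mode u = 1" "0 < \<kappa>" "\<And>x. \<kappa> * u x ^ 2 = pot_rise u x"
proof -
  obtain M H where M: "1 \<le> M" and H: "0 < H"
    and step: "\<And>u. \<lbrakk>hump u; u 0 = 0; first_mode u = 1; u pi \<le> M\<rbrakk>
       \<Longrightarrow> wave_class M H (\<lambda>x. (1 / first_mode (root_rise u)) * root_rise u x)"
    using wave_class_step by metis
  define S where "S = {u :: real \<Rightarrow>\<^sub>C real. wave_class M H (apply_bcontfun u)}"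
  define V where "V u = Bcontfun (root_rise (apply_bcontfun u))" for u :: "real \<Rightarrow>\<^sub>C real"
  define F where "F u = (1 / first_mode (V u)) *\<^sub>R V u" for u
  have SD: "hump (apply_bcontfun u)" "u 0 = 0" "first_mode u = 1" "u pi \<le> M" if "u \<in> S" for u
    using that by (auto simp: S_def wave_class_def)
  have V: "apply_bcontfun (V u) = root_rise u" if "u \<in> S" for u
    unfolding V_def by (intro Bcontfun_inverse even_wave_bcontfun hump_even_wave hump_root_rise SD that)
  have F: "apply_bcontfun (F u) = (\<lambda>x. (1 / first_mode (root_rise u)) * root_rise u x)" if "u \<in> S" for u
    using V[OF that] by (auto simp: F_def)
  obtain x :: "real \<Rightarrow>\<^sub>C real" where x: "x \<in> S" "F x = x"
  proof (rule schauder_fixpoint[of S F])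
    show "compact S" "convex S" unfolding S_def using compact_wave_class[OF H] convex_wave_class by auto
    show "F ` S \<subseteq> S"
    proof clarify
      fix u assume u: "u \<in> S"
      show "F u \<in> S" unfolding S_def mem_Collect_eq F[OF u] by (intro step SD u)
    qed
    show "S \<noteq> {}"
    proof -
      define u0 where "u0 x = (1 - cos x) / pi" for x
      have "2 / pi \<le> 1" using pi_gt3 by simp
      then have "2 / pi \<le> M" using M by linarith
      then have "wave_class M H (\<lambda>x. (1 / first_mode (root_rise u0)) * root_rise u0 x)"
        by (intro step) (use hump_cos in \<open>auto simp: u0_def[abs_def]\<close>)
      moreover from this have "(\<lambda>x. (1 / first_mode (root_rise u0)) * root_rise u0 x) \<in> bcontfun"
        by (intro even_wave_bcontfun hump_even_wave) (simp add: wave_class_def)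
      ultimately show ?thesis unfolding S_def by (metis (mono_tags, lifting) Bcontfun_inverse empty_iff mem_Collect_eq)
    qed
    \<comment> \<open>The square root is not Lipschitz at 0, where all members of the class vanish;
      the estimate of \<open>abs_sqrt_diff_le\<close> still gives continuity in the uniform
      norm.\<close>
    have Vcont: "continuous_on S V"
      unfolding continuous_on_def
    proof
      fix u assume u: "u \<in> S"
      define C where "C = 2 * (LBINT y:{-pi..pi}. \<bar>lsin y\<bar>)"
      have le: "dist (V w) (V u) \<le> sqrt (C * dist w u)" if w: "w \<in> S" for w
      proof (rule dist_bound)
        fix x
        have "\<bar>root_rise w x - root_rise u x\<bar> \<le> sqrt \<bar>pot_rise w x - pot_rise u x\<bar>"
          unfolding root_rise_def by (intro abs_sqrt_diff_le pot_rise_nonneg SD u w)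
        also have "\<dots> \<le> sqrt (C * dist w u)"
          using abs_pot_rise_diff_le[OF hump_even_wave[OF SD(1)[OF w]] hump_even_wave[OF SD(1)[OF u]], of "dist w u" x]
            dist_bounded[of w _ u] by (simp add: C_def dist_real_def mult_ac)
        finally show "dist (V w x) (V u x) \<le> sqrt (C * dist w u)"
          unfolding V[OF u] V[OF w] by (simp add: dist_real_def)
      qed
      have "((\<lambda>w. sqrt (C * dist w u)) \<longlongrightarrow> sqrt (C * dist u u)) (at u within S)"
        by (intro tendsto_intros)
      then have "((\<lambda>w. sqrt (C * dist w u)) \<longlongrightarrow> 0) (at u within S)" by simp
      then have "((\<lambda>w. dist (V w) (V u)) \<longlongrightarrow> 0) (at u within S)"
      proof (rule tendsto_0_le[where K = 1])
        show "\<forall>\<^sub>F w in at u within S. norm (dist (V w) (V u)) \<le> norm (sqrt (C * dist w u)) * 1"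
          using le unfolding eventually_at_filter by (intro always_eventually) (auto intro: order_trans[OF _ abs_ge_self])
      qed
      then show "(V \<longlongrightarrow> V u) (at u within S)" by (subst tendsto_dist_iff)
    qed
    have N: "continuous_on S (\<lambda>u. first_mode (V u))"
      using continuous_on_compose2[OF continuous_on_first_mode_bcontfun[of UNIV] Vcont] by simp
    show "continuous_on S F"
      unfolding F_def
    proof (intro continuous_intros Vcont N ballI)
      fix u assume u: "u \<in> S"
      show "first_mode (V u) \<noteq> 0" using first_mode_root_rise(2)[OF SD(1)[OF u] SD(3)[OF u]] V[OF u] by simp
    qed
  qed
  define m where "m = first_mode (root_rise x)"
  have m: "0 < m" unfolding m_def by (intro first_mode_root_rise SD x)
  have eq: "x y = 1 / m * root_rise x y" for y
    using F[OF x(1)] x(2) by (simp add: m_def fun_eq_iff)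
  show thesis
  proof (rule that[of x "m ^ 2"])
    show "m ^ 2 * x y ^ 2 = pot_rise x y" for y
      using m pot_rise_nonneg[OF SD(1)[OF x(1)]] unfolding eq[of y] by (simp add: power_divide root_rise_def)
  qed (use SD x m in auto)
qed

text \<open>One side of the equation is quadratic and the other linear, so multiplying
  \<open>u\<close> by \<kappa> absorbs the factor.\<close>

theorem exists_wave:
  obtains u where "hump u" "u 0 = 0" "0 < first_mode u" "\<And>x. u x ^ 2 = pot_rise u x"
proof -
  obtain u \<kappa> where u: "hump u" "u 0 = 0" "first_mode u = 1" "0 < \<kappa>" "\<And>x. \<kappa> * u x ^ 2 = pot_rise u x"
    using exists_normalized_wave by metis
  show thesis
  proof (rule that[of "\<lambda>x. \<kappa> * u x"])
    show "(\<kappa> * u x) ^ 2 = pot_rise (\<lambda>x. \<kappa> * u x) x" for x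
      using u(5)[of x] by (simp add: pot_rise_def log_pot_scale power2_eq_square mult_ac flip: right_diff_distrib)
  qed (use u hump_scale in \<open>auto simp: first_mode_scale\<close>)
qed

subsection \<open>Differentiability and the Hilbert transform\<close>

lemma lsin_has_derivative:
  assumes "0 < z" "z < 2 * pi"
  shows "(lsin has_real_derivative cot (z / 2) / 2) (at z within S)"
proof -
  have pos: "0 < sin (z / 2)" using assms by (intro sin_gt_zero) auto
  have "((\<lambda>z. ln (sin (z / 2))) has_real_derivative cot (z / 2) / 2) (at z)"
    using pos by (auto intro!: derivative_eq_intros simp: cot_def field_simps)
  moreover have "\<forall>\<^sub>F y in nhds z. ln (sin (y / 2)) = lsin y"
  proof -
    have "\<forall>\<^sub>F y in nhds z. y \<in> {0<..<2 * pi}" by (rule eventually_nhds_in_open) (use assms in auto)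
    then show ?thesis
    proof eventually_elim
      case (elim y)
      then have "0 < sin (y / 2)" by (intro sin_gt_zero) auto
      then show ?case by (simp add: lsin_def)
    qed
  qed
  ultimately have "(lsin has_real_derivative cot (z / 2) / 2) (at z)"
    using DERIV_cong_ev[of z z "\<lambda>z. ln (sin (z / 2))" lsin] by blast
  then show ?thesis by (rule has_field_derivative_at_within)
qed

lemma abs_cot_half_le:
  assumes "0 < s" "s \<le> pi"
  shows "\<bar>cot (s / 2)\<bar> \<le> pi / s"
proof -
  have "s / pi \<le> sin (s / 2)" "0 < s / pi" using sin_half_lower[of s] assms by auto
  then have "\<bar>cos (s / 2)\<bar> / sin (s / 2) \<le> 1 / (s / pi)" by (intro frac_le) auto
  moreover have "0 < sin (s / 2)" using \<open>s / pi \<le> sin (s / 2)\<close> \<open>0 < s / pi\<close> by linarith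
  ultimately show ?thesis by (simp add: cot_def)
qed

lemma kern_minus: "kern (- h) s = - kern h s"
  using lsin_minus[of "h + s"] lsin_minus[of "h - s"] by (simp add: kern_def algebra_simps)

text \<open>For \<open>s \<ge> 2 * \<bar>h\<bar>\<close> both arguments of \<open>lsin\<close> stay,
  up to sign, in [s/2, 3s/2], where its derivative is at most \<open>pi / s\<close>. The part of
  this interval beyond pi is reflected at pi, into the reach of
  \<open>sin_half_lower\<close>.\<close>

lemma abs_kern_le:
  assumes "2 * \<bar>h\<bar> \<le> s" "s \<le> pi"
  shows "\<bar>kern h s\<bar> \<le> 2 * pi * \<bar>h\<bar> / s"
proof (cases "s = 0")
  case False
  then have s: "0 < s" using assms(1) by linarith
  have bound: "\<bar>kern h s\<bar> \<le> 2 * pi * h / s" if h: "0 \<le> h" "2 * h \<le> s" for h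
  proof -
    have "norm (lsin (s + h) - lsin (s - h)) \<le> pi / s * norm ((s + h) - (s - h))"
    proof (rule field_differentiable_bound)
      fix z assume z: "z \<in> {s / 2..3 * s / 2}"
      have z2: "0 < z" "z < 2 * pi" using z s assms(2) by auto
      show "(lsin has_real_derivative cot (z / 2) / 2) (at z within {s / 2..3 * s / 2})"
        by (rule lsin_has_derivative[OF z2])
      have "s / (2 * pi) \<le> sin (z / 2)"
      proof (cases "z \<le> pi")
        case True
        have "s / (2 * pi) \<le> z / pi" using z by (simp add: field_simps)
        then show ?thesis using sin_half_lower[of z] True z2 by linarith
      next
        case False
        have "sin (z / 2) = sin ((2 * pi - z) / 2)"
          using sin_pi_minus[of "z / 2"] by (simp add: diff_divide_distrib)
        moreover have "s / (2 * pi) \<le> (2 * pi - z) / pi" using z assms(2) by (simp add: field_simps)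
        ultimately show ?thesis using sin_half_lower[of "2 * pi - z"] False z2 by linarith
      qed
      then have "\<bar>cos (z / 2)\<bar> / sin (z / 2) \<le> 1 / (s / (2 * pi))" using s by (intro frac_le) auto
      moreover have "0 < sin (z / 2)" using z2 by (intro sin_gt_zero) auto
      ultimately show "norm (cot (z / 2) / 2) \<le> pi / s" by (simp add: cot_def)
    qed (use h s in auto)
    then show ?thesis using h by (simp add: kern_def lsin_minus_commute[of h s] add.commute mult_ac)
  qed
  show ?thesis
    using bound[of h] bound[of "-h"] assms(1) by (cases "0 \<le> h") (auto simp: kern_minus)
qed (use assms in \<open>simp add: kern_def\<close>)

text \<open>As \<open>lsin\<close> is even, \<open>kern h s\<close> is the central difference
  \<open>lsin (s + h) - lsin (s - h)\<close>.\<close>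

lemma kern_quotient_tendsto:
  assumes s: "0 < s" "s < 2 * pi" and h: "h \<longlonglongrightarrow> 0" "\<And>n. h n \<noteq> 0"
  shows "(\<lambda>n. kern (h n) s / (2 * h n)) \<longlonglongrightarrow> cot (s / 2) / 2"
proof -
  have d: "((\<lambda>k. (lsin (s + k) - lsin s) / k) \<longlongrightarrow> cot (s / 2) / 2) (at 0)"
    using lsin_has_derivative[OF s, of UNIV] by (simp add: DERIV_def)
  have "filterlim h (at 0) sequentially" "filterlim (\<lambda>n. - h n) (at 0) sequentially"
    using h tendsto_minus[OF h(1)] by (auto simp: filterlim_at)
  then have a: "(\<lambda>n. (lsin (s + h n) - lsin s) / h n) \<longlonglongrightarrow> cot (s / 2) / 2"
    and b: "(\<lambda>n. (lsin (s + - h n) - lsin s) / - h n) \<longlonglongrightarrow> cot (s / 2) / 2"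
    using filterlim_compose[OF d] by blast+
  have "(\<lambda>n. ((lsin (s + h n) - lsin s) / h n + (lsin (s + - h n) - lsin s) / - h n) / 2)
      \<longlonglongrightarrow> (cot (s / 2) / 2 + cot (s / 2) / 2) / 2"
    by (rule tendsto_divide[OF tendsto_add[OF a b] tendsto_const]) simp
  moreover have "((lsin (s + h n) - lsin s) / h n + (lsin (s + - h n) - lsin s) / - h n) / 2 = kern (h n) s / (2 * h n)" for n
    using h(2)[of n] by (simp add: kern_def lsin_minus_commute[of "h n" s] add.commute field_simps)
  ultimately show ?thesis by (simp add: mult.commute)
qed

text \<open>Folded at \<open>x\<close>, the principal value becomes an ordinary integral of this
  function when \<open>u\<close> is Hoelder continuous at \<open>x\<close>. The integral over
  [0, pi] is then twice the derivative of \<open>log_pot u\<close> and -2\<pi> times the Hilbert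
  transform.\<close>

definition conj_integrand :: "(real \<Rightarrow> real) \<Rightarrow> real \<Rightarrow> real \<Rightarrow> real" where
  "conj_integrand u x s = cot (s / 2) * (u (x + s) - u (x - s))"

lemma borel_measurable_cot [measurable]: "(cot :: real \<Rightarrow> real) \<in> borel_measurable borel"
  unfolding cot_def[abs_def] by measurable

text \<open>A condition at the single point \<open>x\<close> with its own constant: the constant
  obtained for the wave has \<open>u x\<close> in the denominator.\<close>

definition holder_at :: "(real \<Rightarrow> real) \<Rightarrow> real \<Rightarrow> real \<Rightarrow> bool" where
  "holder_at u x C \<longleftrightarrow> (\<forall>y. \<bar>u y - u x\<bar> \<le> C * \<bar>y - x\<bar> powr (3/4))"

lemma holder_at_diff:
  assumes "holder_at u x C" "\<bar>y - x\<bar> \<le> r" "\<bar>z - x\<bar> \<le> r"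
  shows "\<bar>u y - u z\<bar> \<le> 2 * C * r powr (3/4)"
proof -
  have C: "0 \<le> C" using assms(1)[unfolded holder_at_def, rule_format, of "x + 1"] by (simp add: abs_ge_zero order_trans[OF abs_ge_zero])
  have "\<bar>u y - u x\<bar> \<le> C * r powr (3/4)" "\<bar>u z - u x\<bar> \<le> C * r powr (3/4)"
    using assms C by (auto simp: holder_at_def intro!: order_trans[OF assms(1)[unfolded holder_at_def, rule_format]] mult_left_mono powr_mono2)
  then show ?thesis by linarith
qed

lemma set_integrable_conj_integrand:
  assumes u: "even_wave u" and C: "holder_at u x C"
  shows "set_integrable lborel {0..pi} (conj_integrand u x)"
proof (rule set_integrable_bound)
  have [measurable]: "u \<in> borel_measurable borel" by (rule even_waveD[OF u])
  show "set_integrable lborel {0..pi} (\<lambda>s. 2 * pi * C * s powr (-1/4))"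
    using set_integral_powr(1)[of "-1/4" pi] by (intro set_integrable_mult_right) auto
  show "set_borel_measurable lborel {0..pi} (conj_integrand u x)"
    unfolding set_borel_measurable_def conj_integrand_def[abs_def] by measurable
  show "AE s in lborel. s \<in> {0..pi} \<longrightarrow> norm (conj_integrand u x s) \<le> norm (2 * pi * C * s powr (-1/4))"
    using AE_lborel_singleton[of 0]
  proof (eventually_elim, safe)
    fix s :: real assume s: "s \<noteq> 0" "s \<in> {0..pi}"
    have "norm (conj_integrand u x s) \<le> (pi / s) * (2 * C * s powr (3/4))"
      unfolding conj_integrand_def real_norm_def abs_mult
      by (intro mult_mono abs_cot_half_le holder_at_diff[OF C]) (use s in auto)
    also have "\<dots> = 2 * pi * C * (s powr (3/4) / s powr 1)" using s by simp
    also have "\<dots> = 2 * pi * C * s powr (-1/4)" by (subst powr_diff[symmetric]) simp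
    finally show "norm (conj_integrand u x s) \<le> norm (2 * pi * C * s powr (-1/4))" by simp
  qed
qed

text \<open>The quotient from \<open>x\<close> to \<open>x + t\<close> is folded about the midpoint
  \<open>x + h\<close>, h = t / 2, and split at \<open>s = 2 * \<bar>h\<bar>\<close>. Inside, the
  mass of the kernel and the Hoelder bound give the power 3/4 + 3/4 - 1 > 0 of \<bar>h\<bar>, which
  tends to 0. Outside, the kernel quotient tends to the cotangent under an integrable majorant, a
  multiple of \<open>s powr (-1/4)\<close>.\<close>

lemma log_pot_has_derivative:
  assumes u: "even_wave u" and C: "holder_at u x C"
  shows "(log_pot u has_real_derivative (LBINT s:{0..pi}. conj_integrand u x s) / 2) (at x)"
  unfolding DERIV_def tendsto_at_iff_sequentially
proof (intro allI impI)
  fix t :: "nat \<Rightarrow> real" assume t: "\<forall>n. t n \<in> UNIV - {0}" "t \<longlonglongrightarrow> 0"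
  define h where "h n = t n / 2" for n
  have h0: "h n \<noteq> 0" for n using t(1) by (simp add: h_def)
  have hlim: "h \<longlonglongrightarrow> 0" unfolding h_def using t(2) by (auto intro!: tendsto_eq_intros)
  have [measurable]: "u \<in> borel_measurable borel" by (rule even_waveD[OF u])
  define w where "w n s = u (x + h n + s) - u (x + h n - s)" for n s
  have [measurable]: "w n \<in> borel_measurable borel" for n unfolding w_def[abs_def] by measurable
  define inner where "inner n s = (if s < 2 * \<bar>h n\<bar> then kern (h n) s / (2 * h n) * w n s else 0)" for n s
  define outer where "outer n s = (if s < 2 * \<bar>h n\<bar> then 0 else kern (h n) s / (2 * h n) * w n s)" for n s
  have split: "kern (h n) s / (2 * h n) * w n s = inner n s + outer n s" for n s
    by (simp add: inner_def outer_def)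
  have int: "set_integrable lborel {0..pi} (\<lambda>s. kern (h n) s / (2 * h n) * w n s)" for n
    using set_integrable_divide[OF set_integrable_kern_mult[OF u, of "h n" "x + h n"], of "2 * h n"]
    by (simp add: w_def)
  have int_inner: "set_integrable lborel {0..pi} (inner n)" for n
    by (rule set_integrable_bound[OF int[of n]])
       (auto simp: inner_def[abs_def] set_borel_measurable_def intro!: AE_I2)
  have int_outer: "set_integrable lborel {0..pi} (outer n)" for n
    by (rule set_integrable_bound[OF int[of n]])
       (auto simp: outer_def[abs_def] set_borel_measurable_def intro!: AE_I2)
  have quot: "(log_pot u (x + t n) - log_pot u x) / t n
      = (LBINT s:{0..pi}. inner n s) + (LBINT s:{0..pi}. outer n s)" for n
  proof -
    have "log_pot u (x + t n) - log_pot u x = (LBINT s:{0..pi}. kern (h n) s * w n s)"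
      using log_pot_diff[OF u, of "x + h n" "h n"] by (simp add: h_def w_def add.commute)
    then have "(log_pot u (x + t n) - log_pot u x) / t n = (LBINT s:{0..pi}. kern (h n) s / (2 * h n) * w n s)"
      by (simp add: h_def)
    then show ?thesis unfolding split using set_integral_add(2)[OF int_inner int_outer] by simp
  qed

  have abs_kern_int: "(LBINT s:{0..pi}. \<bar>kern (h n) s\<bar>) \<le> 16 * \<bar>h n\<bar> powr (3/4)" if "\<bar>h n\<bar> \<le> pi" for n
    using set_integral_abs_kern_le[of "h n"] set_integral_abs_kern_le[of "- h n"] that
    by (cases "0 \<le> h n") (auto simp: kern_minus)
  \<comment> \<open>The arguments of \<open>u\<close> in \<open>w n s\<close> lie within
    \<open>\<bar>h n\<bar> + s\<close> of \<open>x\<close>: less than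
    \<open>3 * \<bar>h n\<bar>\<close> here, at most \<open>3/2 * s\<close> in the outer
    part.\<close>
  have inner_le: "\<bar>LBINT s:{0..pi}. inner n s\<bar> \<le> 16 * C * (3 powr (3/4)) * \<bar>h n\<bar> powr (1/2)" if hn: "\<bar>h n\<bar> \<le> pi" for n
  proof -
    define B where "B = 2 * C * (3 * \<bar>h n\<bar>) powr (3/4) / (2 * \<bar>h n\<bar>)"
    have C0: "0 \<le> C" using C[unfolded holder_at_def, rule_format, of "x + 1"] order_trans[OF abs_ge_zero] by fastforce
    have "\<bar>LBINT s:{0..pi}. inner n s\<bar> \<le> (LBINT s:{0..pi}. \<bar>inner n s\<bar>)"
      using integral_norm_bound[of lborel "\<lambda>s. indicator {0..pi} s *\<^sub>R inner n s"]
      by (simp add: set_lebesgue_integral_def abs_mult)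
    also have "\<dots> \<le> (LBINT s:{0..pi}. \<bar>kern (h n) s\<bar> * B)"
    proof (rule set_integral_mono)
      fix s assume s: "s \<in> {0..pi}"
      show "\<bar>inner n s\<bar> \<le> \<bar>kern (h n) s\<bar> * B"
      proof (cases "s < 2 * \<bar>h n\<bar>")
        case True
        have "\<bar>w n s\<bar> \<le> 2 * C * (3 * \<bar>h n\<bar>) powr (3/4)"
          unfolding w_def by (rule holder_at_diff[OF C]) (use True s in auto)
        then have "\<bar>kern (h n) s\<bar> * \<bar>w n s\<bar> / (2 * \<bar>h n\<bar>) \<le> \<bar>kern (h n) s\<bar> * (2 * C * (3 * \<bar>h n\<bar>) powr (3/4)) / (2 * \<bar>h n\<bar>)"
          by (intro divide_right_mono mult_left_mono) auto
        then show ?thesis using True by (simp add: inner_def B_def abs_mult)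
      qed (use C0 in \<open>simp add: inner_def B_def\<close>)
    qed (use set_integrable_abs[OF int_inner] set_integrable_abs[OF set_integrable_kern] in auto)
    also have "\<dots> = (LBINT s:{0..pi}. \<bar>kern (h n) s\<bar>) * B" by simp
    also have "\<dots> \<le> 16 * \<bar>h n\<bar> powr (3/4) * B"
      using abs_kern_int[OF hn] C0 by (intro mult_right_mono) (auto simp: B_def)
    also have "\<dots> = 16 * C * (3 powr (3/4)) * (\<bar>h n\<bar> powr (3/4) * \<bar>h n\<bar> powr (3/4) / \<bar>h n\<bar> powr 1)"
      by (simp add: B_def powr_mult)
    also have "\<bar>h n\<bar> powr (3/4) * \<bar>h n\<bar> powr (3/4) / \<bar>h n\<bar> powr 1 = \<bar>h n\<bar> powr (1/2)"
      by (simp only: powr_add[symmetric] powr_diff[symmetric]) simp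
    finally show ?thesis .
  qed
  have inner_lim: "(\<lambda>n. LBINT s:{0..pi}. inner n s) \<longlonglongrightarrow> 0"
  proof (rule Lim_null_comparison)
    show "\<forall>\<^sub>F n in sequentially. norm (LBINT s:{0..pi}. inner n s) \<le> 16 * C * (3 powr (3/4)) * \<bar>h n\<bar> powr (1/2)"
    proof -
      have "\<forall>\<^sub>F n in sequentially. \<bar>h n\<bar> < pi"
        using tendsto_rabs[OF hlim] by (rule order_tendstoD) simp
      then show ?thesis by eventually_elim (use inner_le in auto)
    qed
    have "(\<lambda>n. 16 * C * (3 powr (3/4)) * \<bar>h n\<bar> powr (1/2)) \<longlonglongrightarrow> 16 * C * (3 powr (3/4)) * \<bar>0\<bar> powr (1/2)"
      by (intro tendsto_intros hlim) auto
    then show "(\<lambda>n. 16 * C * (3 powr (3/4)) * \<bar>h n\<bar> powr (1/2)) \<longlonglongrightarrow> 0" by simp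
  qed

  have outer_lim: "(\<lambda>n. LBINT s:{0..pi}. outer n s) \<longlonglongrightarrow> (LBINT s:{0..pi}. conj_integrand u x s / 2)"
    unfolding set_lebesgue_integral_def
  proof (rule integral_dominated_convergence)
    show "integrable lborel (\<lambda>s. indicator {0..pi} s *\<^sub>R (2 * pi * C * (3/2) powr (3/4) * s powr (-1/4)))"
      using set_integrable_mult_right[OF set_integral_powr(1)[of "-1/4" pi]] by (simp add: set_integrable_def)
    show "(\<lambda>s. indicator {0..pi} s *\<^sub>R outer n s) \<in> borel_measurable lborel" for n
      unfolding outer_def[abs_def] by measurable
    show "(\<lambda>s. indicator {0..pi} s *\<^sub>R (conj_integrand u x s / 2)) \<in> borel_measurable lborel"
      unfolding conj_integrand_def[abs_def] by measurable
    show "AE s in lborel. norm (indicator {0..pi} s *\<^sub>R outer n s)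
        \<le> indicator {0..pi} s *\<^sub>R (2 * pi * C * (3/2) powr (3/4) * s powr (-1/4))" for n
    proof (intro AE_I2)
      fix s :: real
      have C0: "0 \<le> C" using C[unfolded holder_at_def, rule_format, of "x + 1"] order_trans[OF abs_ge_zero] by fastforce
      show "norm (indicator {0..pi} s *\<^sub>R outer n s)
        \<le> indicator {0..pi} s *\<^sub>R (2 * pi * C * (3/2) powr (3/4) * s powr (-1/4))"
      proof (cases "s \<in> {0..pi} \<and> 2 * \<bar>h n\<bar> \<le> s")
        case True
        have s: "0 < s" using True h0[of n] by auto
        have "\<bar>kern (h n) s / (2 * h n)\<bar> \<le> (2 * pi * \<bar>h n\<bar> / s) / (2 * \<bar>h n\<bar>)"
          unfolding abs_divide abs_mult abs_numeral using abs_kern_le[of "h n" s] True by (intro divide_right_mono) auto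
        also have "\<dots> = pi / s" using h0[of n] by simp
        finally have k: "\<bar>kern (h n) s / (2 * h n)\<bar> \<le> pi / s" .
        have w: "\<bar>w n s\<bar> \<le> 2 * C * (3/2 * s) powr (3/4)"
          unfolding w_def by (rule holder_at_diff[OF C]) (use True in auto)
        have "\<bar>kern (h n) s / (2 * h n) * w n s\<bar> \<le> (pi / s) * (2 * C * (3/2 * s) powr (3/4))"
          unfolding abs_mult by (intro mult_mono k w) (use s in auto)
        also have "\<dots> = 2 * pi * C * (3/2) powr (3/4) * (s powr (3/4) / s powr 1)"
          using s by (subst powr_mult) auto
        also have "\<dots> = 2 * pi * C * (3/2) powr (3/4) * s powr (-1/4)" by (subst powr_diff[symmetric]) simp
        finally show ?thesis using True by (simp add: outer_def)
      qed (use C0 in \<open>auto simp: outer_def indicator_def\<close>)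
    qed
    show "AE s in lborel. (\<lambda>n. indicator {0..pi} s *\<^sub>R outer n s) \<longlonglongrightarrow> indicator {0..pi} s *\<^sub>R (conj_integrand u x s / 2)"
      using AE_lborel_singleton[of 0]
    proof eventually_elim
      case (elim s)
      show ?case
      proof (cases "s \<in> {0..pi}")
        case True
        then have s: "0 < s" "s < 2 * pi" using elim by auto
        have "\<forall>\<^sub>F n in sequentially. \<bar>h n\<bar> < s / 2"
          using tendsto_rabs[OF hlim] by (rule order_tendstoD) (use s in simp)
        then have ev: "\<forall>\<^sub>F n in sequentially. kern (h n) s / (2 * h n) * w n s = outer n s"
          by eventually_elim (simp add: outer_def)
        have uc: "isCont u y" for y
          using even_waveD(1)[OF u, of UNIV] by (simp add: continuous_on_eq_continuous_at)
        have "(\<lambda>n. w n s) \<longlonglongrightarrow> u (x + 0 + s) - u (x + 0 - s)"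
          unfolding w_def by (intro tendsto_diff isCont_tendsto_compose[OF uc] tendsto_intros hlim)
        then have "(\<lambda>n. kern (h n) s / (2 * h n) * w n s) \<longlonglongrightarrow> cot (s / 2) / 2 * (u (x + s) - u (x - s))"
          by (intro tendsto_mult kern_quotient_tendsto s hlim h0) simp
        then have "(\<lambda>n. outer n s) \<longlonglongrightarrow> conj_integrand u x s / 2"
          using Lim_transform_eventually[OF _ ev] by (simp add: conj_integrand_def)
        then show ?thesis using True by simp
      qed simp
    qed
  qed
  show "((\<lambda>k. (log_pot u (x + k) - log_pot u x) / k) \<circ> t) \<longlonglongrightarrow> (LBINT s:{0..pi}. conj_integrand u x s) / 2"
    using tendsto_add[OF inner_lim outer_lim] by (simp add: o_def quot)
qed

text \<open>\<open>pv_domain\<close> without the restriction to one period. This set is invariant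
  under 2\<pi>, so the truncated integrand becomes a periodic function and can be folded about
  \<open>x\<close>, wherever \<open>x\<close> lies.\<close>

definition off_lattice :: "real \<Rightarrow> real \<Rightarrow> real set" where
  "off_lattice x \<epsilon> = {y. \<forall>k::int. \<epsilon> < \<bar>x - y - 2 * pi * of_int k\<bar>}"

lemma pv_domain_eq: "pv_domain x \<epsilon> = {-pi..pi} \<inter> off_lattice x \<epsilon>"
  by (auto simp: pv_domain_def off_lattice_def)

lemma off_lattice_sets [measurable]: "off_lattice x \<epsilon> \<in> sets borel"
  unfolding off_lattice_def by measurable

lemma off_lattice_periodic: "y + 2 * pi \<in> off_lattice x \<epsilon> \<longleftrightarrow> y \<in> off_lattice x \<epsilon>"
proof -
  have eq: "x - (y + 2 * pi) - 2 * pi * of_int k = x - y - 2 * pi * of_int (k + 1)" for k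
    by (simp add: algebra_simps)
  have "(\<forall>k::int. \<epsilon> < \<bar>x - y - 2 * pi * of_int (k + 1)\<bar>) \<longleftrightarrow> (\<forall>k::int. \<epsilon> < \<bar>x - y - 2 * pi * of_int k\<bar>)"
    by (metis diff_add_cancel)
  then show ?thesis unfolding off_lattice_def mem_Collect_eq eq .
qed

lemma off_lattice_near:
  assumes "s \<in> {0..pi}"
  shows "x + s \<in> off_lattice x \<epsilon> \<longleftrightarrow> \<epsilon> < s" "x - s \<in> off_lattice x \<epsilon> \<longleftrightarrow> \<epsilon> < s"
proof -
  have far: "s \<le> \<bar>s + 2 * pi * of_int k\<bar> \<and> s \<le> \<bar>s - 2 * pi * of_int k\<bar>" for k :: int
  proof (cases "k = 0")
    case False
    then have "1 \<le> \<bar>real_of_int k\<bar>" by linarith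
    then have "2 * pi * 1 \<le> 2 * pi * \<bar>real_of_int k\<bar>" by (intro mult_left_mono) auto
    then have "2 * pi \<le> \<bar>2 * pi * of_int k\<bar>" by (simp add: abs_mult)
    then show ?thesis using assms unfolding atLeastAtMost_iff by arith
  qed (use assms in auto)
  have eq: "\<bar>x - (x + s) - 2 * pi * of_int k\<bar> = \<bar>s + 2 * pi * of_int k\<bar>"
    "\<bar>x - (x - s) - 2 * pi * of_int k\<bar> = \<bar>s - 2 * pi * of_int k\<bar>" for k :: int
    by (simp_all add: abs_minus_commute abs_if)
  show "x + s \<in> off_lattice x \<epsilon> \<longleftrightarrow> \<epsilon> < s" "x - s \<in> off_lattice x \<epsilon> \<longleftrightarrow> \<epsilon> < s"
    unfolding off_lattice_def mem_Collect_eq eq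
    using far assms by (auto intro: less_le_trans dest: spec[of _ 0])
qed

lemma abs_cot_off_lattice:
  assumes "y \<in> off_lattice x \<epsilon>" "0 < \<epsilon>"
  shows "\<bar>cot ((x - y) / 2)\<bar> \<le> pi / \<epsilon>"
proof -
  obtain k where k: "-pi \<le> (x - y) + 2 * pi * of_int k" "(x - y) + 2 * pi * of_int k < pi"
    using two_pi_representative[of "-pi" "x - y"] by auto
  define z where "z = x - y + 2 * pi * of_int k"
  have z: "\<epsilon> < \<bar>z\<bar>" "\<bar>z\<bar> \<le> pi"
    using assms(1)[unfolded off_lattice_def mem_Collect_eq, rule_format, of "- k"] k by (auto simp: z_def)
  have "two_pi_periodic (\<lambda>z. cot (z / 2))"
    unfolding two_pi_periodic_def by (simp add: add_divide_distrib cot_periodic cot_def)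
  from two_pi_periodic_int[OF this, of "x - y" k] have "\<bar>cot ((x - y) / 2)\<bar> = \<bar>cot (z / 2)\<bar>"
    by (simp add: z_def)
  also have "\<dots> = \<bar>cot (\<bar>z\<bar> / 2)\<bar>" by (simp add: cot_def abs_if)
  also have "\<dots> \<le> pi / \<bar>z\<bar>" using z assms(2) by (intro abs_cot_half_le) auto
  also have "\<dots> \<le> pi / \<epsilon>" using z assms(2) by (intro divide_left_mono) auto
  finally show ?thesis .
qed

text \<open>Removing the \<epsilon>-neighbourhoods of the points congruent to \<open>x\<close>
  leaves \<open>s > \<epsilon>\<close> after folding, so the principal value is a limit of integrals
  over [\<epsilon>, pi] of an integrable function. The sign comes from
  \<open>cot ((x - y) / 2)\<close> at \<open>y = x + s\<close>.\<close>

lemma has_hilbert_transform_even_wave: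
  assumes u: "even_wave u" and int: "set_integrable lborel {0..pi} (conj_integrand u x)"
  shows "has_hilbert_transform u x (- (LBINT s:{0..pi}. conj_integrand u x s) / (2 * pi))"
proof -
  have [measurable]: "u \<in> borel_measurable borel" by (rule even_waveD[OF u])
  obtain M where M: "0 < M" "\<And>x. \<bar>u x\<bar> \<le> M" using even_wave_bounded[OF u] by blast
  define f where "f \<epsilon> y = indicat_real (off_lattice x \<epsilon>) y * (cot ((x - y) / 2) * u y)" for \<epsilon> y
  have f_ind: "indicat_real {-pi..pi} y *\<^sub>R f \<epsilon> y = indicat_real (pv_domain x \<epsilon>) y *\<^sub>R (cot ((x - y) / 2) * u y)" for \<epsilon> y
    by (simp add: f_def pv_domain_eq indicator_inter_arith)
  have fint: "set_integrable lborel {-pi..pi} (f \<epsilon>)" if "0 < \<epsilon>" for \<epsilon>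
  proof (rule set_integrable_bound)
    show "set_integrable lborel {-pi..pi} (\<lambda>y. pi / \<epsilon> * M)"
      by (intro set_integrable_continuous continuous_intros)
    show "set_borel_measurable lborel {-pi..pi} (f \<epsilon>)"
      unfolding set_borel_measurable_def f_def[abs_def] by measurable
    show "AE y in lborel. y \<in> {-pi..pi} \<longrightarrow> norm (f \<epsilon> y) \<le> norm (pi / \<epsilon> * M)"
    proof (intro AE_I2 impI)
      fix y
      show "norm (f \<epsilon> y) \<le> norm (pi / \<epsilon> * M)"
      proof (cases "y \<in> off_lattice x \<epsilon>")
        case True
        then have "norm (f \<epsilon> y) = \<bar>cot ((x - y) / 2)\<bar> * \<bar>u y\<bar>" by (simp add: f_def abs_mult)
        also have "\<dots> \<le> pi / \<epsilon> * M" by (intro mult_mono abs_cot_off_lattice[OF True] M) (use that in auto)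
        finally show ?thesis using M(1) that by simp
      qed (simp add: f_def)
    qed
  qed
  have per: "two_pi_periodic (f \<epsilon>)" for \<epsilon>
  proof -
    have "cot ((x - (y + 2 * pi)) / 2) = cot ((x - y) / 2)" for y
    proof -
      have "(x - (y + 2 * pi)) / 2 = (x - y) / 2 - pi" by (simp add: diff_divide_distrib add_divide_distrib)
      then show ?thesis by (simp only:) (simp add: cot_def sin_diff cos_diff)
    qed
    then show ?thesis
      using off_lattice_periodic even_waveD(4)[OF u] by (simp add: two_pi_periodic_def f_def indicator_def)
  qed
  have eq: "(LBINT y:pv_domain x \<epsilon>. cot ((x - y) / 2) * u y) = - (LBINT s:{\<epsilon>..pi}. conj_integrand u x s)"
    if \<epsilon>: "0 < \<epsilon>" for \<epsilon>
  proof -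
    have "(LBINT y:pv_domain x \<epsilon>. cot ((x - y) / 2) * u y) = (LBINT y:{-pi..pi}. f \<epsilon> y)"
      unfolding set_lebesgue_integral_def f_ind ..
    also have "\<dots> = (LBINT s:{0..pi}. f \<epsilon> (x + s) + f \<epsilon> (x - s))"
      by (rule set_integral_periodic_fold(3)[OF per fint[OF \<epsilon>]])
    also have "\<dots> = (LBINT s:{0..pi}. indicator {\<epsilon><..} s * (- conj_integrand u x s))"
    proof (rule set_lebesgue_integral_cong)
      show "\<forall>s. s \<in> {0..pi} \<longrightarrow> f \<epsilon> (x + s) + f \<epsilon> (x - s) = indicator {\<epsilon><..} s * (- conj_integrand u x s)"
        using off_lattice_near by (auto simp: f_def indicator_def conj_integrand_def algebra_simps)
    qed simp
    also have "\<dots> = (LBINT s:{\<epsilon><..pi}. - conj_integrand u x s)"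
      unfolding set_lebesgue_integral_def
      by (intro Bochner_Integration.integral_cong) (use \<epsilon> in \<open>auto simp: indicator_def\<close>)
    also have "\<dots> = (LBINT s:{\<epsilon>..pi}. - conj_integrand u x s)"
    proof (rule set_integral_cong_set)
      show "AE s in lborel. s \<in> {\<epsilon>..pi} \<longleftrightarrow> s \<in> {\<epsilon><..pi}"
        using AE_lborel_singleton[of \<epsilon>] by eventually_elim auto
    qed (auto simp: set_borel_measurable_def conj_integrand_def[abs_def])
    also have "\<dots> = - (LBINT s:{\<epsilon>..pi}. conj_integrand u x s)"
      by (rule set_integral_uminus, rule set_integrable_subinterval[OF int]) (use \<epsilon> in auto)
    finally show ?thesis .
  qed
  have "((\<lambda>\<epsilon>. LBINT s:{\<epsilon>..pi}. conj_integrand u x s) \<longlongrightarrow> (LBINT s:{0<..pi}. conj_integrand u x s)) (at_right 0)"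
    by (rule tendsto_set_lebesgue_integral_at_right)
       (auto intro: set_integrable_subset[OF int])
  also have "(LBINT s:{0<..pi}. conj_integrand u x s) = (LBINT s:{0..pi}. conj_integrand u x s)"
  proof (rule set_integral_cong_set)
    show "AE s in lborel. s \<in> {0..pi} \<longleftrightarrow> s \<in> {0<..pi}"
      using AE_lborel_singleton[of 0] by eventually_elim auto
  qed (auto simp: set_borel_measurable_def conj_integrand_def[abs_def])
  finally have lim: "((\<lambda>\<epsilon>. LBINT s:{\<epsilon>..pi}. conj_integrand u x s) \<longlongrightarrow> (LBINT s:{0..pi}. conj_integrand u x s)) (at_right 0)" .
  have "((\<lambda>\<epsilon>. 1 / (2 * pi) * - (LBINT s:{\<epsilon>..pi}. conj_integrand u x s))
      \<longlongrightarrow> 1 / (2 * pi) * - (LBINT s:{0..pi}. conj_integrand u x s)) (at_right 0)"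
    by (intro tendsto_intros lim)
  moreover have "\<forall>\<^sub>F \<epsilon> in at_right 0. 1 / (2 * pi) * - (LBINT s:{\<epsilon>..pi}. conj_integrand u x s)
      = 1 / (2 * pi) * (LBINT y:pv_domain x \<epsilon>. cot ((x - y) / 2) * u y)"
    using eventually_at_right_less[of 0] by eventually_elim (simp add: eq)
  ultimately have "((\<lambda>\<epsilon>. 1 / (2 * pi) * (LBINT y:pv_domain x \<epsilon>. cot ((x - y) / 2) * u y))
      \<longlongrightarrow> - (LBINT s:{0..pi}. conj_integrand u x s) / (2 * pi)) (at_right 0)"
    using Lim_transform_eventually by fastforce
  moreover have "set_integrable lborel (pv_domain x \<epsilon>) (\<lambda>y. cot ((x - y) / 2) * u y)" if "0 < \<epsilon>" for \<epsilon>
    using fint[OF that] unfolding set_integrable_def f_ind .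
  ultimately show ?thesis by (simp add: has_hilbert_transform_def)
qed

subsection \<open>The profile equation\<close>

locale cusped_wave =
  fixes u :: "real \<Rightarrow> real"
  assumes hump: "hump u" and zero: "u 0 = 0" and mode_pos: "0 < first_mode u"
    and wave_eq: "\<And>x. u x ^ 2 = pot_rise u x"
begin

lemma even_wave: "even_wave u"
  using hump by (rule hump_even_wave)

lemma nonneg: "0 \<le> u x"
  using hump_bounds(1)[OF hump, of x] zero by simp

lemma le_pi: "\<bar>u x\<bar> \<le> u pi"
  using hump_bounds(2)[OF hump, of x] nonneg[of x] by simp

lemma linear_lower:
  assumes "x \<in> {0..pi}"
  shows "sqrt (first_mode u / 40) * x \<le> u x"
proof (rule power2_le_imp_le)
  show "(sqrt (first_mode u / 40) * x) ^ 2 \<le> u x ^ 2"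
    using pot_rise_lower[OF hump assms] mode_pos unfolding wave_eq by (simp add: power_mult_distrib mult.commute)
qed (rule nonneg)

lemma pos:
  assumes "x \<notin> range (\<lambda>k::int. 2 * pi * of_int k)"
  shows "0 < u x"
proof -
  obtain k where k: "-pi \<le> x + 2 * pi * of_int k" "x + 2 * pi * of_int k < pi"
    using two_pi_representative[of "-pi" x] by auto
  define z where "z = x + 2 * pi * of_int k"
  have "z \<noteq> 0"
  proof
    assume "z = 0"
    then have "x = 2 * pi * of_int (- k)" by (simp add: z_def)
    with assms show False by blast
  qed
  then have z: "\<bar>z\<bar> \<in> {0..pi}" "0 < \<bar>z\<bar>" using k by (auto simp: z_def)
  have "u x = u z" unfolding z_def using two_pi_periodic_int[OF even_waveD(2)[OF even_wave], of x k] by simp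
  also have "\<dots> = u \<bar>z\<bar>" using even_waveD(3)[OF even_wave, of z] by (simp add: abs_if)
  finally show ?thesis
    using linear_lower[OF z(1)] mult_pos_pos[OF _ z(2), of "sqrt (first_mode u / 40)"] mode_pos by simp
qed

text \<open>The square of \<open>u\<close> is a potential up to a constant, hence Hoelder
  continuous, and \<open>u y ^ 2 - u x ^ 2\<close> contains the factor
  \<open>u y + u x \<ge> u x\<close>, which can be divided out.\<close>

lemma holder_at:
  assumes "0 < u x"
  shows "holder_at u x (32 * u pi / u x)"
  unfolding holder_at_def
proof
  fix y
  have "\<bar>u y - u x\<bar> * u x \<le> \<bar>u y - u x\<bar> * (u y + u x)"
    using nonneg[of y] by (intro mult_left_mono) auto
  also have "\<dots> = \<bar>(u y - u x) * (u y + u x)\<bar>" using nonneg[of y] assms by (simp add: abs_mult)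
  also have "(u y - u x) * (u y + u x) = u y ^ 2 - u x ^ 2" by (simp add: power2_eq_square algebra_simps)
  also have "\<dots> = log_pot u y - log_pot u x" by (simp add: wave_eq pot_rise_def)
  also have "\<bar>\<dots>\<bar> \<le> 32 * u pi * \<bar>y - x\<bar> powr (3/4)"
    by (rule log_pot_holder[OF even_wave le_pi])
  finally show "\<bar>u y - u x\<bar> \<le> 32 * u pi / u x * \<bar>y - x\<bar> powr (3/4)"
    using assms by (simp add: field_simps)
qed

text \<open>Differentiating the root of \<open>pot_rise u\<close> gives \<open>I / (4 * u x)\<close>
  for the derivative of \<open>u\<close>. Both sides of the equation then equal
  \<open>I / pi ^ 2\<close>: the factor 2 / pi in the profile makes them agree, and \<open>c\<close>
  cancels.\<close>

lemma profile:
  "burgers_hilbert_profile_on (- range (\<lambda>k::int. 2 * pi * of_int k)) c (\<lambda>x. c - 2 / pi * u x)"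
  unfolding burgers_hilbert_profile_on_def
proof
  fix x assume "x \<in> - range (\<lambda>k::int. 2 * pi * of_int k)"
  then have ux: "0 < u x" using pos by simp
  define I where "I = (LBINT s:{0..pi}. conj_integrand u x s)"
  have "(pot_rise u has_real_derivative I / 2 - 0) (at x)"
    unfolding pot_rise_def[abs_def] I_def
    by (intro DERIV_diff log_pot_has_derivative[OF even_wave holder_at[OF ux]] DERIV_const)
  moreover have "0 < pot_rise u x" using ux by (simp flip: wave_eq)
  ultimately have "((\<lambda>x. sqrt (pot_rise u x)) has_real_derivative inverse (sqrt (pot_rise u x)) / 2 * (I / 2)) (at x)"
    by (intro DERIV_chain2[OF DERIV_real_sqrt]) auto
  moreover have root: "sqrt (pot_rise u y) = u y" for y using nonneg[of y] by (simp flip: wave_eq)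
  ultimately have "(u has_real_derivative inverse (u x) / 2 * (I / 2)) (at x)" unfolding root by blast
  then have du: "(u has_real_derivative I / (4 * u x)) (at x)"
    by (rule DERIV_cong) (simp add: field_simps)
  define d where "d = - (2 / pi * (I / (4 * u x)))"
  have d: "((\<lambda>x. c - 2 / pi * u x) has_real_derivative d) (at x)"
    unfolding d_def using DERIV_diff[OF DERIV_const DERIV_cmult[OF du, of "2 / pi"]] by (rule DERIV_cong) simp
  have ev: "even_wave (\<lambda>x. c - 2 / pi * u x)"
    using even_wave by (auto simp: even_wave_def two_pi_periodic_def intro!: continuous_intros)
  have conj: "conj_integrand (\<lambda>x. c - 2 / pi * u x) x = (\<lambda>s. - (2 / pi) * conj_integrand u x s)"
    by (auto simp: conj_integrand_def algebra_simps)
  have int: "set_integrable lborel {0..pi} (conj_integrand (\<lambda>x. c - 2 / pi * u x) x)"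
    unfolding conj by (intro set_integrable_mult_right set_integrable_conj_integrand[OF even_wave holder_at[OF ux]])
  have "- (LBINT s:{0..pi}. conj_integrand (\<lambda>x. c - 2 / pi * u x) x s) / (2 * pi) = I / pi ^ 2"
    unfolding conj set_integral_mult_right I_def by (simp add: power2_eq_square)
  also have "\<dots> = - c * d + (c - 2 / pi * u x) * d"
    using ux by (simp add: d_def field_simps power2_eq_square)
  finally have "has_hilbert_transform (\<lambda>x. c - 2 / pi * u x) x (- c * d + (c - 2 / pi * u x) * d)"
    using has_hilbert_transform_even_wave[OF ev int] by simp
  with d show "\<exists>d. ((\<lambda>x. c - 2 / pi * u x) has_real_derivative d) (at x) \<and>
      has_hilbert_transform (\<lambda>x. c - 2 / pi * u x) x (- c * d + (c - 2 / pi * u x) * d)" by blast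
qed

end

text \<open>
  The error in the lower bound must be relative to \<open>w\<close>: an error \<open>C * t\<close> would not exclude
  that \<open>w\<close> stays bounded.
\<close>

lemma sqrt_ode_asymptotics:
  fixes P w :: "real \<Rightarrow> real"
  assumes T: "1 \<le> T" and c: "0 < c" and C: "0 \<le> C"
    and deriv: "\<And>t. T \<le> t \<Longrightarrow> (P has_real_derivative w t) (at t)"
    and P0: "\<And>t. T \<le> t \<Longrightarrow> 0 \<le> P t"
    and wc: "\<And>t. T \<le> t \<Longrightarrow> c \<le> w t"
    and lower: "\<And>t. T \<le> t \<Longrightarrow> P t - C - C * w t \<le> w t ^ 2"
    and upper: "\<And>t. T \<le> t \<Longrightarrow> w t ^ 2 \<le> P t + C * t"
  obtains A T' where "T \<le> T'" "\<And>t. T' \<le> t \<Longrightarrow> \<bar>w t - t / 2\<bar> \<le> A * sqrt t"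
proof -
  \<comment> \<open>From completing the square: the lower hypothesis gives
    \<open>P t \<le> (w t + C / 2) ^ 2 + C\<close>, so \<open>w\<close> falls below
    \<open>sqrt (P t)\<close> by at most \<open>D\<close>.\<close>
  define D where "D = sqrt C + C / 2"
  have D0: "0 \<le> D" using C by (simp add: D_def)
  have w_lower: "sqrt (P t) - D \<le> w t" if t: "T \<le> t" for t
  proof -
    have w0: "0 \<le> w t" using wc[OF t] c by linarith
    have "(w t + C / 2) ^ 2 = w t ^ 2 + C * w t + C ^ 2 / 4" by (simp add: power2_eq_square algebra_simps)
    then have "P t \<le> (w t + C / 2) ^ 2 + C" using lower[OF t] zero_le_power2[of C] by linarith
    then have "sqrt (P t) \<le> sqrt ((w t + C / 2) ^ 2 + C)" by simp
    also have "\<dots> \<le> sqrt ((w t + C / 2) ^ 2) + sqrt C" by (rule sqrt_add_le_add_sqrt) (use C in auto)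
    also have "\<dots> = w t + C / 2 + sqrt C" using w0 C by simp
    finally show ?thesis by (simp add: D_def)
  qed
  have mono: "f a \<le> f b" if "S \<le> a" "a \<le> b" and "\<And>t. S \<le> t \<Longrightarrow> \<exists>y. (f has_real_derivative y) (at t) \<and> 0 \<le> y"
    for f :: "real \<Rightarrow> real" and S a b
    by (rule DERIV_nonneg_imp_nondecreasing[OF that(2)]) (use that in auto)

  \<comment> \<open>Bootstrap: \<open>w \<ge> c\<close> makes \<open>P\<close> grow at least
    linearly, so \<open>sqrt (P t)\<close> eventually exceeds \<open>2 * D\<close>; then
    \<open>sqrt (P t)\<close> has slope at least 1/4, and \<open>P\<close> grows
    quadratically.\<close>
  have P_lin: "c * (t - T) \<le> P t" if "T \<le> t" for t
  proof -
    have "P T - c * T \<le> P t - c * t"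
    proof (rule mono[of T T t "\<lambda>t. P t - c * t"])
      fix t assume t: "T \<le> t"
      have "((\<lambda>t. P t - c * t) has_real_derivative (w t - c)) (at t)"
        using DERIV_diff[OF deriv[OF t] DERIV_cmult[OF DERIV_ident, of c]] by simp
      then show "\<exists>y. ((\<lambda>t. P t - c * t) has_real_derivative y) (at t) \<and> 0 \<le> y" using wc[OF t] by auto
    qed (use that in auto)
    then show ?thesis using P0[of T] by (simp add: algebra_simps)
  qed
  define T1 where "T1 = T + ((2 * D) ^ 2 + 1) / c"
  have T1: "T \<le> T1" using c by (simp add: T1_def)
  have big: "2 * D \<le> sqrt (P t)" "1 \<le> P t" if t: "T1 \<le> t" for t
  proof -
    have "(2 * D) ^ 2 + 1 \<le> c * (t - T)" using t c by (simp add: T1_def field_simps)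
    also have "\<dots> \<le> P t" using P_lin t T1 by simp
    finally have *: "(2 * D) ^ 2 + 1 \<le> P t" .
    then show "2 * D \<le> sqrt (P t)" by (intro real_le_rsqrt) simp
    show "1 \<le> P t" using * zero_le_power2[of "2 * D"] by linarith
  qed
  have dsqrt: "((\<lambda>t. sqrt (P t)) has_real_derivative w t / (2 * sqrt (P t))) (at t)" if t: "T1 \<le> t" for t
  proof -
    have "0 < P t" using big(2)[OF t] by linarith
    from DERIV_chain2[OF DERIV_real_sqrt[OF this] deriv[of t]] show ?thesis
      using t T1 by (simp add: field_simps)
  qed
  \<comment> \<open>From \<open>2 * T1\<close> on, the bound \<open>(t - T1) / 4\<close> is at least
    \<open>t / 8\<close>.\<close>
  define T2 where "T2 = 2 * T1"
  have T2: "T1 \<le> T2" "1 \<le> T2" using T T1 by (auto simp: T2_def)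
  have sq_lin: "t / 8 \<le> sqrt (P t)" if t: "T2 \<le> t" for t
  proof -
    have "sqrt (P T1) - T1 / 4 \<le> sqrt (P t) - t / 4"
    proof (rule mono[of T1 T1 t "\<lambda>t. sqrt (P t) - t / 4"])
      fix t assume t: "T1 \<le> t"
      have "((\<lambda>t. sqrt (P t) - t / 4) has_real_derivative (w t / (2 * sqrt (P t)) - 1 / 4)) (at t)"
        by (intro DERIV_diff dsqrt[OF t] DERIV_cdivide DERIV_ident)
      moreover have "1 / 4 \<le> w t / (2 * sqrt (P t))"
      proof -
        have "sqrt (P t) / 2 \<le> w t" using w_lower[of t] big(1)[OF t] t T1 by linarith
        moreover have "0 < sqrt (P t)" using big(2)[OF t] by simp
        ultimately show ?thesis by (simp add: field_simps)
      qed
      ultimately show "\<exists>y. ((\<lambda>t. sqrt (P t) - t / 4) has_real_derivative y) (at t) \<and> 0 \<le> y" by force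
    qed (use t T2 in auto)
    moreover have "0 \<le> sqrt (P T1)" using P0[of T1] T1 by simp
    moreover have "T1 \<le> t / 2" using t by (simp add: T2_def)
    ultimately show ?thesis by linarith
  qed
  \<comment> \<open>\<open>sq_lin\<close> even gives 4 / t; the weaker 4 / sqrt t integrates to the
    error sqrt t that is claimed.\<close>
  have inv_le: "1 / (2 * sqrt (P t)) \<le> 4 / sqrt t" if t: "T2 \<le> t" for t
  proof -
    have t1: "1 \<le> t" using t T2 by linarith
    have "sqrt t * 1 \<le> sqrt t * sqrt t" using t1 by (intro mult_left_mono) auto
    then have "sqrt t / 4 \<le> t / 4" using t1 by simp
    also have "\<dots> \<le> 2 * sqrt (P t)" using sq_lin[OF t] by simp
    finally have "1 / (2 * sqrt (P t)) \<le> 1 / (sqrt t / 4)"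
      using t1 big(2)[of t] t T2 by (intro divide_left_mono) (auto intro!: mult_pos_pos)
    then show ?thesis by simp
  qed
  have dlin: "((\<lambda>t. sqrt (P t) - t / 2 + b * sqrt t) has_real_derivative (w t / (2 * sqrt (P t)) - 1 / 2 + b / (2 * sqrt t))) (at t)"
    if t: "T2 \<le> t" for t b
  proof -
    have "0 < t" using t T2 by linarith
    then show ?thesis
      using DERIV_add[OF DERIV_diff[OF dsqrt DERIV_cdivide[OF DERIV_ident, of 2]] DERIV_cmult[OF DERIV_real_sqrt, of t b]] t T2
      by (simp add: field_simps)
  qed
  \<comment> \<open>The error \<open>C * t\<close> in the square is at most
    \<open>8 * C * sqrt (P t)\<close>, hence a bounded error in the root.\<close>
  have w_upper: "w t \<le> sqrt (P t) + 4 * C" if t: "T2 \<le> t" for t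
  proof (rule power2_le_imp_le)
    have Pt: "0 \<le> P t" using P0[of t] t T1 T2 by linarith
    have "C * t \<le> C * (8 * sqrt (P t))" using sq_lin[OF t] C by (intro mult_left_mono) auto
    moreover have "(sqrt (P t) + 4 * C) ^ 2 = P t + C * (8 * sqrt (P t)) + 16 * C ^ 2"
      using Pt by (simp add: power2_eq_square algebra_simps)
    ultimately have "P t + C * t \<le> (sqrt (P t) + 4 * C) ^ 2" using zero_le_power2[of C] by linarith
    then show "w t ^ 2 \<le> (sqrt (P t) + 4 * C) ^ 2" using upper[of t] t T1 T2 by linarith
    show "0 \<le> sqrt (P t) + 4 * C" using Pt C by simp
  qed
  \<comment> \<open>The derivatives 4 D / sqrt t and 16 C / sqrt t of 8 D sqrt t and 32 C sqrt t
    dominate the deviation of the slope of sqrt P from 1/2; the absolute value covers the initial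
    value at \<open>T2\<close>.\<close>
  define A1 where "A1 = \<bar>sqrt (P T2) - T2 / 2\<bar> + 8 * D"
  define A2 where "A2 = \<bar>sqrt (P T2) - T2 / 2\<bar> + 32 * C"
  have lo: "t / 2 - A1 * sqrt t \<le> sqrt (P t)" if t: "T2 \<le> t" for t
  proof -
    have "sqrt (P T2) - T2 / 2 + 8 * D * sqrt T2 \<le> sqrt (P t) - t / 2 + 8 * D * sqrt t"
    proof (rule mono[of T2 T2 t "\<lambda>t. sqrt (P t) - t / 2 + 8 * D * sqrt t"])
      fix t assume t: "T2 \<le> t"
      have P: "1 \<le> P t" using big(2)[of t] t T2 by linarith
      have "(sqrt (P t) - D) / (2 * sqrt (P t)) \<le> w t / (2 * sqrt (P t))"
        using w_lower[of t] t T1 T2 P by (intro divide_right_mono) auto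
      also have "(sqrt (P t) - D) / (2 * sqrt (P t)) = 1 / 2 - D * (1 / (2 * sqrt (P t)))"
        using P by (simp add: field_simps)
      finally have "1 / 2 - D * (4 / sqrt t) \<le> w t / (2 * sqrt (P t))"
        using mult_left_mono[OF inv_le[OF t] D0] by linarith
      then have "0 \<le> w t / (2 * sqrt (P t)) - 1 / 2 + 8 * D / (2 * sqrt t)" by (simp add: field_simps)
      then show "\<exists>y. ((\<lambda>t. sqrt (P t) - t / 2 + 8 * D * sqrt t) has_real_derivative y) (at t) \<and> 0 \<le> y"
        using dlin[OF t] by blast
    qed (use t in auto)
    moreover have "0 \<le> 8 * D * sqrt T2" using D0 T2 by simp
    moreover have "\<bar>sqrt (P T2) - T2 / 2\<bar> * 1 \<le> \<bar>sqrt (P T2) - T2 / 2\<bar> * sqrt t"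
      using t T2 by (intro mult_left_mono) auto
    ultimately show ?thesis by (simp add: A1_def algebra_simps)
  qed
  have hi: "sqrt (P t) \<le> t / 2 + A2 * sqrt t" if t: "T2 \<le> t" for t
  proof -
    have "- (sqrt (P T2) - T2 / 2 + (- 32 * C) * sqrt T2) \<le> - (sqrt (P t) - t / 2 + (- 32 * C) * sqrt t)"
    proof (rule mono[of T2 T2 t "\<lambda>t. - (sqrt (P t) - t / 2 + (- 32 * C) * sqrt t)"])
      fix t assume t: "T2 \<le> t"
      have P: "1 \<le> P t" using big(2)[of t] t T2 by linarith
      have "w t / (2 * sqrt (P t)) \<le> (sqrt (P t) + 4 * C) / (2 * sqrt (P t))"
        using w_upper[OF t] P by (intro divide_right_mono) auto
      also have "\<dots> = 1 / 2 + 4 * C * (1 / (2 * sqrt (P t)))"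
        using P by (simp add: field_simps)
      finally have "w t / (2 * sqrt (P t)) \<le> 1 / 2 + 4 * C * (4 / sqrt t)"
        using mult_left_mono[OF inv_le[OF t], of "4 * C"] C by linarith
      then have "0 \<le> - (w t / (2 * sqrt (P t)) - 1 / 2 + (- 32 * C) / (2 * sqrt t))" by (simp add: field_simps)
      then show "\<exists>y. ((\<lambda>t. - (sqrt (P t) - t / 2 + (- 32 * C) * sqrt t)) has_real_derivative y) (at t) \<and> 0 \<le> y"
        using DERIV_minus[OF dlin[OF t]] by blast
    qed (use t in auto)
    moreover have "0 \<le> 32 * C * sqrt T2" using C T2 by simp
    moreover have "\<bar>sqrt (P T2) - T2 / 2\<bar> * 1 \<le> \<bar>sqrt (P T2) - T2 / 2\<bar> * sqrt t"
      using t T2 by (intro mult_left_mono) auto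
    ultimately show ?thesis by (simp add: A2_def algebra_simps)
  qed
  show thesis
  proof (rule that[of T2 "A1 + A2 + D + 4 * C"])
    show "T \<le> T2" using T1 T2 by linarith
    fix t assume t: "T2 \<le> t"
    have t1: "1 \<le> sqrt t" using t T2 by simp
    have "D * 1 \<le> D * sqrt t" "4 * C * 1 \<le> 4 * C * sqrt t" "0 \<le> A1 * sqrt t" "0 \<le> A2 * sqrt t"
      "0 \<le> D * sqrt t" "0 \<le> 4 * C * sqrt t"
      using t1 D0 C by (intro mult_left_mono mult_nonneg_nonneg; auto simp: A1_def A2_def)+
    moreover have "T \<le> t" using t T1 T2 by linarith
    ultimately show "\<bar>w t - t / 2\<bar> \<le> (A1 + A2 + D + 4 * C) * sqrt t"
      using lo[OF t] hi[OF t] w_lower[of t] w_upper[OF t] unfolding distrib_right by linarith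
  qed
qed

subsection \<open>Asymptotics at the cusp\<close>

text \<open>The kernel of \<open>pot_rise\<close> on even functions, from pairing y with -y; the
  term \<open>2 * lsin y\<close> stems from the subtracted potential at 0.\<close>

definition fold_kern :: "real \<Rightarrow> real \<Rightarrow> real" where
  "fold_kern x y = 2 * lsin y - lsin (x - y) - lsin (x + y)"

definition sin_ratio :: "real \<Rightarrow> real \<Rightarrow> real" where
  "sin_ratio x y = sin (x / 2) ^ 2 / sin (y / 2) ^ 2"

lemma set_integrable_fold_kern: "set_integrable lborel {0..pi} (fold_kern x)"
proof -
  have i: "set_integrable lborel {0..pi} lsin"
    using set_integrable_subinterval[OF set_integrable_lsin] by simp
  have j: "set_integrable lborel {0..pi} (\<lambda>y. lsin (x - y))" "set_integrable lborel {0..pi} (\<lambda>y. lsin (x + y))"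
    by (intro set_integrable_lsin_shift; simp)+
  show ?thesis
    unfolding fold_kern_def[abs_def]
    by (intro set_integral_diff(1) set_integrable_mult_right i j)
qed

lemma borel_measurable_fold_kern [measurable]: "fold_kern x \<in> borel_measurable borel"
  unfolding fold_kern_def[abs_def] by measurable

lemma set_integrable_fold_kern_mult:
  assumes "even_wave u" "a \<in> {0..pi}" "b \<le> pi"
  shows "set_integrable lborel {a..b} (\<lambda>y. fold_kern x y * u y)"
proof -
  obtain M where M: "\<And>x. \<bar>u x\<bar> \<le> M" using even_wave_bounded[OF assms(1)] by blast
  show ?thesis
    by (rule set_integrable_subinterval[of 0 pi])
       (use assms(2,3) M even_waveD(5)[OF assms(1)] in \<open>auto intro!: set_integrable_mult_bounded[where B = M] set_integrable_fold_kern\<close>)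
qed

lemma pot_rise_fold:
  assumes u: "even_wave u"
  shows "pot_rise u x = (LBINT y:{0..pi}. fold_kern x y * u y)"
proof -
  define f where "f y = (lsin (0 - y) - lsin (x - y)) * u y" for y
  have int: "set_integrable lborel {-pi..pi} (\<lambda>y. lsin (z - y) * u y)" for z
    by (rule set_integrable_lsin_mult[OF u]) simp
  have "lsin (z - (y + 2 * pi)) = lsin (z - y)" for z y
    using lsin_add_2pi[of "z - (y + 2 * pi)"] by (simp add: algebra_simps)
  then have per: "two_pi_periodic f"
    using even_waveD(4)[OF u] by (simp add: two_pi_periodic_def f_def del: diff_0)
  have fint: "set_integrable lborel {-pi..pi} f"
    unfolding f_def left_diff_distrib by (rule set_integral_diff(1)[OF int int])
  have "pot_rise u x = (LBINT y:{-pi..pi}. f y)"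
    unfolding f_def log_pot_def pot_rise_def left_diff_distrib using set_integral_diff(2)[OF int[of 0] int[of x]] by simp
  also have "\<dots> = (LBINT s:{0..pi}. f (0 + s) + f (0 - s))"
    by (rule set_integral_periodic_fold[OF per fint])
  also have "(\<lambda>s. f (0 + s) + f (0 - s)) = (\<lambda>s. fold_kern x s * u s)"
  proof
    fix s
    show "f (0 + s) + f (0 - s) = fold_kern x s * u s"
      using even_waveD(3)[OF u, of s] by (simp add: f_def fold_kern_def algebra_simps)
  qed
  finally show ?thesis .
qed

text \<open>The formula \<open>sin ((x + y) / 2) * sin ((x - y) / 2) = sin (x / 2) ^ 2 - sin (y / 2)
  ^ 2\<close> merges the logarithms into one. The periodic kernel thus takes the form of its
  counterpart on the line, - ln \<bar>1 - x^2 / y^2\<bar>, with \<open>sin_ratio x y\<close> in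
  place of x^2 / y^2.\<close>

lemma fold_kern_eq:
  assumes x: "0 < x" "x \<le> pi / 4" and y: "0 < y" "y \<le> pi" "y \<noteq> x"
  shows "fold_kern x y = - ln \<bar>1 - sin_ratio x y\<bar>" "sin_ratio x y \<noteq> 1"
proof -
  have id: "sin ((x + y) / 2) * sin ((x - y) / 2) = sin (x / 2) ^ 2 - sin (y / 2) ^ 2"
    using sin_half_sq_diff[of "(x + y) / 2 + (x - y) / 2" "0"] sin_times_sin[of "(x + y) / 2" "(x - y) / 2"]
    by (simp add: sin_squared_eq_half field_simps)
  have s1: "0 < sin (y / 2)" using y by (intro sin_gt_zero) auto
  have s2: "sin ((x + y) / 2) \<noteq> 0" using sin_gt_zero[of "(x + y) / 2"] x y by auto
  have s3: "sin ((x - y) / 2) \<noteq> 0" using sin_eq_0_pi[of "(x - y) / 2"] x y by auto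
  have ne: "sin (x / 2) ^ 2 - sin (y / 2) ^ 2 \<noteq> 0" unfolding id[symmetric] using s2 s3 by simp
  then show "sin_ratio x y \<noteq> 1" using s1 by (simp add: sin_ratio_def)
  have "1 - sin_ratio x y = - ((sin (x / 2) ^ 2 - sin (y / 2) ^ 2) / sin (y / 2) ^ 2)"
    using s1 by (simp add: sin_ratio_def field_simps)
  then have "\<bar>1 - sin_ratio x y\<bar> = \<bar>sin ((x + y) / 2)\<bar> * \<bar>sin ((x - y) / 2)\<bar> / \<bar>sin (y / 2)\<bar> ^ 2"
    unfolding id[symmetric] by (simp add: abs_mult abs_divide)
  then have "ln \<bar>1 - sin_ratio x y\<bar> = lsin (x + y) + lsin (x - y) - 2 * lsin y"
    using s1 s2 s3 by (simp add: ln_div ln_mult ln_realpow lsin_def)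
  then show "fold_kern x y = - ln \<bar>1 - sin_ratio x y\<bar>" by (simp add: fold_kern_def)
qed

section \<open>Comparison of the folded kernel with x^2 / y^2\<close>

lemma sin_cubic_lower: "0 \<le> z \<Longrightarrow> z - z ^ 3 / 6 \<le> sin (z::real)"
proof -
  assume z: "0 \<le> z"
  have "\<bar>sin z - (\<Sum>m<3. sin_coeff m * z ^ m)\<bar> \<le> inverse (fact 3) * \<bar>z\<bar> ^ 3"
    by (rule Maclaurin_sin_bound)
  then have "\<bar>sin z - z\<bar> \<le> z ^ 3 / 6" using z by (simp add: sin_coeff_def eval_nat_numeral)
  then show ?thesis by linarith
qed

text \<open>With \<open>w = z ^ 2\<close> and the cubic lower bound for the sine it suffices that
  \<open>(1 - w / 6) ^ 2 * (1 + w) \<ge> 1\<close>. The difference of the two sides is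
  \<open>w * ((w - 3) * (w - 8)) / 36\<close>, nonnegative for w in [0, 3].\<close>

lemma inverse_sin_sq_le:
  assumes z: "0 < z" "z \<le> pi / 2"
  shows "1 / sin z ^ 2 \<le> 1 / z ^ 2 + 1"
proof -
  define w where "w = z ^ 2"
  have w0: "0 < w" using z by (simp add: w_def)
  have "z * z \<le> 1.6 * 1.6" using z pi_approx by (intro mult_mono) auto
  then have w: "w \<le> 3" by (simp add: w_def power2_eq_square)
  have "z - z ^ 3 / 6 = z * (1 - w / 6)" by (simp add: w_def power2_eq_square power3_eq_cube algebra_simps)
  then have low: "z * (1 - w / 6) \<le> sin z" "0 \<le> z * (1 - w / 6)" using sin_cubic_lower[of z] z w by auto
  have "w * (1 - w / 6) ^ 2 = (z * (1 - w / 6)) ^ 2" by (simp add: w_def power_mult_distrib)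
  also have "\<dots> \<le> sin z ^ 2" using low by (intro power_mono)
  finally have s: "w * (1 - w / 6) ^ 2 \<le> sin z ^ 2" .
  have pos: "0 < w * (1 - w / 6) ^ 2" using w0 w by simp
  have "0 \<le> w * ((w - 3) * (w - 8)) / 36" using w w0 by (intro divide_nonneg_pos mult_nonneg_nonneg mult_nonpos_nonpos) auto
  then have "1 \<le> (1 - w / 6) ^ 2 * (1 + w)" by (simp add: power2_eq_square field_simps)
  then have "w * 1 \<le> w * ((1 - w / 6) ^ 2 * (1 + w))" using w0 by (intro mult_left_mono) auto
  then have "1 / (w * (1 - w / 6) ^ 2) \<le> 1 / w + 1" using w0 pos by (simp add: divide_simps split: if_splits) (simp add: algebra_simps)
  moreover have "1 / sin z ^ 2 \<le> 1 / (w * (1 - w / 6) ^ 2)"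
    using s pos less_le_trans[OF pos s] by (intro divide_left_mono mult_pos_pos[OF _ pos]) auto
  ultimately show ?thesis by (simp add: w_def)
qed

lemma sin_half_sq_le: "sin (x / 2) ^ 2 \<le> x ^ 2 / (4::real)"
  using power_mono[OF abs_sin_x_le_abs_x[of "x / 2"], of 2] by (simp add: power_divide)

text \<open>The errors in the first two bounds are multiples of x^2 without the factor 1 / y^2, so
  their integrals against \<open>u\<close> remain O(x^2). The third has the right order but not the
  right constant and serves the quadratic term of the logarithm.\<close>

lemma sin_ratio_bounds:
  assumes x: "0 < x" and y: "x \<le> y" "y \<le> pi"
  shows "x ^ 2 / y ^ 2 - x ^ 2 \<le> sin_ratio x y" "sin_ratio x y \<le> x ^ 2 / y ^ 2 + x ^ 2 / 4"
    "sin_ratio x y \<le> 5 / 2 * (x ^ 2 / y ^ 2)"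
proof -
  have y0: "0 < y" using x y by linarith
  have sy: "0 < sin (y / 2)" using y0 y by (intro sin_gt_zero) auto
  have inv: "1 / sin (y / 2) ^ 2 \<le> 4 / y ^ 2 + 1"
    using inverse_sin_sq_le[of "y / 2"] y0 y by (simp add: power_divide)
  have "sin_ratio x y \<le> x ^ 2 / 4 * (1 / sin (y / 2) ^ 2)"
    unfolding sin_ratio_def using mult_right_mono[OF sin_half_sq_le[of x], of "1 / sin (y / 2) ^ 2"] by simp
  also have "\<dots> \<le> x ^ 2 / 4 * (4 / y ^ 2 + 1)" by (intro mult_left_mono inv) simp
  also have "\<dots> = x ^ 2 / y ^ 2 + x ^ 2 / 4" by (simp add: algebra_simps)
  finally show "sin_ratio x y \<le> x ^ 2 / y ^ 2 + x ^ 2 / 4" .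
  show "sin_ratio x y \<le> 5 / 2 * (x ^ 2 / y ^ 2)"
  proof -
    have "(y / pi) ^ 2 \<le> sin (y / 2) ^ 2" using sin_half_lower[of y] y0 y by (intro power_mono) auto
    then have "sin_ratio x y \<le> (x ^ 2 / 4) / (y / pi) ^ 2"
      unfolding sin_ratio_def using y0 sin_half_sq_le[of x] by (intro frac_le) auto
    also have "\<dots> = pi ^ 2 / 4 * (x ^ 2 / y ^ 2)" by (simp add: power_divide)
    also have "\<dots> \<le> 5 / 2 * (x ^ 2 / y ^ 2)"
    proof (rule mult_right_mono)
      have "pi * pi \<le> 3.15 * 3.15" using pi_approx by (intro mult_mono) auto
      then show "pi ^ 2 / 4 \<le> 5 / 2" by (simp add: power2_eq_square)
    qed simp
    finally show ?thesis .
  qed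
  show "x ^ 2 / y ^ 2 - x ^ 2 \<le> sin_ratio x y"
  proof (cases "x \<le> 1")
    case True
    have "x / 2 - (x / 2) ^ 3 / 6 = x / 2 * (1 - x ^ 2 / 24)" by (simp add: power2_eq_square power3_eq_cube algebra_simps)
    then have low: "x / 2 * (1 - x ^ 2 / 24) \<le> sin (x / 2)" using sin_cubic_lower[of "x / 2"] x by simp
    have "x ^ 2 \<le> 1" using True x by (simp add: power_le_one)
    then have "0 \<le> x / 2 * (1 - x ^ 2 / 24)" using x by simp
    then have "(x / 2 * (1 - x ^ 2 / 24)) ^ 2 \<le> sin (x / 2) ^ 2" using low by (intro power_mono)
    moreover have "x ^ 2 / 4 * (1 - x ^ 2 / 12) \<le> (x / 2 * (1 - x ^ 2 / 24)) ^ 2"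
    proof -
      have "(1 - x ^ 2 / 24) ^ 2 = 1 - x ^ 2 / 12 + (x ^ 2 / 24) ^ 2" by (simp add: power2_eq_square algebra_simps)
      then have "1 - x ^ 2 / 12 \<le> (1 - x ^ 2 / 24) ^ 2" using zero_le_power2[of "x ^ 2 / 24"] by linarith
      then have "x ^ 2 / 4 * (1 - x ^ 2 / 12) \<le> x ^ 2 / 4 * (1 - x ^ 2 / 24) ^ 2" by (intro mult_left_mono) auto
      then show ?thesis by (simp add: power_mult_distrib power_divide)
    qed
    ultimately have sx: "x ^ 2 / 4 * (1 - x ^ 2 / 12) \<le> sin (x / 2) ^ 2" by linarith
    have "(x ^ 2 / 4 * (1 - x ^ 2 / 12)) / (y ^ 2 / 4) \<le> sin_ratio x y"
      unfolding sin_ratio_def using sx sy sin_half_sq_le[of y] \<open>x ^ 2 \<le> 1\<close>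
      by (intro frac_le) auto
    moreover have "(x ^ 2 / 4 * (1 - x ^ 2 / 12)) / (y ^ 2 / 4) = x ^ 2 / y ^ 2 - x ^ 2 / 12 * (x ^ 2 / y ^ 2)"
      by (simp add: algebra_simps diff_divide_distrib)
    moreover have "x ^ 2 / 12 * (x ^ 2 / y ^ 2) \<le> x ^ 2 * 1"
      using x y y0 by (intro mult_mono) (auto intro: power_mono)
    ultimately show ?thesis by linarith
  next
    case False
    have "x ^ 2 / y ^ 2 \<le> x ^ 2 / 1" using False y by (intro divide_left_mono) (auto simp: one_le_power)
    moreover have "0 \<le> sin_ratio x y" by (simp add: sin_ratio_def)
    ultimately show ?thesis by simp
  qed
qed

lemma fold_kern_lower:
  assumes "0 < x" "x \<le> pi / 4" "x < y" "y \<le> pi"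
  shows "x ^ 2 / y ^ 2 - x ^ 2 \<le> fold_kern x y"
proof -
  have "sin (x / 2) < sin (y / 2)" using assms by (intro sin_monotone_2pi) auto
  moreover have "0 < sin (x / 2)" using assms by (intro sin_gt_zero) auto
  ultimately have "sin_ratio x y < 1" by (simp add: sin_ratio_def power_strict_mono)
  then have "sin_ratio x y \<le> fold_kern x y"
    using fold_kern_eq(1)[of x y] ln_le_minus_one[of "1 - sin_ratio x y"] assms by simp
  then show ?thesis using sin_ratio_bounds(1)[of x y] assms by linarith
qed

text \<open>\<open>2 * x \<le> y\<close> makes the ratio \<open>q\<close> at most 1/2:
  \<open>sin (y / 2) \<ge> sin x = 2 * sin (x / 2) * cos (x / 2)\<close>, and the cosine is at least
  sqrt 2 / 2. On that range \<open>- ln (1 - q) \<le> q + 2 * q ^ 2\<close>; the 13 rounds up 2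
  times 25/4.\<close>

lemma fold_kern_upper:
  assumes "0 < x" "x \<le> pi / 4" "2 * x \<le> y" "y \<le> pi"
  shows "fold_kern x y \<le> x ^ 2 / y ^ 2 + x ^ 2 / 4 + 13 * (x ^ 4 / y ^ 4)"
proof -
  define q where "q = sin_ratio x y"
  have q0: "0 \<le> q" by (simp add: q_def sin_ratio_def)
  have "sin x \<le> sin (y / 2)" using assms by (intro sin_monotone_2pi_le) auto
  moreover have "sin x = 2 * sin (x / 2) * cos (x / 2)" using sin_double[of "x / 2"] by simp
  ultimately have s: "2 * sin (x / 2) * cos (x / 2) \<le> sin (y / 2)" by simp
  have sx: "0 < sin (x / 2)" using assms by (intro sin_gt_zero) auto
  have "cos (pi / 4) \<le> cos (x / 2)" using assms by (intro cos_monotone_0_pi_le) auto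
  then have c: "sqrt 2 / 2 \<le> cos (x / 2)" by (simp add: cos_45)
  have "sqrt 2 * sin (x / 2) \<le> 2 * sin (x / 2) * cos (x / 2)" using mult_right_mono[of "sqrt 2" "2 * cos (x / 2)" "sin (x / 2)"] c sx
    by (simp add: mult_ac)
  then have "(sqrt 2 * sin (x / 2)) ^ 2 \<le> sin (y / 2) ^ 2" using order_trans[OF _ s] sx by (intro power_mono) auto
  then have "2 * sin (x / 2) ^ 2 \<le> sin (y / 2) ^ 2" by (simp add: power_mult_distrib)
  moreover have "0 < sin (y / 2)" using assms by (intro sin_gt_zero) auto
  ultimately have qh: "q \<le> 1 / 2" by (simp add: q_def sin_ratio_def field_simps)
  have "fold_kern x y = - ln (1 - q)" using fold_kern_eq(1)[of x y] assms qh by (simp add: q_def)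
  also have "\<dots> \<le> q + 2 * q ^ 2" using ln_one_minus_pos_lower_bound[OF q0 qh] by simp
  finally have *: "fold_kern x y \<le> q + 2 * q ^ 2" .
  have "q ^ 2 \<le> (5 / 2 * (x ^ 2 / y ^ 2)) ^ 2"
    using sin_ratio_bounds(3)[of x y] q0 assms by (intro power_mono) (auto simp: q_def)
  also have "\<dots> = 25 / 4 * (x ^ 4 / y ^ 4)" by (simp add: power_mult_distrib power_divide flip: power_mult)
  finally have "q ^ 2 \<le> 25 / 4 * (x ^ 4 / y ^ 4)" .
  moreover have "0 \<le> x ^ 4 / y ^ 4" by simp
  ultimately have "2 * q ^ 2 \<le> 13 * (x ^ 4 / y ^ 4)" by linarith
  moreover have "q \<le> x ^ 2 / y ^ 2 + x ^ 2 / 4" using sin_ratio_bounds(2)[of x y] assms by (simp add: q_def)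
  ultimately show ?thesis using * by linarith
qed

lemma ln_le_powr_quarter: "0 < r \<Longrightarrow> ln r \<le> 4 * r powr (1/4)" for r :: real
  using ln_le_minus_one[of "r powr (1/4)"] by (simp add: ln_powr)

text \<open>The argument \<open>t\<close> of the logarithm is large near \<open>y = 0\<close> and
  small near \<open>y = x\<close>. It is controlled by the homogeneous bounds
  \<open>t \<le> 16 * (x / y) ^ 2\<close> and \<open>1 / t \<le> 8 * x / \<bar>x - y\<bar>\<close>;
  applying ln r \<le> r to a root of each gives integrable powers.\<close>

lemma abs_fold_kern_near:
  assumes x: "0 < x" "x \<le> pi / 4" and y: "0 < y" "y \<le> 2 * x" "y \<noteq> x"
  shows "\<bar>fold_kern x y\<bar> \<le> 8 * x powr (1/2) * y powr (-1/2) + 8 * x powr (1/4) * \<bar>x - y\<bar> powr (-1/4)"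
proof -
  define t where "t = \<bar>1 - sin_ratio x y\<bar>"
  have y2: "y \<le> pi" using x y by linarith
  have t0: "0 < t" and k: "fold_kern x y = - ln t" using fold_kern_eq[OF x y(1) y2 y(3)] by (auto simp: t_def)
  have sy: "0 < sin (y / 2)" using y y2 by (intro sin_gt_zero) auto
  have upper: "t \<le> 16 * (x / y) ^ 2"
  proof -
    have "t \<le> 1 + sin_ratio x y" using zero_le_divide_iff[of "sin (x / 2) ^ 2" "sin (y / 2) ^ 2"] by (simp add: t_def sin_ratio_def abs_le_iff)
    also have "sin_ratio x y \<le> (x ^ 2 / 4) / (y / pi) ^ 2"
      unfolding sin_ratio_def using sin_half_sq_le[of x] sin_half_lower[of y] y y2
      by (intro frac_le power_mono) auto
    also have "(x ^ 2 / 4) / (y / pi) ^ 2 = pi ^ 2 / 4 * (x / y) ^ 2" by (simp add: power_divide)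
    also have "1 \<le> 4 * (x / y) ^ 2"
    proof -
      have "1 \<le> 2 * (x / y)" using y by (simp add: field_simps)
      then have "1 ^ 2 \<le> (2 * (x / y)) ^ 2" by (intro power_mono) auto
      then show ?thesis by (simp add: power_mult_distrib power_divide)
    qed
    also have "pi ^ 2 / 4 * (x / y) ^ 2 \<le> 12 * (x / y) ^ 2"
    proof (rule mult_right_mono)
      have "pi * pi \<le> 4 * 4" using pi_less_4 by (intro mult_mono) auto
      then show "pi ^ 2 / 4 \<le> 12" by (simp add: power2_eq_square)
    qed simp
    finally show ?thesis by simp
  qed
  have lower: "1 / t \<le> 8 * x / \<bar>x - y\<bar>"
  proof -
    have p: "0 < sin ((x + y) / 2)" using x y by (intro sin_gt_zero) auto
    have d: "\<bar>x - y\<bar> / pi \<le> \<bar>sin ((x - y) / 2)\<bar>"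
    proof -
      have "\<bar>sin ((x - y) / 2)\<bar> = \<bar>sin (\<bar>x - y\<bar> / 2)\<bar>"
      proof (cases "y \<le> x")
        case False
        then have "(x - y) / 2 = - (\<bar>x - y\<bar> / 2)" by linarith
        then show ?thesis by (simp only: sin_minus abs_minus_cancel)
      qed simp
      moreover have "\<bar>x - y\<bar> \<le> pi" using x y by linarith
      ultimately show ?thesis using sin_half_lower[of "\<bar>x - y\<bar>"] by linarith
    qed
    have d0: "0 < \<bar>x - y\<bar> / pi" using y by simp
    then have q: "0 < \<bar>sin ((x - y) / 2)\<bar>" using d by linarith
    have "- ln t = ln (sin (y / 2) ^ 2 / (\<bar>sin ((x - y) / 2)\<bar> * sin ((x + y) / 2)))"
      using p q sy by (simp add: ln_div ln_mult ln_realpow k[symmetric] fold_kern_def lsin_def)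
    then have "ln (1 / t) = ln (sin (y / 2) ^ 2 / (\<bar>sin ((x - y) / 2)\<bar> * sin ((x + y) / 2)))"
      using t0 by (simp add: ln_div)
    then have "1 / t = sin (y / 2) ^ 2 / (\<bar>sin ((x - y) / 2)\<bar> * sin ((x + y) / 2))"
      using p q sy t0 by (subst (asm) ln_inj_iff) (auto intro!: divide_pos_pos mult_pos_pos)
    also have "\<dots> \<le> (y ^ 2 / 4) / ((\<bar>x - y\<bar> / pi) * ((x + y) / pi))"
      using sin_half_sq_le[of y] d d0 sin_half_lower[of "x + y"] x y p
      by (intro frac_le mult_mono mult_pos_pos) auto
    also have "\<dots> = pi ^ 2 / 4 * (y ^ 2 / (\<bar>x - y\<bar> * (x + y)))" by (simp add: power2_eq_square)
    also have "\<dots> \<le> 4 * (2 * x / \<bar>x - y\<bar>)"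
    proof (rule mult_mono)
      have "pi * pi \<le> 4 * 4" using pi_less_4 by (intro mult_mono) auto
      then show "pi ^ 2 / 4 \<le> 4" by (simp add: power2_eq_square)
      have "y * y \<le> 2 * x * (x + y)" using x y by (intro mult_mono) auto
      then show "y ^ 2 / (\<bar>x - y\<bar> * (x + y)) \<le> 2 * x / \<bar>x - y\<bar>"
        using x y by (simp add: power2_eq_square divide_simps)
    qed (use x y in auto)
    finally show ?thesis by simp
  qed
  have two: "8 powr (1/4) \<le> (2::real)"
  proof -
    have "8 powr (1/4) \<le> (2 powr 4) powr (1/4 :: real)" by (rule powr_mono2) auto
    then show ?thesis by (simp only: powr_powr) simp
  qed
  have "ln t \<le> ln (16 * (x / y) ^ 2)" by (intro ln_mono upper t0)
  also have "\<dots> = 2 * ln (4 * (x / y))"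
    using x y ln_realpow[of "4 * (x / y)" 2] by (simp add: power_mult_distrib power_divide)
  also have "\<dots> = 4 * ln ((4 * (x / y)) powr (1/2))" using x y by (simp add: ln_powr)
  also have "\<dots> \<le> 4 * (4 * (x / y)) powr (1/2)"
    using ln_le_minus_one[of "(4 * (x / y)) powr (1/2)"] x y by simp
  also have "\<dots> = 8 * (x powr (1/2) * y powr (-1/2))"
    using x y by (simp add: powr_mult powr_divide powr_minus_divide powr_half_sqrt)
  finally have A: "ln t \<le> 8 * (x powr (1/2) * y powr (-1/2))" .
  have "- ln t = ln (1 / t)" using t0 by (simp add: ln_div)
  also have "\<dots> \<le> ln (8 * x / \<bar>x - y\<bar>)" by (intro ln_mono lower) (use t0 in simp)
  also have "\<dots> \<le> 4 * (8 * x / \<bar>x - y\<bar>) powr (1/4)"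
    using x y by (intro ln_le_powr_quarter) auto
  also have "\<dots> = 4 * 8 powr (1/4) * (x powr (1/4) * \<bar>x - y\<bar> powr (-1/4))"
    using x y by (simp add: powr_mult powr_divide powr_minus_divide)
  also have "\<dots> \<le> 4 * 2 * (x powr (1/4) * \<bar>x - y\<bar> powr (-1/4))"
    using two by (intro mult_right_mono) auto
  finally have B: "- ln t \<le> 8 * (x powr (1/4) * \<bar>x - y\<bar> powr (-1/4))" by simp
  have "0 \<le> 8 * (x powr (1/2) * y powr (-1/2))" "0 \<le> 8 * (x powr (1/4) * \<bar>x - y\<bar> powr (-1/4))" by auto
  with A B show ?thesis unfolding k abs_minus_cancel mult.assoc by linarith
qed

text \<open>The majorant is homogeneous of degree 0 in x and y, so its integral is a multiple of
  \<open>x\<close>; 16 sqrt 2 + 64/3 is less than 45.\<close>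

lemma set_integral_abs_fold_kern_near:
  assumes x: "0 < x" "x \<le> pi / 4"
  shows "(LBINT y:{0..2 * x}. \<bar>fold_kern x y\<bar>) \<le> 45 * x"
proof -
  define g where "g y = 8 * x powr (1/2) * y powr (-1/2) + 8 * x powr (1/4) * \<bar>x - y\<bar> powr (-1/4)" for y
  have p1: "set_integrable lborel {0..2 * x} (\<lambda>y. y powr (-1/2))"
    "(LBINT y:{0..2 * x}. y powr (-1/2)) = 2 * (2 * x) powr (1/2)"
    using set_integral_powr[of "-1/2" "2 * x"] x by auto
  have q: "set_integrable lborel {0..x} (\<lambda>z. \<bar>z\<bar> powr (-1/4))" "(LBINT z:{0..x}. \<bar>z\<bar> powr (-1/4)) = 4 / 3 * x powr (3/4)"
  proof -
    have "set_integrable lborel {0..x} (\<lambda>z. \<bar>z\<bar> powr (-1/4)) = set_integrable lborel {0..x} (\<lambda>z. z powr (-1/4))"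
      by (rule set_integrable_cong) auto
    moreover have "(LBINT z:{0..x}. \<bar>z\<bar> powr (-1/4)) = (LBINT z:{0..x}. z powr (-1/4))"
      by (rule set_lebesgue_integral_cong) auto
    ultimately show "set_integrable lborel {0..x} (\<lambda>z. \<bar>z\<bar> powr (-1/4))" "(LBINT z:{0..x}. \<bar>z\<bar> powr (-1/4)) = 4 / 3 * x powr (3/4)"
      using set_integral_powr[of "-1/4" x] x by auto
  qed
  have l: "set_integrable lborel {0..x} (\<lambda>y. \<bar>x - y\<bar> powr (-1/4))"
    "(LBINT y:{0..x}. \<bar>x - y\<bar> powr (-1/4)) = 4 / 3 * x powr (3/4)"
  proof -
    show "set_integrable lborel {0..x} (\<lambda>y. \<bar>x - y\<bar> powr (-1/4))"
      "(LBINT y:{0..x}. \<bar>x - y\<bar> powr (-1/4)) = 4 / 3 * x powr (3/4)"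
      using set_integrable_reflect[of 0 x "\<lambda>y. \<bar>x - y\<bar> powr (-1/4)" x]
        set_integral_reflect[of 0 x "\<lambda>y. \<bar>x - y\<bar> powr (-1/4)" x] q by simp_all
  qed
  have r: "set_integrable lborel {x..2 * x} (\<lambda>y. \<bar>x - y\<bar> powr (-1/4))"
    "(LBINT y:{x..2 * x}. \<bar>x - y\<bar> powr (-1/4)) = 4 / 3 * x powr (3/4)"
  proof -
    show "set_integrable lborel {x..2 * x} (\<lambda>y. \<bar>x - y\<bar> powr (-1/4))"
      "(LBINT y:{x..2 * x}. \<bar>x - y\<bar> powr (-1/4)) = 4 / 3 * x powr (3/4)"
      using set_integrable_shift[of x "2 * x" "\<lambda>y. \<bar>x - y\<bar> powr (-1/4)" x]
        set_integral_shift[of x "2 * x" "\<lambda>y. \<bar>x - y\<bar> powr (-1/4)" x] q by simp_all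
  qed
  have p2: "set_integrable lborel {0..2 * x} (\<lambda>y. \<bar>x - y\<bar> powr (-1/4))"
    "(LBINT y:{0..2 * x}. \<bar>x - y\<bar> powr (-1/4)) = 8 / 3 * x powr (3/4)"
    using set_integral_combine_Icc[OF _ _ l(1) r(1)] l(2) r(2) x by auto
  have gint: "set_integrable lborel {0..2 * x} g"
    unfolding g_def by (intro set_integral_add(1) set_integrable_mult_right p1(1) p2(1))
  have "(LBINT y:{0..2 * x}. \<bar>fold_kern x y\<bar>) \<le> (LBINT y:{0..2 * x}. g y)"
  proof (rule set_integral_mono_AE)
    show "set_integrable lborel {0..2 * x} (\<lambda>y. \<bar>fold_kern x y\<bar>)"
      using set_integrable_subinterval[OF set_integrable_abs[OF set_integrable_fold_kern[of x]], of 0 "2 * x"] x by simp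
    show "AE y\<in>{0..2 * x} in lborel. \<bar>fold_kern x y\<bar> \<le> g y"
      using AE_lborel_singleton[of 0] AE_lborel_singleton[of x]
      by eventually_elim (use abs_fold_kern_near[OF x] in \<open>auto simp: g_def\<close>)
  qed (rule gint)
  also have "\<dots> = 8 * x powr (1/2) * (2 * (2 * x) powr (1/2)) + 8 * x powr (1/4) * (8 / 3 * x powr (3/4))"
    unfolding g_def p1(2)[symmetric] p2(2)[symmetric]
    using set_integral_add(2)[OF set_integrable_mult_right[OF p1(1)] set_integrable_mult_right[OF p2(1)]] by simp
  also have "\<dots> = 16 * sqrt 2 * (x powr (1/2) * x powr (1/2)) + 64 / 3 * (x powr (1/4) * x powr (3/4))"
    using x by (simp add: powr_mult powr_half_sqrt real_sqrt_mult)
  also have "\<dots> = 16 * sqrt 2 * x + 64 / 3 * x" using x by (simp flip: powr_add)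
  also have "\<dots> \<le> 16 * (71 / 50) * x + 64 / 3 * x"
  proof -
    have "sqrt 2 \<le> 71 / 50" by (rule real_le_lsqrt) (auto simp: power2_eq_square)
    then show ?thesis using x by simp
  qed
  also have "\<dots> \<le> 45 * x" using x by simp
  finally show ?thesis .
qed

lemma set_integral_FTC:
  fixes F f :: "real \<Rightarrow> real"
  assumes "a \<le> b" "continuous_on {a..b} f"
    and "\<And>x. x \<in> {a..b} \<Longrightarrow> (F has_real_derivative f x) (at x within {a..b})"
  shows "(LBINT x:{a..b}. f x) = F b - F a"
proof -
  have "(f has_integral (F b - F a)) {a..b}"
    using assms by (intro fundamental_theorem_of_calculus) (auto simp: has_real_derivative_iff_has_vector_derivative)
  then show ?thesis
    using set_borel_integral_eq_integral(2)[OF set_integrable_continuous[OF assms(2)]] by (simp add: integral_unique)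
qed

section \<open>Estimates for the wave near the cusp\<close>

context cusped_wave
begin

text \<open>The function \<Psi> of the overview.\<close>

definition tail :: "real \<Rightarrow> real" where
  "tail x = (LBINT y:{x..pi}. u y / y ^ 2)"

lemma continuous_on_div_power: "0 < a \<Longrightarrow> continuous_on {a..b} (\<lambda>y. u y / y ^ n)"
  by (intro continuous_intros even_waveD(1)[OF even_wave]) auto

lemma set_integrable_div_power: "0 < a \<Longrightarrow> set_integrable lborel {a..b} (\<lambda>y. u y / y ^ n)"
  by (intro set_integrable_continuous continuous_on_div_power)

lemma tail_nonneg: "0 < x \<Longrightarrow> 0 \<le> tail x"
  unfolding tail_def
  using set_integral_mono[of lborel "{x..pi}" "\<lambda>_. 0" "\<lambda>y. u y / y ^ 2"] set_integrable_div_power[of x pi 2] nonneg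
  by (simp add: set_integrable_def)

lemma wave_split:
  assumes "0 \<le> z" "z \<le> pi"
  shows "u x ^ 2 = (LBINT y:{0..z}. fold_kern x y * u y) + (LBINT y:{z..pi}. fold_kern x y * u y)"
  unfolding wave_eq pot_rise_fold[OF even_wave]
  by (rule set_integral_combine_Icc(2)) (use assms in \<open>auto intro!: set_integrable_fold_kern_mult even_wave\<close>)

text \<open>\<open>u\<close> increases, so its value at the right end point can be taken out of the
  integral. The lower estimate uses \<open>z = x\<close>, the upper one
  \<open>z = 2 * x\<close>.\<close>

lemma abs_near_integral_le:
  assumes x: "0 < x" "x \<le> pi / 4" and z: "0 \<le> z" "z \<le> 2 * x"
  shows "\<bar>LBINT y:{0..z}. fold_kern x y * u y\<bar> \<le> 45 * x * u z"
proof -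
  have zpi: "z \<le> pi" using x z by linarith
  have i: "set_integrable lborel {0..b} (\<lambda>y. \<bar>fold_kern x y\<bar>)" if "b \<le> pi" for b
    using set_integrable_subinterval[OF set_integrable_abs[OF set_integrable_fold_kern]] that by simp
  have "\<bar>LBINT y:{0..z}. fold_kern x y * u y\<bar> \<le> (LBINT y:{0..z}. \<bar>fold_kern x y * u y\<bar>)"
    using integral_norm_bound[of lborel "\<lambda>s. indicator {0..z} s *\<^sub>R (fold_kern x s * u s)"]
    by (simp add: set_lebesgue_integral_def abs_mult)
  also have "\<dots> \<le> (LBINT y:{0..z}. \<bar>fold_kern x y\<bar> * u z)"
  proof (rule set_integral_mono)
    fix y assume "y \<in> {0..z}"
    then show "\<bar>fold_kern x y * u y\<bar> \<le> \<bar>fold_kern x y\<bar> * u z"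
      using humpD[OF hump, of y z] zpi nonneg[of y] by (auto simp: abs_mult intro!: mult_left_mono)
  qed (use i[OF zpi] zpi in \<open>auto intro!: set_integrable_abs set_integrable_fold_kern_mult even_wave\<close>)
  also have "\<dots> = (LBINT y:{0..z}. \<bar>fold_kern x y\<bar>) * u z" by simp
  also have "\<dots> \<le> (LBINT y:{0..2 * x}. \<bar>fold_kern x y\<bar>) * u z"
  proof (rule mult_right_mono[OF _ nonneg])
    have "(LBINT y:{0..2 * x}. \<bar>fold_kern x y\<bar>) = (LBINT y:{0..z}. \<bar>fold_kern x y\<bar>) + (LBINT y:{z..2 * x}. \<bar>fold_kern x y\<bar>)"
      using z x i[of "2 * x"] by (intro set_integral_combine_Icc(2)) (auto intro: set_integrable_subinterval[OF i[of "2 * x"]])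
    moreover have "0 \<le> (LBINT y:{z..2 * x}. \<bar>fold_kern x y\<bar>)"
      unfolding set_lebesgue_integral_def by (intro Bochner_Integration.integral_nonneg) auto
    ultimately show "(LBINT y:{0..z}. \<bar>fold_kern x y\<bar>) \<le> (LBINT y:{0..2 * x}. \<bar>fold_kern x y\<bar>)" by linarith
  qed
  also have "\<dots> \<le> 45 * x * u z"
    using set_integral_abs_fold_kern_near[OF x] nonneg by (intro mult_right_mono) auto
  finally show ?thesis .
qed

text \<open>\<open>fold_kern_lower\<close> reaches down to \<open>y = x\<close>, so the near part
  ends at \<open>x\<close> and its error contains \<open>u x\<close> itself. After division by
  \<open>x ^ 2\<close> this is a multiple of \<open>u x / x\<close>, the relative error that
  \<open>sqrt_ode_asymptotics\<close> asks for.\<close>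

lemma lower_estimate:
  assumes x: "0 < x" "x \<le> pi / 4"
  shows "x ^ 2 * tail x - 4 * u pi * x ^ 2 - 45 * x * u x \<le> u x ^ 2"
proof -
  have xpi: "x \<le> pi" using x pi_gt_zero by linarith
  have int: "set_integrable lborel {x..pi} (\<lambda>y. x ^ 2 * (u y / y ^ 2))" "set_integrable lborel {x..pi} (\<lambda>y. x ^ 2 * u pi)"
    by (intro set_integrable_mult_right set_integrable_div_power x) (intro set_integrable_continuous continuous_intros)
  have "x ^ 2 * tail x - x ^ 2 * u pi * (pi - x) = (LBINT y:{x..pi}. x ^ 2 * (u y / y ^ 2) - x ^ 2 * u pi)"
    unfolding set_integral_diff(2)[OF int] tail_def set_integral_mult_right using xpi by (simp add: set_integral_const)
  also have "\<dots> \<le> (LBINT y:{x..pi}. fold_kern x y * u y)"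
  proof (rule set_integral_mono_AE)
    show "AE y\<in>{x..pi} in lborel. x ^ 2 * (u y / y ^ 2) - x ^ 2 * u pi \<le> fold_kern x y * u y"
      using AE_lborel_singleton[of x]
    proof eventually_elim
      case (elim y)
      show ?case
      proof
        assume y: "y \<in> {x..pi}"
        have "x ^ 2 * (u y / y ^ 2) - x ^ 2 * u pi \<le> x ^ 2 * (u y / y ^ 2) - x ^ 2 * u y"
          using le_pi[of y] by (intro diff_left_mono mult_left_mono) auto
        also have "\<dots> = (x ^ 2 / y ^ 2 - x ^ 2) * u y" by (simp add: algebra_simps)
        also have "\<dots> \<le> fold_kern x y * u y"
          using fold_kern_lower[OF x, of y] y elim nonneg by (intro mult_right_mono) auto
        finally show "x ^ 2 * (u y / y ^ 2) - x ^ 2 * u pi \<le> fold_kern x y * u y" .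
      qed
    qed
    show "set_integrable lborel {x..pi} (\<lambda>y. fold_kern x y * u y)"
      by (rule set_integrable_fold_kern_mult[OF even_wave]) (use x xpi in auto)
  qed (rule set_integral_diff(1)[OF int])
  finally have far: "x ^ 2 * tail x - x ^ 2 * u pi * (pi - x) \<le> (LBINT y:{x..pi}. fold_kern x y * u y)" .
  have "x ^ 2 * u pi * (pi - x) \<le> x ^ 2 * u pi * 4"
    using x pi_less_4 nonneg[of pi] by (intro mult_left_mono) auto
  then have "x ^ 2 * u pi * (pi - x) \<le> 4 * u pi * x ^ 2" by (simp only: mult_ac)
  moreover have "\<bar>LBINT y:{0..x}. fold_kern x y * u y\<bar> \<le> 45 * x * u x"
    by (rule abs_near_integral_le[OF x]) (use x in auto)
  ultimately show ?thesis using far wave_split[of x x] x xpi by linarith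
qed

text \<open>\<open>fold_kern_upper\<close> holds from \<open>2 * x\<close> on, which brings in
  \<open>u (2 * x)\<close> and the integral of u y / y^4. A growth bound on \<open>u\<close> will
  make both of lower order.\<close>

lemma upper_estimate:
  assumes x: "0 < x" "x \<le> pi / 4"
  shows "u x ^ 2 \<le> x ^ 2 * tail x + u pi * x ^ 2 + 45 * x * u (2 * x) + 13 * x ^ 4 * (LBINT y:{2 * x..pi}. u y / y ^ 4)"
proof -
  have x2: "2 * x \<le> pi" using x by linarith
  have int: "set_integrable lborel {2 * x..pi} (\<lambda>y. x ^ 2 * (u y / y ^ 2))"
    "set_integrable lborel {2 * x..pi} (\<lambda>y. x ^ 2 / 4 * u pi)"
    "set_integrable lborel {2 * x..pi} (\<lambda>y. 13 * x ^ 4 * (u y / y ^ 4))"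
  proof -
    have "0 < 2 * x" using x by simp
    then show "set_integrable lborel {2 * x..pi} (\<lambda>y. x ^ 2 * (u y / y ^ 2))"
      "set_integrable lborel {2 * x..pi} (\<lambda>y. 13 * x ^ 4 * (u y / y ^ 4))"
      by (intro set_integrable_mult_right set_integrable_div_power; assumption)+
    show "set_integrable lborel {2 * x..pi} (\<lambda>y. x ^ 2 / 4 * u pi)"
      by (intro set_integrable_continuous continuous_intros)
  qed
  have "(LBINT y:{2 * x..pi}. fold_kern x y * u y)
      \<le> (LBINT y:{2 * x..pi}. x ^ 2 * (u y / y ^ 2) + x ^ 2 / 4 * u pi + 13 * x ^ 4 * (u y / y ^ 4))"
  proof (rule set_integral_mono)
    fix y assume y: "y \<in> {2 * x..pi}"
    have "fold_kern x y * u y \<le> (x ^ 2 / y ^ 2 + x ^ 2 / 4 + 13 * (x ^ 4 / y ^ 4)) * u y"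
      using fold_kern_upper[OF x, of y] y nonneg by (intro mult_right_mono) auto
    also have "\<dots> = x ^ 2 * (u y / y ^ 2) + x ^ 2 / 4 * u y + 13 * x ^ 4 * (u y / y ^ 4)" by (simp add: algebra_simps)
    also have "\<dots> \<le> x ^ 2 * (u y / y ^ 2) + x ^ 2 / 4 * u pi + 13 * x ^ 4 * (u y / y ^ 4)"
      using le_pi[of y] by (intro add_mono mult_left_mono order_refl) auto
    finally show "fold_kern x y * u y \<le> x ^ 2 * (u y / y ^ 2) + x ^ 2 / 4 * u pi + 13 * x ^ 4 * (u y / y ^ 4)" .
  qed (use x x2 int in \<open>auto intro!: set_integrable_fold_kern_mult even_wave set_integral_add(1)\<close>)
  also have "\<dots> = x ^ 2 * (LBINT y:{2 * x..pi}. u y / y ^ 2) + x ^ 2 / 4 * u pi * (pi - 2 * x)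
      + 13 * x ^ 4 * (LBINT y:{2 * x..pi}. u y / y ^ 4)"
    unfolding set_integral_add(2)[OF set_integral_add(1)[OF int(1,2)] int(3)] set_integral_add(2)[OF int(1,2)]
      set_integral_mult_right
    using x2 by (simp add: set_integral_const)
  finally have far: "(LBINT y:{2 * x..pi}. fold_kern x y * u y)
      \<le> x ^ 2 * (LBINT y:{2 * x..pi}. u y / y ^ 2) + x ^ 2 / 4 * u pi * (pi - 2 * x)
        + 13 * x ^ 4 * (LBINT y:{2 * x..pi}. u y / y ^ 4)" .
  have "x ^ 2 * (LBINT y:{2 * x..pi}. u y / y ^ 2) \<le> x ^ 2 * tail x"
  proof (rule mult_left_mono)
    have "tail x = (LBINT y:{x..2 * x}. u y / y ^ 2) + (LBINT y:{2 * x..pi}. u y / y ^ 2)"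
      unfolding tail_def by (rule set_integral_combine_Icc(2)) (use x x2 in \<open>auto intro: set_integrable_div_power\<close>)
    moreover have "0 \<le> (LBINT y:{x..2 * x}. u y / y ^ 2)"
      unfolding set_lebesgue_integral_def using nonneg by (intro Bochner_Integration.integral_nonneg) auto
    ultimately show "(LBINT y:{2 * x..pi}. u y / y ^ 2) \<le> tail x" by linarith
  qed simp
  moreover have "x ^ 2 / 4 * u pi * (pi - 2 * x) \<le> x ^ 2 / 4 * u pi * 4"
    using x pi_less_4 nonneg[of pi] by (intro mult_left_mono) auto
  moreover have "x ^ 2 / 4 * u pi * 4 = u pi * x ^ 2" by simp
  ultimately have far: "(LBINT y:{2 * x..pi}. fold_kern x y * u y)
      \<le> x ^ 2 * tail x + u pi * x ^ 2 + 13 * x ^ 4 * (LBINT y:{2 * x..pi}. u y / y ^ 4)"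
    using far by linarith
  moreover have "\<bar>LBINT y:{0..2 * x}. fold_kern x y * u y\<bar> \<le> 45 * x * u (2 * x)"
    by (rule abs_near_integral_le[OF x]) (use x in auto)
  ultimately show ?thesis using wave_split[of "2 * x" x] x x2 by linarith
qed

text \<open>The summand 1 keeps it at least 1 up to \<open>x = pi\<close>, so that it can be divided
  by and absorbs constants.\<close>

definition log_scale :: "real \<Rightarrow> real" where
  "log_scale x = 1 + ln (pi / x)"

lemma log_scale_mono: "0 < x \<Longrightarrow> x \<le> y \<Longrightarrow> log_scale y \<le> log_scale x"
  unfolding log_scale_def using pi_gt_zero
  by (intro add_left_mono ln_mono) (auto intro!: divide_pos_pos divide_left_mono)

lemma log_scale_ge_1: "0 < x \<Longrightarrow> x \<le> pi \<Longrightarrow> 1 \<le> log_scale x"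
  by (simp add: log_scale_def)

text \<open>Growth is assumed on [x, pi] only and with an open constant \<open>B\<close>, so that
  the estimate applies at a maximum point before any growth bound is known. Of the 92, 90 come from
  \<open>u (2 * x)\<close> and 2 from the integral of u y / y^4.\<close>

lemma estimate_from_growth:
  assumes x: "0 < x" "x \<le> pi / 4" and B: "0 \<le> B"
    and growth: "\<And>y. x \<le> y \<Longrightarrow> y \<le> pi \<Longrightarrow> u y \<le> B * y * log_scale y"
  shows "u x ^ 2 \<le> x ^ 2 * (tail x + (u pi + 92 * B) * log_scale x)"
    and "tail x \<le> B * log_scale x ^ 2"
proof -
  define l where "l = log_scale x"
  have xpi: "x \<le> pi" "2 * x \<le> pi" using x by auto
  have l1: "1 \<le> l" using log_scale_ge_1 x xpi by (simp add: l_def)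
  have g: "u y \<le> B * y * l" if "x \<le> y" "y \<le> pi" for y
    using growth[OF that] mult_left_mono[OF log_scale_mono[of x y], of "B * y"] B x that by (simp add: l_def)
  have int2: "continuous_on {x..pi} (\<lambda>y. B * l * (1 / y))" and int4: "continuous_on {2 * x..pi} (\<lambda>y. B * l * (1 / y ^ 3))"
    using x by (intro continuous_intros; auto)+
  have "tail x \<le> (LBINT y:{x..pi}. B * l * (1 / y))"
    unfolding tail_def
  proof (rule set_integral_mono)
    fix y assume y: "y \<in> {x..pi}"
    have "u y / y ^ 2 \<le> (B * y * l) / y ^ 2" using g y by (intro divide_right_mono) auto
    then show "u y / y ^ 2 \<le> B * l * (1 / y)" using x y by (simp add: power2_eq_square)
  qed (use x int2 in \<open>auto intro: set_integrable_div_power set_integrable_continuous\<close>)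
  also have "\<dots> = B * l * (LBINT y:{x..pi}. 1 / y)" by (rule set_integral_mult_right)
  also have "(LBINT y:{x..pi}. 1 / y) = ln pi - ln x"
    using x xpi by (intro set_integral_FTC) (auto intro!: continuous_intros derivative_eq_intros)
  also have "\<dots> = ln (pi / x)" using x by (simp add: ln_div)
  also have "B * l * ln (pi / x) \<le> B * l * l" using B l1 by (intro mult_left_mono) (auto simp: l_def log_scale_def)
  finally show "tail x \<le> B * log_scale x ^ 2" by (simp add: l_def power2_eq_square)
  have "(LBINT y:{2 * x..pi}. u y / y ^ 4) \<le> (LBINT y:{2 * x..pi}. B * l * (1 / y ^ 3))"
  proof (rule set_integral_mono)
    fix y assume y: "y \<in> {2 * x..pi}"
    have "u y / y ^ 4 \<le> (B * y * l) / y ^ 4" using g y x by (intro divide_right_mono) auto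
    then show "u y / y ^ 4 \<le> B * l * (1 / y ^ 3)" using x y by (simp add: eval_nat_numeral)
  qed (use x int4 in \<open>auto intro: set_integrable_div_power set_integrable_continuous\<close>)
  also have "\<dots> = B * l * (LBINT y:{2 * x..pi}. 1 / y ^ 3)" by (rule set_integral_mult_right)
  also have "(LBINT y:{2 * x..pi}. 1 / y ^ 3) = (- 1 / (2 * pi ^ 2)) - (- 1 / (2 * (2 * x) ^ 2))"
  proof (rule set_integral_FTC)
    fix y assume y: "y \<in> {2 * x..pi}"
    then show "((\<lambda>y. - 1 / (2 * y ^ 2)) has_real_derivative 1 / y ^ 3) (at y within {2 * x..pi})"
      using x by (auto intro!: derivative_eq_intros simp: eval_nat_numeral field_simps)
  qed (use x xpi in \<open>auto intro!: continuous_intros\<close>)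
  also have "B * l * ((- 1 / (2 * pi ^ 2)) - (- 1 / (2 * (2 * x) ^ 2))) \<le> B * l * (1 / (8 * x ^ 2))"
    using B l1 by (intro mult_left_mono) (auto simp: power_mult_distrib)
  finally have "13 * x ^ 4 * (LBINT y:{2 * x..pi}. u y / y ^ 4) \<le> 13 * x ^ 4 * (B * l * (1 / (8 * x ^ 2)))"
    by (intro mult_left_mono) auto
  also have "\<dots> = 13 / 8 * (B * l * x ^ 2)" using x by (simp add: eval_nat_numeral)
  also have "\<dots> \<le> 2 * (B * l * x ^ 2)" using B l1 by (intro mult_right_mono) auto
  finally have far: "13 * x ^ 4 * (LBINT y:{2 * x..pi}. u y / y ^ 4) \<le> 2 * (B * l * x ^ 2)" .
  have "45 * x * u (2 * x) \<le> 45 * x * (B * (2 * x) * l)"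
    using g[of "2 * x"] x xpi by (intro mult_left_mono) auto
  then have near: "45 * x * u (2 * x) \<le> 90 * (B * l * x ^ 2)" by (simp add: power2_eq_square mult_ac)
  have "u pi * x ^ 2 * 1 \<le> u pi * x ^ 2 * l" using l1 nonneg[of pi] by (intro mult_left_mono) auto
  with upper_estimate[OF x] far near
  have "u x ^ 2 \<le> x ^ 2 * tail x + u pi * x ^ 2 * l + 92 * (B * l * x ^ 2)" by linarith
  then show "u x ^ 2 \<le> x ^ 2 * (tail x + (u pi + 92 * B) * log_scale x)"
    by (simp add: l_def algebra_simps)
qed

lemma growth:
  assumes "0 < x" "x \<le> pi"
  shows "u x \<le> (94 + 2 * u pi) * x * log_scale x"
proof -
  \<comment> \<open>The estimate at a maximum point \<open>z\<close> of \<open>g\<close> on \<open>[x, \<pi>]\<close> only involves values of \<open>u\<close> on \<open>[z, \<pi>]\<close>;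
     it is quadratic in \<open>g z\<close> on the left and linear on the right, uniformly in \<open>x\<close>.\<close>
  define g where "g y = u y / (y * log_scale y)" for y
  have pos: "0 < y * log_scale y" if "x \<le> y" "y \<le> pi" for y
    using log_scale_ge_1[of y] that assms by (intro mult_pos_pos) auto
  have "continuous_on {x..pi} g"
    unfolding g_def log_scale_def
    by (intro continuous_intros even_waveD(1)[OF even_wave]) (use pos assms in \<open>force simp: log_scale_def\<close>)+
  then obtain z where z: "z \<in> {x..pi}" and max: "\<And>y. y \<in> {x..pi} \<Longrightarrow> g y \<le> g z"
    using continuous_attains_sup[of "{x..pi}" g] assms by auto
  define B where "B = g z"
  have z0: "0 < z" using z assms by simp
  have B0: "0 \<le> B" using pos[of z] z nonneg[of z] by (simp add: B_def g_def)
  have gB: "u y \<le> B * y * log_scale y" if "x \<le> y" "y \<le> pi" for y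
    using max[of y] pos[OF that] that by (simp add: B_def g_def pos_divide_le_eq mult.assoc)
  have uz: "u z = B * (z * log_scale z)" 
  proof -
    have "z * log_scale z \<noteq> 0" using pos[of z] z by auto
    then show ?thesis unfolding B_def g_def by (rule nonzero_divide_eq_eq[THEN iffD1, OF _ refl])
  qed
  have l1: "1 \<le> log_scale z" using log_scale_ge_1 z z0 by simp
  \<comment> \<open>For \<open>z \<le> pi / 4\<close> the estimate gives
    \<open>B ^ 2 \<le> 93 * B + u pi\<close>, with 93 = 92 + 1 from the tail; otherwise
    \<open>z \<ge> 1 / 2\<close> and \<open>B \<le> 2 * u z\<close>. The constant covers both
    cases.\<close>
  have "B \<le> 94 + 2 * u pi"
  proof (cases "z \<le> pi / 4")
    case True
    have "u z ^ 2 \<le> z ^ 2 * (tail z + (u pi + 92 * B) * log_scale z)"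
      using estimate_from_growth(1)[OF z0 True B0] gB z by auto
    also have "\<dots> \<le> z ^ 2 * (B * log_scale z ^ 2 + (u pi + 92 * B) * log_scale z ^ 2)"
    proof (intro mult_left_mono add_mono)
      show "tail z \<le> B * log_scale z ^ 2" using estimate_from_growth(2)[OF z0 True B0] gB z by auto
      show "log_scale z \<le> log_scale z ^ 2" using l1 by (simp add: power2_eq_square)
    qed (use B0 nonneg[of pi] in auto)
    also have "\<dots> = (z * log_scale z) ^ 2 * (93 * B + u pi)" by (simp add: power_mult_distrib algebra_simps)
    finally have "(z * log_scale z) ^ 2 * B ^ 2 \<le> (z * log_scale z) ^ 2 * (93 * B + u pi)"
      by (simp add: uz power_mult_distrib mult_ac)
    moreover have "0 < (z * log_scale z) ^ 2" using pos[of z] z by (intro zero_less_power) auto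
    ultimately have sq: "B ^ 2 \<le> 93 * B + u pi" by (rule mult_left_le_imp_le)
    show ?thesis
    proof (rule ccontr)
      assume "\<not> B \<le> 94 + 2 * u pi"
      then have "(94 + u pi) * B < B * B" "1 \<le> B" using nonneg[of pi] by auto
      moreover have "u pi * 1 \<le> u pi * B" using \<open>1 \<le> B\<close> nonneg[of pi] by (intro mult_left_mono)
      ultimately show False using sq by (simp add: power2_eq_square algebra_simps)
    qed
  next
    case False
    have "1 / 2 \<le> z" using False pi_gt3 by simp
    then have "(1 / 2) * 1 \<le> z * log_scale z" using l1 by (intro mult_mono) auto
    then have "B * (1 / 2) \<le> u z" unfolding uz using B0 by (intro mult_left_mono) auto
    then show ?thesis using le_pi[of z] by simp
  qed
  then have "B * (x * log_scale x) \<le> (94 + 2 * u pi) * (x * log_scale x)"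
    using pos[of x] assms by (intro mult_right_mono) auto
  then show ?thesis using gB[of x] assms unfolding mult.assoc by linarith
qed

lemma tail_has_derivative:
  assumes "0 < x" "x < pi"
  shows "(tail has_real_derivative - (u x / x ^ 2)) (at x)"
proof -
  define f where "f y = u y / y ^ 2" for y
  define a where "a = x / 2"
  have a: "0 < a" "a < x" using assms by (auto simp: a_def)
  have cont: "continuous_on {a..pi} f" unfolding f_def by (rule continuous_on_div_power[OF a(1)])
  have "((\<lambda>z. integral {a..z} f) has_real_derivative f x) (at x within {a..pi})"
    by (rule integral_has_real_derivative[OF cont]) (use a assms in auto)
  then have "((\<lambda>z. integral {a..z} f) has_real_derivative f x) (at x)"
    using a assms at_within_Icc_at[of a x pi] by simp
  then have "((\<lambda>z. tail a - integral {a..z} f) has_real_derivative 0 - f x) (at x)"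
    by (intro DERIV_diff DERIV_const)
  then have "(tail has_real_derivative 0 - f x) (at x)"
  proof (rule has_field_derivative_transform_within_open)
    show "open {a<..<pi}" "x \<in> {a<..<pi}" using a assms by auto
    fix z assume z: "z \<in> {a<..<pi}"
    have i: "set_integrable lborel {a..z} f" "set_integrable lborel {z..pi} f"
      unfolding f_def using a z by (auto intro: set_integrable_div_power)
    have "tail a = (LBINT y:{a..z}. f y) + tail z"
      unfolding tail_def f_def[symmetric] by (rule set_integral_combine_Icc(2)) (use z i in auto)
    then show "tail a - integral {a..z} f = tail z"
      using set_borel_integral_eq_integral(2)[OF i(1)] by simp
  qed
  then show ?thesis by (simp add: f_def)
qed

text \<open>At \<open>x = exp (- t)\<close> the function \<open>tail (exp (- t))\<close> has
  derivative \<open>u x / x\<close>, because the factor \<open>x\<close> of the chain rule cancels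
  one power in \<open>u x / x ^ 2\<close>. The wave thus satisfies the hypotheses on
  \<open>P\<close> and \<open>w\<close> in \<open>sqrt_ode_asymptotics\<close>.\<close>

lemma slope_asymptotics:
  obtains A T where "2 \<le> T" "\<And>t. T \<le> t \<Longrightarrow> \<bar>u (exp (- t)) / exp (- t) - t / 2\<bar> \<le> A * sqrt t"
proof -
  \<comment> \<open>The growth constant \<open>94 + 2 * u pi\<close> inserted into
    \<open>estimate_from_growth\<close>; the factor 3 comes from
    \<open>log_scale x \<le> 3 * t\<close>.\<close>
  define C where "C = 3 * (u pi + 92 * (94 + 2 * u pi))"
  define c where "c = sqrt (first_mode u / 40)"
  have M: "0 \<le> u pi" by (rule nonneg)
  have C: "45 \<le> C" "4 * u pi \<le> C" using M by (auto simp: C_def)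
  have small: "exp (- t) \<le> 1 / 3" if "2 \<le> t" for t :: real
  proof -
    have "3 \<le> exp t" using exp_ge_add_one_self[of t] that by linarith
    then show ?thesis by (simp add: exp_minus field_simps)
  qed
  have range: "exp (- t) \<le> pi / 4" "exp (- t) < pi" if "2 \<le> t" for t
    using small[OF that] pi_gt3 by linarith+
  have deriv: "((\<lambda>t. tail (exp (- t))) has_real_derivative u (exp (- t)) / exp (- t)) (at t)" if t: "2 \<le> t" for t
  proof -
    have "((\<lambda>t. exp (- t)) has_real_derivative - exp (- t)) (at t)" by (auto intro!: derivative_eq_intros)
    from DERIV_chain2[OF tail_has_derivative[OF exp_gt_zero range(2)[OF t]] this]
    show ?thesis by (rule DERIV_cong) (simp add: power2_eq_square)
  qed
  obtain A T where "2 \<le> T" "\<And>t. T \<le> t \<Longrightarrow> \<bar>u (exp (- t)) / exp (- t) - t / 2\<bar> \<le> A * sqrt t"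
  proof (rule sqrt_ode_asymptotics[of 2 c C "\<lambda>t. tail (exp (- t))" "\<lambda>t. u (exp (- t)) / exp (- t)"])
    show "0 < c" using mode_pos by (simp add: c_def)
    show "0 \<le> C" using C by simp
    fix t :: real assume t: "2 \<le> t"
    define x where "x = exp (- t)"
    have x: "0 < x" "x \<le> pi / 4" using range[OF t] by (auto simp: x_def)
    have x0: "x \<in> {0..pi}" using x by auto
    show "((\<lambda>t. tail (exp (- t))) has_real_derivative u (exp (- t)) / exp (- t)) (at t)" by (rule deriv[OF t])
    show "0 \<le> tail (exp (- t))" by (rule tail_nonneg) simp
    show "c \<le> u (exp (- t)) / exp (- t)"
      using linear_lower[OF x0] x unfolding x_def[symmetric] c_def by (simp add: field_simps)
    have sq: "(u x / x) ^ 2 = u x ^ 2 / x ^ 2" by (simp add: power_divide)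
    have "tail x - C - C * (u x / x) \<le> tail x - 4 * u pi - 45 * (u x / x)"
      using C nonneg[of x] x by (intro diff_mono mult_right_mono) auto
    also have "\<dots> = (x ^ 2 * tail x - 4 * u pi * x ^ 2 - 45 * x * u x) / x ^ 2"
      using x by (simp add: field_simps power2_eq_square)
    also have "\<dots> \<le> (u x / x) ^ 2" unfolding sq using lower_estimate[OF x] by (intro divide_right_mono) auto
    finally show "tail (exp (- t)) - C - C * (u (exp (- t)) / exp (- t)) \<le> (u (exp (- t)) / exp (- t)) ^ 2"
      by (simp add: x_def)
    have ls: "log_scale x \<le> 3 * t"
    proof -
      have "ln pi \<le> 3" using ln_le_minus_one[of pi] pi_less_4 by simp
      moreover have "log_scale x = 1 + ln pi + t" by (simp add: log_scale_def x_def ln_div)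
      ultimately show ?thesis using t by simp
    qed
    have "(u x / x) ^ 2 \<le> x ^ 2 * (tail x + (u pi + 92 * (94 + 2 * u pi)) * log_scale x) / x ^ 2"
      unfolding sq using M growth x
      by (intro divide_right_mono estimate_from_growth(1)[OF x]) auto
    also have "\<dots> = tail x + (u pi + 92 * (94 + 2 * u pi)) * log_scale x" using x by simp
    also have "\<dots> \<le> tail x + (u pi + 92 * (94 + 2 * u pi)) * (3 * t)"
      using ls M by (intro add_left_mono mult_left_mono) auto
    also have "\<dots> = tail x + C * t" by (simp add: C_def)
    finally show "(u (exp (- t)) / exp (- t)) ^ 2 \<le> tail (exp (- t)) + C * t" by (simp add: x_def)
  qed (use that in auto)
  then show thesis by (rule that)
qed

lemma asymptotics:
  "(\<lambda>x. (c - 2 / pi * u x) - (c + 1 / pi * \<bar>x\<bar> * ln \<bar>x\<bar>)) \<in> O[at 0](\<lambda>x. \<bar>x\<bar> * sqrt \<bar>ln \<bar>x\<bar>\<bar>)"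
proof -
  obtain A T where T: "2 \<le> T" and A: "\<And>t. T \<le> t \<Longrightarrow> \<bar>u (exp (- t)) / exp (- t) - t / 2\<bar> \<le> A * sqrt t"
    using slope_asymptotics by metis
  show ?thesis
  proof (rule bigoI)
    have "eventually (\<lambda>x::real. x \<in> {- exp (- T)<..<exp (- T)}) (at 0)"
      by (intro eventually_at_in_open') auto
    then show "\<forall>\<^sub>F x in at 0. norm ((c - 2 / pi * u x) - (c + 1 / pi * \<bar>x\<bar> * ln \<bar>x\<bar>))
        \<le> 2 / pi * A * norm (\<bar>x\<bar> * sqrt \<bar>ln \<bar>x\<bar>\<bar>)"
      using eventually_neq_at_within[of 0]
    proof eventually_elim
      case (elim x)
      define t where "t = - ln \<bar>x\<bar>"
      have ex: "exp (- t) = \<bar>x\<bar>" using elim by (simp add: t_def)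
      have "exp (- t) < exp (- T)" using elim ex by auto
      then have Tt: "T \<le> t" by simp
      have lnabs: "\<bar>ln \<bar>x\<bar>\<bar> = t" "ln \<bar>x\<bar> = - t" using Tt T by (auto simp: t_def)
      have ux: "u x = u \<bar>x\<bar>" using even_waveD(3)[OF even_wave, of x] by (simp add: abs_if)
      \<comment> \<open>As \<open>t = - ln \<bar>x\<bar>\<close>, the main part t / 2 of the slope
        produces exactly the stated logarithmic term.\<close>
      have "(c - 2 / pi * u x) - (c + 1 / pi * \<bar>x\<bar> * ln \<bar>x\<bar>) = - (2 / pi * \<bar>x\<bar> * (u \<bar>x\<bar> / \<bar>x\<bar> - t / 2))"
        unfolding ux lnabs(2) using elim by (simp add: field_simps)
      then have "norm ((c - 2 / pi * u x) - (c + 1 / pi * \<bar>x\<bar> * ln \<bar>x\<bar>)) = 2 / pi * \<bar>x\<bar> * \<bar>u \<bar>x\<bar> / \<bar>x\<bar> - t / 2\<bar>"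
        by (simp add: abs_mult)
      also have "\<dots> \<le> 2 / pi * \<bar>x\<bar> * (A * sqrt t)"
        using A[OF Tt] unfolding ex by (intro mult_left_mono) auto
      also have "\<dots> = 2 / pi * A * norm (\<bar>x\<bar> * sqrt \<bar>ln \<bar>x\<bar>\<bar>)"
        unfolding lnabs(1) using Tt T by (simp add: abs_mult)
      finally show ?case .
    qed
  qed
qed

end

theorem theorem1p1:
  "\<exists>(c::real) (\<phi>::real \<Rightarrow> real).
     0 < c \<and>
     two_pi_periodic \<phi> \<and>
     continuous_on UNIV \<phi> \<and>
     burgers_hilbert_profile_on (- range (\<lambda>k::int. 2 * pi * of_int k)) c \<phi> \<and>
     (\<lambda>x. \<phi> x - (c + 1 / pi * \<bar>x\<bar> * ln \<bar>x\<bar>)) \<in> O[at 0](\<lambda>x. \<bar>x\<bar> * sqrt \<bar>ln \<bar>x\<bar>\<bar>)"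
proof -
  obtain u where "hump u" "u 0 = 0" "0 < first_mode u" "\<And>x. u x ^ 2 = pot_rise u x"
    using exists_wave by metis
  then interpret cusped_wave u by unfold_locales auto
  define \<phi> where "\<phi> x = 1 - 2 / pi * u x" for x
  have "two_pi_periodic \<phi>" "continuous_on UNIV \<phi>"
    using even_wave by (auto simp: \<phi>_def even_wave_def two_pi_periodic_def intro!: continuous_intros)
  moreover have "burgers_hilbert_profile_on (- range (\<lambda>k::int. 2 * pi * of_int k)) 1 \<phi>"
    unfolding \<phi>_def by (rule profile)
  moreover have "(\<lambda>x. \<phi> x - (1 + 1 / pi * \<bar>x\<bar> * ln \<bar>x\<bar>)) \<in> O[at 0](\<lambda>x. \<bar>x\<bar> * sqrt \<bar>ln \<bar>x\<bar>\<bar>)"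
    unfolding \<phi>_def by (rule asymptotics)
  ultimately show ?thesis by (intro exI[of _ 1] exI[of _ \<phi>]) simp
qed

end
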